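(* (a) Let $\lambda$ be a regular cardinal, $\mathcal A$ a $\lambda$-mono-generated category, $\mathcal B$ a category, and $F:\mathcal A\to\mathcal B$ a functor preserving monomorphisms and $\lambda$-directed colimits of monomorphisms. If a morphism $f$ of $\mathcal A$ is a $\lambda$-embedding, so is $F(f)$. (b) Let $\lambda\geq\kappa$ be infinite cardinals with $\lambda$ regular, $\mathcal A$ a $\lambda$-mono-generated category, $T$ a basic universal theory belonging to the class $\forall_{\lambda\kappa}$, and $F:\mathcal A\to\mathrm{Mod}(T)$ a functor that takes $\lambda$-directed colimits of monomorphisms to colimits. If a morphism $f$ of $\mathcal A$ is a $\lambda$-embedding, so is $F(f)$.
   Context: Regular cardinals are infinite. A $\lambda$-directed diagram is a functor whose domain is a $\lambda$-directed poset (every subset of cardinality $<\lambda$ has an upper bound); a $\lambda$-directed colimit of monomorphisms is a colimit of a $\lambda$-directed diagram all of whose maps are monomorphisms. Preservation of such colimits refers to those that exist in $\mathcal A$; "$F$ takes $\lambda$-directed colimits of monomorphisms to colimits" means that $F$ sends the corresponding colimit cocones to colimit cocones (without requiring $F$ to preserve monomorphisms). An object $G$ of a category $\mathcal A$ is $\lambda$-generated if $\hom(G,-):\mathcal A\to \mathrm{Set}$ preserves those $\lambda$-directed colimits of monomorphisms that exist in $\mathcal A$. The category $\mathcal A$ is $\lambda$-mono-generated if every object of $\mathcal A$ is a colimit of a $\lambda$-directed diagram consisting of monomorphisms and $\lambda$-generated objects. (It is not assumed that all $\lambda$-directed colimits of monomorphisms exist.) A span between objects $X,Y$ is a diagram $X\xleftarrow{x}U\xrightarrow{y}Y$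 with both $x,y$ monomorphisms. A set $\{X\xleftarrow{x_i}U_i\xrightarrow{y_i}Y \mid i\in I\}$ of spans is $\lambda$-dense if it is non-empty and: (back) for all $i\in I$ and every monomorphism $g:G\to X$ with $G$ $\lambda$-generated, there exist $j\in I$ and morphisms $s:G\to U_j$, $w:U_i\to U_j$ with $x_js=g$, $x_jw=x_i$, $y_jw=y_i$; (forth) for all $i\in I$ and every monomorphism $g:G\to Y$ with $G$ $\lambda$-generated, there exist $j\in I$ and morphisms $s:G\to U_j$, $w:U_i\to U_j$ with $y_js=g$, $x_jw=x_i$, $y_jw=y_i$. A morphism $f:X\to Y$ is a $\lambda$-embedding if there is a $\lambda$-dense set $\mathcal S$ of spans between $X$ and $Y$ such that for every monomorphism $g:G\to X$ with $G$ $\lambda$-generated there exist a span $X\xleftarrow{u}U\xrightarrow{v}Y$ in $\mathcal S$ and $t:G\to U$ with $ut=g$ and $vt=fg$. Let $\Sigma$ be a language for $L_{\infty\kappa}$: possibly many-sorted, with relation and function symbols (including constants) of arity less than $\kappa$. Homomorphisms of $\Sigma$-structures are maps preserving the interpretations of function symbols and preserving (not necessarily reflecting) the relations. A basic universal theory in $L_{\infty\kappa}$ is one axiomatized by a set of sentences (no free variables) of the form $\forall\mathbf x(\phi\Rightarrow\psi)$, where $\mathbf x$ is a tuple of fewer than $\kappa$ variables and $\phi,\psi$ are built from atomic formulas (including equations) using arbitrary set-indexed conjunctions $\bigwedge$ and disjunctions $\bigvee$ only (the empty conjunction being $\top$ and the empty disjunction $\bot$). $\forall_{\lambda\kappa}$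 is the class of basic universal theories in $L_{\infty\kappa}$ in which conjunctions $\bigwedge_{i\in I}$ are used only with $|I|<\lambda$ (disjunctions are unrestricted). $\mathrm{Mod}(T)$ is the category of models of $T$ and homomorphisms of $\Sigma$-structures. *)

theory Defs
  imports Main "HOL-Library.FuncSet"
begin

unbundle cardinal_syntax

section \<open>Categories and functors\<close>

record ('o, 'm) cat =
  ob   :: "'o set"
  ar   :: "'m set"
  dm   :: "'m \<Rightarrow> 'o"
  cd   :: "'m \<Rightarrow> 'o"
  idt  :: "'o \<Rightarrow> 'm"
  cmp  :: "'m \<Rightarrow> 'm \<Rightarrow> 'm"  \<comment> \<open>\<open>cmp C g f\<close> is \<open>g\<close> after \<open>f\<close>\<close>

definition hom :: "('o, 'm) cat \<Rightarrow> 'o \<Rightarrow> 'o \<Rightarrow> 'm set" where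
  "hom C X Y = {f \<in> ar C. dm C f = X \<and> cd C f = Y}"

definition category :: "('o, 'm) cat \<Rightarrow> bool" where
  "category C \<longleftrightarrow>
     (\<forall>f \<in> ar C. dm C f \<in> ob C \<and> cd C f \<in> ob C) \<and>
     (\<forall>X \<in> ob C. idt C X \<in> hom C X X) \<and>
     (\<forall>X Y Z f g. f \<in> hom C X Y \<longrightarrow> g \<in> hom C Y Z \<longrightarrow> cmp C g f \<in> hom C X Z) \<and>
     (\<forall>X Y f. f \<in> hom C X Y \<longrightarrow> cmp C f (idt C X) = f \<and> cmp C (idt C Y) f = f) \<and>
     (\<forall>W X Y Z f g h. f \<in> hom C W X \<longrightarrow> g \<in> hom C X Y \<longrightarrow> h \<in> hom C Y Z \<longrightarrow>
        cmp C h (cmp C g f) = cmp C (cmp C h g) f)"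

definition mono_in :: "('o, 'm) cat \<Rightarrow> 'm \<Rightarrow> bool" where
  "mono_in C f \<longleftrightarrow> f \<in> ar C \<and>
     (\<forall>Z. \<forall>u \<in> hom C Z (dm C f). \<forall>v \<in> hom C Z (dm C f). cmp C f u = cmp C f v \<longrightarrow> u = v)"

record ('o, 'm, 'p, 'n) func =
  fo :: "'o \<Rightarrow> 'p"
  fa :: "'m \<Rightarrow> 'n"

definition is_functor ::
  "('o, 'm) cat \<Rightarrow> ('p, 'n) cat \<Rightarrow> ('o, 'm, 'p, 'n) func \<Rightarrow> bool" where
  "is_functor A B F \<longleftrightarrow>
     (\<forall>X \<in> ob A. fo F X \<in> ob B) \<and>
     (\<forall>X Y f. f \<in> hom A X Y \<longrightarrow> fa F f \<in> hom B (fo F X) (fo F Y)) \<and>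
     (\<forall>X \<in> ob A. fa F (idt A X) = idt B (fo F X)) \<and>
     (\<forall>X Y Z f g. f \<in> hom A X Y \<longrightarrow> g \<in> hom A Y Z \<longrightarrow>
        fa F (cmp A g f) = cmp B (fa F g) (fa F f))"

definition func_comp ::
  "('p, 'n, 'q, 'l) func \<Rightarrow> ('o, 'm, 'p, 'n) func \<Rightarrow> ('o, 'm, 'q, 'l) func" where
  "func_comp G F = \<lparr>fo = (\<lambda>X. fo G (fo F X)), fa = (\<lambda>f. fa G (fa F f))\<rparr>"

definition preserves_monos ::
  "('o, 'm) cat \<Rightarrow> ('p, 'n) cat \<Rightarrow> ('o, 'm, 'p, 'n) func \<Rightarrow> bool" where
  "preserves_monos A B F \<longleftrightarrow> (\<forall>f. mono_in A f \<longrightarrow> mono_in B (fa F f))"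


section \<open>Colimits\<close>

definition is_cocone ::
  "('i, 'e) cat \<Rightarrow> ('o, 'm) cat \<Rightarrow> ('i, 'e, 'o, 'm) func \<Rightarrow> 'o \<Rightarrow> ('i \<Rightarrow> 'm) \<Rightarrow> bool" where
  "is_cocone J C D X k \<longleftrightarrow> X \<in> ob C \<and>
     (\<forall>i \<in> ob J. k i \<in> hom C (fo D i) X) \<and>
     (\<forall>i j e. e \<in> hom J i j \<longrightarrow> cmp C (k j) (fa D e) = k i)"

definition is_colimit ::
  "('i, 'e) cat \<Rightarrow> ('o, 'm) cat \<Rightarrow> ('i, 'e, 'o, 'm) func \<Rightarrow> 'o \<Rightarrow> ('i \<Rightarrow> 'm) \<Rightarrow> bool" where
  "is_colimit J C D X k \<longleftrightarrow> is_cocone J C D X k \<and>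
     (\<forall>Y l. is_cocone J C D Y l \<longrightarrow>
        (\<exists>!h. h \<in> hom C X Y \<and> (\<forall>i \<in> ob J. cmp C h (k i) = l i)))"


section \<open>Directed diagrams of monomorphisms\<close>

text \<open>
  Cardinals are represented, as in the library, by cardinal-order relations. A poset is
  given by its order relation \<open>r\<close>; since \<open>r\<close> is reflexive, its underlying set is \<open>Field r\<close>.
\<close>

definition regular_cardinal :: "'k rel \<Rightarrow> bool" where
  "regular_cardinal lam \<longleftrightarrow> Cinfinite lam \<and> regularCard lam"

definition directed_poset :: "'k rel \<Rightarrow> 'u rel \<Rightarrow> bool" where
  "directed_poset lam r \<longleftrightarrow> Partial_order r \<and>
     (\<forall>S \<subseteq> Field r. |S| <o lam \<longrightarrow> (\<exists>b \<in> Field r. \<forall>a \<in> S. (a, b) \<in> r))"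

definition poset_cat :: "'u rel \<Rightarrow> ('u, 'u \<times> 'u) cat" where
  "poset_cat r = \<lparr>ob = Field r, ar = r, dm = fst, cd = snd,
     idt = (\<lambda>i. (i, i)), cmp = (\<lambda>g f. (fst f, snd g))\<rparr>"

definition directed_mono_diagram ::
  "'k rel \<Rightarrow> 'u rel \<Rightarrow> ('o, 'm) cat \<Rightarrow> ('u, 'u \<times> 'u, 'o, 'm) func \<Rightarrow> bool" where
  "directed_mono_diagram lam r C D \<longleftrightarrow> directed_poset lam r \<and>
     is_functor (poset_cat r) C D \<and> (\<forall>e \<in> r. mono_in C (fa D e))"

text \<open>
  The type \<open>'u\<close> plays the role of the universe of small sets: the (small) posets indexing
  directed diagrams are the posets carried by sets of elements of \<open>'u\<close>. It is passed
  explicitly where it does not occur in the types of the other arguments.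
  Only colimits that exist in \<open>A\<close> are considered, and \<open>F\<close> need not preserve monomorphisms.
\<close>

definition takes_directed_mono_colimits_to_colimits ::
  "'u itself \<Rightarrow> 'k rel \<Rightarrow> ('o, 'm) cat \<Rightarrow> ('p, 'n) cat \<Rightarrow> ('o, 'm, 'p, 'n) func \<Rightarrow> bool" where
  "takes_directed_mono_colimits_to_colimits U lam A B F \<longleftrightarrow>
     (\<forall>(r :: 'u rel) D X k.
        directed_mono_diagram lam r A D \<longrightarrow> is_colimit (poset_cat r) A D X k \<longrightarrow>
        is_colimit (poset_cat r) B (func_comp F D) (fo F X) (\<lambda>i. fa F (k i)))"


section \<open>Generated objects\<close>

text \<open>
  The category of sets of elements of \<open>'a\<close>. An arrow is a triple (domain, map, codomain)
  whose map is extensional, that is, \<open>undefined\<close> outside the domain.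
\<close>

definition set_cat :: "('a set, 'a set \<times> ('a \<Rightarrow> 'a) \<times> 'a set) cat" where
  "set_cat = \<lparr>ob = UNIV, ar = {(X, h, Y). h \<in> X \<rightarrow>\<^sub>E Y},
     dm = (\<lambda>(X, h, Y). X), cd = (\<lambda>(X, h, Y). Y),
     idt = (\<lambda>X. (X, \<lambda>x\<in>X. x, X)),
     cmp = (\<lambda>(Y, g, Z) (X, f, Y'). (X, compose X g f, Z))\<rparr>"

text \<open>
  \<open>hom(G, -)\<close> takes values in the sets of arrows of \<open>C\<close>. Using only sets of this type as
  test objects does not change which cocones on hom-sets are colimits: the colimit property in
  the category of sets is detected by maps into a two-element set (and if \<open>'m\<close> has only one
  element, all nonempty directed diagrams of hom-sets are constant).
\<close>

definition hom_functor ::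
  "('o, 'm) cat \<Rightarrow> 'o \<Rightarrow> ('o, 'm, 'm set, 'm set \<times> ('m \<Rightarrow> 'm) \<times> 'm set) func" where
  "hom_functor C G = \<lparr>fo = (\<lambda>X. hom C G X),
     fa = (\<lambda>u. (hom C G (dm C u), \<lambda>g \<in> hom C G (dm C u). cmp C u g, hom C G (cd C u)))\<rparr>"

definition generated_obj :: "'u itself \<Rightarrow> 'k rel \<Rightarrow> ('o, 'm) cat \<Rightarrow> 'o \<Rightarrow> bool" where
  "generated_obj U lam C G \<longleftrightarrow> G \<in> ob C \<and>
     takes_directed_mono_colimits_to_colimits U lam C set_cat (hom_functor C G)"

definition mono_generated_category :: "'u itself \<Rightarrow> 'k rel \<Rightarrow> ('o, 'm) cat \<Rightarrow> bool" where
  "mono_generated_category U lam C \<longleftrightarrow> category C \<and>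
     (\<forall>X \<in> ob C. \<exists>(r :: 'u rel) D k.
        directed_mono_diagram lam r C D \<and>
        (\<forall>i \<in> Field r. generated_obj U lam C (fo D i)) \<and>
        is_colimit (poset_cat r) C D X k)"


section \<open>Dense sets of spans and embeddings\<close>

text \<open>A span is given by its two legs \<open>(x, y)\<close>; its apex is their common domain.\<close>

definition spans :: "('o, 'm) cat \<Rightarrow> 'o \<Rightarrow> 'o \<Rightarrow> ('m \<times> 'm) set" where
  "spans C X Y = {(x, y). mono_in C x \<and> mono_in C y \<and>
     dm C x = dm C y \<and> cd C x = X \<and> cd C y = Y}"

definition dense_spans ::
  "'u itself \<Rightarrow> 'k rel \<Rightarrow> ('o, 'm) cat \<Rightarrow> 'o \<Rightarrow> 'o \<Rightarrow> ('m \<times> 'm) set \<Rightarrow> bool" where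
  "dense_spans U lam C X Y S \<longleftrightarrow> S \<noteq> {} \<and> S \<subseteq> spans C X Y \<and>
     (\<forall>(x, y) \<in> S. \<forall>G g. generated_obj U lam C G \<longrightarrow> g \<in> hom C G X \<longrightarrow> mono_in C g \<longrightarrow>
        (\<exists>(x', y') \<in> S. \<exists>s \<in> hom C G (dm C x'). \<exists>w \<in> hom C (dm C x) (dm C x').
           cmp C x' s = g \<and> cmp C x' w = x \<and> cmp C y' w = y)) \<and>
     (\<forall>(x, y) \<in> S. \<forall>G g. generated_obj U lam C G \<longrightarrow> g \<in> hom C G Y \<longrightarrow> mono_in C g \<longrightarrow>
        (\<exists>(x', y') \<in> S. \<exists>s \<in> hom C G (dm C x'). \<exists>w \<in> hom C (dm C x) (dm C x').
           cmp C y' s = g \<and> cmp C x' w = x \<and> cmp C y' w = y))"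

definition is_embedding :: "'u itself \<Rightarrow> 'k rel \<Rightarrow> ('o, 'm) cat \<Rightarrow> 'm \<Rightarrow> bool" where
  "is_embedding U lam C f \<longleftrightarrow> f \<in> ar C \<and>
     (\<exists>S. dense_spans U lam C (dm C f) (cd C f) S \<and>
        (\<forall>G g. generated_obj U lam C G \<longrightarrow> g \<in> hom C G (dm C f) \<longrightarrow> mono_in C g \<longrightarrow>
           (\<exists>(u, v) \<in> S. \<exists>t \<in> hom C G (dm C u). cmp C u t = g \<and> cmp C v t = cmp C f g)))"


section \<open>Infinitary many-sorted languages and structures\<close>

text \<open>
  The arity of a symbol is a set of argument positions (of type \<open>'p\<close>), each position having a
  sort; constants are function symbols with no positions.
\<close>

record ('s, 'f, 'r, 'p) lang =
  sorts  :: "'s set"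
  funs   :: "'f set"
  rels   :: "'r set"
  far    :: "'f \<Rightarrow> 'p set"
  fsort  :: "'f \<Rightarrow> 'p \<Rightarrow> 's"
  fres   :: "'f \<Rightarrow> 's"
  rar    :: "'r \<Rightarrow> 'p set"
  rsort  :: "'r \<Rightarrow> 'p \<Rightarrow> 's"

definition is_lang :: "'c rel \<Rightarrow> ('s, 'f, 'r, 'p) lang \<Rightarrow> bool" where
  "is_lang kap L \<longleftrightarrow>
     (\<forall>f \<in> funs L. |far L f| <o kap \<and> fsort L f ` far L f \<subseteq> sorts L \<and> fres L f \<in> sorts L) \<and>
     (\<forall>R \<in> rels L. |rar L R| <o kap \<and> rsort L R ` rar L R \<subseteq> sorts L)"

record ('s, 'f, 'r, 'p, 'u) struct =
  carr :: "'s \<Rightarrow> 'u set"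
  fint :: "'f \<Rightarrow> ('p \<Rightarrow> 'u) \<Rightarrow> 'u"
  rint :: "'r \<Rightarrow> ('p \<Rightarrow> 'u) set"

definition fargs :: "('s, 'f, 'r, 'p) lang \<Rightarrow> ('s, 'f, 'r, 'p, 'u) struct \<Rightarrow> 'f \<Rightarrow> ('p \<Rightarrow> 'u) set" where
  "fargs L M f = (\<Pi>\<^sub>E p \<in> far L f. carr M (fsort L f p))"

definition rargs :: "('s, 'f, 'r, 'p) lang \<Rightarrow> ('s, 'f, 'r, 'p, 'u) struct \<Rightarrow> 'r \<Rightarrow> ('p \<Rightarrow> 'u) set" where
  "rargs L M R = (\<Pi>\<^sub>E p \<in> rar L R. carr M (rsort L R p))"

text \<open>
  Carriers may be empty. The values of the fields outside the language are normalised, so that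
  structures are equal exactly when they have the same carriers and interpretations.
\<close>

definition is_struct :: "('s, 'f, 'r, 'p) lang \<Rightarrow> ('s, 'f, 'r, 'p, 'u) struct \<Rightarrow> bool" where
  "is_struct L M \<longleftrightarrow>
     (\<forall>s. s \<notin> sorts L \<longrightarrow> carr M s = {}) \<and>
     (\<forall>f \<in> funs L. fint M f \<in> fargs L M f \<rightarrow>\<^sub>E carr M (fres L f)) \<and>
     (\<forall>f. f \<notin> funs L \<longrightarrow> fint M f = undefined) \<and>
     (\<forall>R \<in> rels L. rint M R \<subseteq> rargs L M R) \<and>
     (\<forall>R. R \<notin> rels L \<longrightarrow> rint M R = {})"

definition is_struct_hom ::
  "('s, 'f, 'r, 'p) lang \<Rightarrow> ('s, 'f, 'r, 'p, 'u) struct \<Rightarrow> ('s, 'f, 'r, 'p, 'u) struct \<Rightarrow>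
     ('s \<Rightarrow> 'u \<Rightarrow> 'u) \<Rightarrow> bool" where
  "is_struct_hom L M N h \<longleftrightarrow>
     (\<forall>s. h s \<in> carr M s \<rightarrow>\<^sub>E carr N s) \<and>
     (\<forall>f \<in> funs L. \<forall>a \<in> fargs L M f.
        h (fres L f) (fint M f a) = fint N f (\<lambda>p \<in> far L f. h (fsort L f p) (a p))) \<and>
     (\<forall>R \<in> rels L. \<forall>a \<in> rint M R. (\<lambda>p \<in> rar L R. h (rsort L R p) (a p)) \<in> rint N R)"


section \<open>Formulas and basic universal theories\<close>

text \<open>
  A variable is a name together with its sort. In \<open>App f t\<close> and \<open>Rel R t\<close> only the values
  of \<open>t\<close> at the argument positions of the symbol matter; in \<open>Conj I ph\<close> and \<open>Disj I ph\<close> only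
  the values of \<open>ph\<close> on \<open>I\<close> matter. The empty conjunction is truth, the empty
  disjunction falsity.
\<close>

datatype ('s, 'f, 'p, 'v) tm =
    Var "'v \<times> 's"
  | App 'f "'p \<Rightarrow> ('s, 'f, 'p, 'v) tm"

datatype ('s, 'f, 'r, 'p, 'v, 'j) fm =
    Eq "('s, 'f, 'p, 'v) tm" "('s, 'f, 'p, 'v) tm"
  | Rel 'r "'p \<Rightarrow> ('s, 'f, 'p, 'v) tm"
  | Conj "'j set" "'j \<Rightarrow> ('s, 'f, 'r, 'p, 'v, 'j) fm"
  | Disj "'j set" "'j \<Rightarrow> ('s, 'f, 'r, 'p, 'v, 'j) fm"

primrec wf_tm ::
  "('s, 'f, 'r, 'p) lang \<Rightarrow> ('v \<times> 's) set \<Rightarrow> ('s, 'f, 'p, 'v) tm \<Rightarrow> 's \<Rightarrow> bool" where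
  "wf_tm L V (Var x) s \<longleftrightarrow> x \<in> V \<and> snd x = s"
| "wf_tm L V (App f t) s \<longleftrightarrow> f \<in> funs L \<and> fres L f = s \<and>
     (\<forall>p \<in> far L f. wf_tm L V (t p) (fsort L f p))"

text \<open>Only conjunctions are bounded by \<open>lam\<close>; index sets of disjunctions are arbitrary.\<close>

primrec wf_fm ::
  "'k rel \<Rightarrow> ('s, 'f, 'r, 'p) lang \<Rightarrow> ('v \<times> 's) set \<Rightarrow> ('s, 'f, 'r, 'p, 'v, 'j) fm \<Rightarrow> bool" where
  "wf_fm lam L V (Eq t u) \<longleftrightarrow> (\<exists>s. wf_tm L V t s \<and> wf_tm L V u s)"
| "wf_fm lam L V (Rel R t) \<longleftrightarrow> R \<in> rels L \<and> (\<forall>p \<in> rar L R. wf_tm L V (t p) (rsort L R p))"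
| "wf_fm lam L V (Conj I ph) \<longleftrightarrow> |I| <o lam \<and> (\<forall>i \<in> I. wf_fm lam L V (ph i))"
| "wf_fm lam L V (Disj I ph) \<longleftrightarrow> (\<forall>i \<in> I. wf_fm lam L V (ph i))"

primrec eval_tm ::
  "('s, 'f, 'r, 'p) lang \<Rightarrow> ('s, 'f, 'r, 'p, 'u) struct \<Rightarrow> ('v \<times> 's \<Rightarrow> 'u) \<Rightarrow>
     ('s, 'f, 'p, 'v) tm \<Rightarrow> 'u" where
  "eval_tm L M a (Var x) = a x"
| "eval_tm L M a (App f t) = fint M f (\<lambda>p \<in> far L f. eval_tm L M a (t p))"

primrec sat_fm ::
  "('s, 'f, 'r, 'p) lang \<Rightarrow> ('s, 'f, 'r, 'p, 'u) struct \<Rightarrow> ('v \<times> 's \<Rightarrow> 'u) \<Rightarrow>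
     ('s, 'f, 'r, 'p, 'v, 'j) fm \<Rightarrow> bool" where
  "sat_fm L M a (Eq t u) \<longleftrightarrow> eval_tm L M a t = eval_tm L M a u"
| "sat_fm L M a (Rel R t) \<longleftrightarrow> (\<lambda>p \<in> rar L R. eval_tm L M a (t p)) \<in> rint M R"
| "sat_fm L M a (Conj I ph) \<longleftrightarrow> (\<forall>i \<in> I. sat_fm L M a (ph i))"
| "sat_fm L M a (Disj I ph) \<longleftrightarrow> (\<exists>i \<in> I. sat_fm L M a (ph i))"

text \<open>\<open>(V, ph, ps)\<close> stands for the sentence \<open>\<forall>V. ph \<Rightarrow> ps\<close>.\<close>

type_synonym ('s, 'f, 'r, 'p, 'v, 'j) bu_sentence =
  "('v \<times> 's) set \<times> ('s, 'f, 'r, 'p, 'v, 'j) fm \<times> ('s, 'f, 'r, 'p, 'v, 'j) fm"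

definition bu_theory ::
  "'k rel \<Rightarrow> 'c rel \<Rightarrow> ('s, 'f, 'r, 'p) lang \<Rightarrow> ('s, 'f, 'r, 'p, 'v, 'j) bu_sentence set \<Rightarrow> bool" where
  "bu_theory lam kap L T \<longleftrightarrow>
     (\<forall>(V, ph, ps) \<in> T. |V| <o kap \<and> snd ` V \<subseteq> sorts L \<and> wf_fm lam L V ph \<and> wf_fm lam L V ps)"

definition is_model ::
  "('s, 'f, 'r, 'p) lang \<Rightarrow> ('s, 'f, 'r, 'p, 'v, 'j) bu_sentence set \<Rightarrow>
     ('s, 'f, 'r, 'p, 'u) struct \<Rightarrow> bool" where
  "is_model L T M \<longleftrightarrow> is_struct L M \<and>
     (\<forall>(V, ph, ps) \<in> T. \<forall>a \<in> (\<Pi>\<^sub>E x \<in> V. carr M (snd x)). sat_fm L M a ph \<longrightarrow> sat_fm L M a ps)"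

definition mod_cat ::
  "('s, 'f, 'r, 'p) lang \<Rightarrow> ('s, 'f, 'r, 'p, 'v, 'j) bu_sentence set \<Rightarrow>
     (('s, 'f, 'r, 'p, 'u) struct,
      ('s, 'f, 'r, 'p, 'u) struct \<times> ('s \<Rightarrow> 'u \<Rightarrow> 'u) \<times> ('s, 'f, 'r, 'p, 'u) struct) cat" where
  "mod_cat L T = \<lparr>ob = {M. is_model L T M},
     ar = {(M, h, N). is_model L T M \<and> is_model L T N \<and> is_struct_hom L M N h},
     dm = (\<lambda>(M, h, N). M), cd = (\<lambda>(M, h, N). N),
     idt = (\<lambda>M. (M, \<lambda>s. \<lambda>x \<in> carr M s. x, M)),
     cmp = (\<lambda>(N, h', Q) (M, h, N'). (M, \<lambda>s. compose (carr M s) (h' s) (h s), Q))\<rparr>"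

end

theory Submission
  imports Defs
begin

text \<open>
  The technical fact behind both parts is that in a \<open>\<lambda>\<close>-mono-generated category \<open>A\<close> the legs
  \<open>k\<^sub>i : D\<^sub>i \<rightarrow> X\<close> of a \<open>\<lambda>\<close>-directed colimit of monomorphisms are themselves monomorphisms
  (\<open>directed_mono_colimit_leg_mono\<close>): generated objects separate parallel arrows, and two arrows
  from a generated object into \<open>D\<^sub>i\<close> that agree in \<open>X\<close> agree already at some later stage, hence
  agree. So every object \<open>X\<close> is covered by monomorphisms from generated objects \<open>D\<^sub>i\<close>, and the
  density conditions may be applied to the \<open>k\<^sub>i\<close>.

  If \<open>F\<close> preserves monomorphisms, then \<open>FX\<close> is the directed colimit of the monomorphisms between
  the \<open>FD\<^sub>i\<close>. An arrow from a generated object into \<open>FX\<close> therefore factors through some \<open>F(k\<^sub>i)\<close>.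
  By density \<open>k\<^sub>i\<close> factors through a span, and the image of that span under \<open>F\<close> answers the
  original arrow. Hence the spans \<open>(Fx, Fy)\<close> form a dense set.

  For \<open>F : A \<rightarrow> Mod(T)\<close>, \<open>F\<close> need not preserve monomorphisms, and the spans \<open>(Fx, Fy)\<close> are
  replaced by spans of images. Directed colimits in \<open>Mod(T)\<close> are computed on underlying sets: the
  concrete colimit is again a model, because a positive formula with fewer than \<open>\<lambda>\<close> conjuncts in
  each conjunction holds in the colimit as soon as, and only if, it holds at some stage
  (\<open>colimit_sat_at_stage\<close>). A Karp-style argument then gives \<open>span_positive_transfer\<close>: for a span
  \<open>(x, y)\<close> in a dense set and fewer than \<open>\<lambda>\<close> parameters in \<open>FU\<close>, a positive formula that holds of the images
  under \<open>Fx\<close> holds of the images under \<open>Fy\<close>. Applied in both directions to atomic formulas, it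
  says that \<open>Fx(a) \<mapsto> Fy(a)\<close> is an isomorphism between the full substructures carried by the images
  of \<open>Fx\<close> and \<open>Fy\<close>. The image of \<open>Fx\<close> thus is the apex of a span of embeddings into \<open>FX\<close> and
  \<open>FY\<close>; it is a model because basic universal sentences pass to substructures.

  These spans are dense: \<open>FX\<close> is the directed union of the images of the \<open>F(k\<^sub>i)\<close>, and this union is
  a directed colimit of monomorphisms in \<open>Mod(T)\<close>. So an arrow from a generated model into \<open>FX\<close>
  lands in the image of one \<open>F(k\<^sub>i)\<close>, hence, by density in \<open>A\<close>, in the image of some \<open>Fx'\<close>.
\<close>

section \<open>Categories, posets and cocones\<close>

lemma cat_cmp_hom: "category C \<Longrightarrow> f \<in> hom C X Y \<Longrightarrow> g \<in> hom C Y Z \<Longrightarrow> cmp C g f \<in> hom C X Z"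
  unfolding category_def by blast

lemma cat_assoc:
  "category C \<Longrightarrow> f \<in> hom C W X \<Longrightarrow> g \<in> hom C X Y \<Longrightarrow> h \<in> hom C Y Z \<Longrightarrow>
    cmp C h (cmp C g f) = cmp C (cmp C h g) f"
  unfolding category_def by blast

lemma functor_hom: "is_functor A B F \<Longrightarrow> f \<in> hom A X Y \<Longrightarrow> fa F f \<in> hom B (fo F X) (fo F Y)"
  unfolding is_functor_def by blast

lemma functor_ob: "is_functor A B F \<Longrightarrow> X \<in> ob A \<Longrightarrow> fo F X \<in> ob B"
  unfolding is_functor_def by blast

lemma functor_cmp:
  "is_functor A B F \<Longrightarrow> f \<in> hom A X Y \<Longrightarrow> g \<in> hom A Y Z \<Longrightarrow>
    fa F (cmp A g f) = cmp B (fa F g) (fa F f)"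
  unfolding is_functor_def by blast

lemma func_comp_simps:
  "fo (func_comp G F) X = fo G (fo F X)" "fa (func_comp G F) f = fa G (fa F f)"
  by (simp_all add: func_comp_def)

lemma functor_func_comp:
  assumes D: "is_functor J A D" and F: "is_functor A B F"
  shows "is_functor J B (func_comp F D)"
  unfolding is_functor_def func_comp_def
  using functor_ob[OF D] functor_ob[OF F] functor_hom[OF D] functor_hom[OF F]
    functor_cmp[OF F] D F
  by (simp add: is_functor_def) metis

lemma mono_cancel:
  assumes "mono_in C m" "m \<in> hom C Y Z" "u \<in> hom C X Y" "v \<in> hom C X Y" "cmp C m u = cmp C m v"
  shows "u = v"
  using assms unfolding mono_in_def hom_def by fastforce

lemma poset_cat_simps [simp]:
  "ob (poset_cat r) = Field r" "ar (poset_cat r) = r"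
  "dm (poset_cat r) = fst" "cd (poset_cat r) = snd"
  "idt (poset_cat r) i = (i, i)" "cmp (poset_cat r) g f = (fst f, snd g)"
  by (simp_all add: poset_cat_def)

lemma hom_poset_cat: "e \<in> hom (poset_cat r) i j \<longleftrightarrow> e = (i, j) \<and> (i, j) \<in> r"
  by (auto simp: hom_def)

lemma poset_functor_hom:
  "is_functor (poset_cat r) C D \<Longrightarrow> (i, j) \<in> r \<Longrightarrow> fa D (i, j) \<in> hom C (fo D i) (fo D j)"
  using functor_hom hom_poset_cat by metis

lemma poset_functor_cmp:
  "is_functor (poset_cat r) C D \<Longrightarrow> (i, j) \<in> r \<Longrightarrow> (j, l) \<in> r \<Longrightarrow>
    cmp C (fa D (j, l)) (fa D (i, j)) = fa D (i, l)"
  using functor_cmp[of "poset_cat r" C D "(i,j)" i j "(j,l)" l] hom_poset_cat[of _ r] by simp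

lemma cocone_leg: "is_cocone J C D X k \<Longrightarrow> i \<in> ob J \<Longrightarrow> k i \<in> hom C (fo D i) X"
  unfolding is_cocone_def by blast

lemma cocone_edge:
  "is_cocone (poset_cat r) C D X k \<Longrightarrow> (i, j) \<in> r \<Longrightarrow> cmp C (k j) (fa D (i, j)) = k i"
  unfolding is_cocone_def using hom_poset_cat by metis

lemma poset_coconeI:
  assumes "X \<in> ob C" "\<And>i. i \<in> Field r \<Longrightarrow> k i \<in> hom C (fo D i) X"
    "\<And>i j. (i, j) \<in> r \<Longrightarrow> cmp C (k j) (fa D (i, j)) = k i"
  shows "is_cocone (poset_cat r) C D X k"
  using assms by (auto simp: is_cocone_def hom_poset_cat)

lemma colimit_cocone: "is_colimit J C D X k \<Longrightarrow> is_cocone J C D X k"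
  unfolding is_colimit_def by blast

lemma colimit_mediate:
  assumes "is_colimit J C D X k" "is_cocone J C D Y l"
  obtains h where "h \<in> hom C X Y" "\<And>i. i \<in> ob J \<Longrightarrow> cmp C h (k i) = l i"
  using assms unfolding is_colimit_def by blast

lemma colimit_unique:
  assumes "is_colimit J C D X k" "is_cocone J C D Y l"
    "h \<in> hom C X Y" "\<And>i. i \<in> ob J \<Longrightarrow> cmp C h (k i) = l i"
    "h' \<in> hom C X Y" "\<And>i. i \<in> ob J \<Longrightarrow> cmp C h' (k i) = l i"
  shows "h = h'"
  using assms unfolding is_colimit_def by blast

lemma directed_refl: "directed_poset lam r \<Longrightarrow> i \<in> Field r \<Longrightarrow> (i, i) \<in> r"
  unfolding directed_poset_def partial_order_on_def preorder_on_def by (auto dest: refl_onD)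

lemma directed_trans: "directed_poset lam r \<Longrightarrow> (i, j) \<in> r \<Longrightarrow> (j, l) \<in> r \<Longrightarrow> (i, l) \<in> r"
  unfolding directed_poset_def partial_order_on_def preorder_on_def by (meson transD)

lemma finite_ordLess_Cinfinite:
  assumes "Cinfinite lam" "finite S"
  shows "|S| <o lam"
proof -
  have "\<not> lam \<le>o |S|"
    using assms card_of_ordLeq_infinite[of "Field lam" S] card_of_Field_ordIso[of lam]
      ordIso_ordLeq_trans unfolding cinfinite_def by blast
  then show ?thesis using assms card_of_Card_order[of S] by (meson card_order_on_well_order_on not_ordLeq_iff_ordLess)
qed

text \<open>
  An upper bound of one witness for each condition serves all conditions at once. This is the form
  in which \<open>\<lambda>\<close>-directedness enters for tuples of arguments and for conjunctions.
\<close>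

lemma directed_common_stage:
  assumes "directed_poset lam r" "|P| <o lam"
    and "\<And>p. p \<in> P \<Longrightarrow> \<exists>j \<in> Field r. Q p j"
    and up: "\<And>p i j. p \<in> P \<Longrightarrow> Q p i \<Longrightarrow> (i, j) \<in> r \<Longrightarrow> Q p j"
  shows "\<exists>j \<in> Field r. \<forall>p \<in> P. Q p j"
proof -
  obtain g where g: "\<And>p. p \<in> P \<Longrightarrow> g p \<in> Field r \<and> Q p (g p)" using assms(3) by metis
  have "|g ` P| <o lam" using card_of_image assms(2) by (rule ordLeq_ordLess_trans)
  moreover have "g ` P \<subseteq> Field r" using g by auto
  ultimately obtain b where "b \<in> Field r" "\<forall>a \<in> g ` P. (a, b) \<in> r"
    using assms(1) unfolding directed_poset_def by meson
  then show ?thesis using g up by (meson imageI)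
qed

lemma directed_bound2:
  assumes "Cinfinite lam" "directed_poset lam r" "i \<in> Field r" "j \<in> Field r"
  obtains b where "b \<in> Field r" "(i, b) \<in> r" "(j, b) \<in> r"
proof -
  have "|{i, j}| <o lam" by (rule finite_ordLess_Cinfinite[OF assms(1)]) simp
  then show ?thesis using that assms unfolding directed_poset_def by (metis empty_subsetI insertCI insert_subset)
qed

section \<open>Generated objects\<close>

text \<open>
  Both in the category of sets and in categories of models an arrow is a triple of domain,
  underlying map and codomain.
\<close>

abbreviation amap :: "'a \<times> 'h \<times> 'b \<Rightarrow> 'h" where "amap \<alpha> \<equiv> fst (snd \<alpha>)"

lemma hom_set_cat: "\<alpha> \<in> hom set_cat X Y \<longleftrightarrow> (\<exists>h \<in> X \<rightarrow>\<^sub>E Y. \<alpha> = (X, h, Y))"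
  by (auto simp: hom_def set_cat_def)

lemma cmp_set_cat: "cmp set_cat (Y, g, Z) (X, f, Y') = (X, compose X g f, Z)"
  by (simp add: set_cat_def)

lemma ob_set_cat: "X \<in> ob set_cat"
  by (simp add: set_cat_def)

text \<open>
  The union \<open>Y\<close> of the images of the legs is the apex of a cocone. The mediating map into \<open>Y\<close>,
  followed by the inclusion, is the identity of the colimit by uniqueness. As a subset of \<open>X\<close>, the
  test object \<open>Y\<close> lives on the same type as \<open>X\<close>.
\<close>

lemma set_colimit_surj:
  assumes col: "is_colimit (poset_cat r) set_cat H X k" and x: "x \<in> X"
  shows "\<exists>i \<in> Field r. \<exists>a \<in> fo H i. x = amap (k i) a"
proof -
  note cc = colimit_cocone[OF col]
  define Y where "Y = (\<Union>i \<in> Field r. amap (k i) ` fo H i)"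
  define l where "l i = (fo H i, amap (k i), Y)" for i
  have k: "\<exists>h \<in> fo H i \<rightarrow>\<^sub>E X. k i = (fo H i, h, X)" if "i \<in> Field r" for i
    using cocone_leg[OF cc] that hom_set_cat by (metis poset_cat_simps(1))
  have YX: "Y \<subseteq> X" unfolding Y_def using k by fastforce
  have "is_cocone (poset_cat r) set_cat H Y l"
  proof (rule poset_coconeI)
    fix i assume "i \<in> Field r"
    then show "l i \<in> hom set_cat (fo H i) Y"
      using k[of i] unfolding hom_set_cat l_def Y_def by (force simp: PiE_iff)
  next
    fix i j assume e: "(i, j) \<in> r"
    then have "i \<in> Field r" "j \<in> Field r" by (auto simp: Field_def)
    then show "cmp set_cat (l j) (fa H (i, j)) = l i"
      using cocone_edge[OF cc e] k[of i] k[of j] unfolding l_def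
      by (cases "fa H (i, j)") (auto simp: cmp_set_cat)
  qed (rule ob_set_cat)
  from colimit_mediate[OF col this] obtain \<beta> where
    \<beta>: "\<beta> \<in> hom set_cat X Y" "\<And>i. i \<in> Field r \<Longrightarrow> cmp set_cat \<beta> (k i) = l i" by auto
  then obtain h where h: "h \<in> X \<rightarrow>\<^sub>E Y" "\<beta> = (X, h, Y)" by (auto simp: hom_set_cat)
  have "(X, h, X) = (X, \<lambda>x\<in>X. x, X)"
  proof (rule colimit_unique[OF col cc])
    show "(X, h, X) \<in> hom set_cat X X" "(X, \<lambda>x\<in>X. x, X) \<in> hom set_cat X X"
      using h(1) YX by (auto simp: hom_set_cat)
    fix i assume i: "i \<in> ob (poset_cat r)"
    then obtain g where g: "g \<in> fo H i \<rightarrow>\<^sub>E X" "k i = (fo H i, g, X)" using k by auto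
    show "cmp set_cat (X, h, X) (k i) = k i"
      using \<beta>(2)[of i] i g h(2) by (auto simp: cmp_set_cat l_def)
    have "compose (fo H i) (\<lambda>x\<in>X. x) g = g"
      using g(1) by (intro extensionalityI[of _ "fo H i"]) (auto simp: compose_def PiE_iff)
    then show "cmp set_cat (X, \<lambda>x\<in>X. x, X) (k i) = k i" using g(2) by (simp add: cmp_set_cat)
  qed
  then have "h x = x" using x by simp
  then have "x \<in> Y" using h(1) x by (metis PiE_mem)
  then show ?thesis unfolding Y_def by blast
qed

text \<open>
  If \<open>u\<close> and \<open>v\<close> never become equal, the colimit is tested against the set \<open>{u, v}\<close>: an element is
  sent to \<open>u\<close> if it eventually coincides with \<open>u\<close>, and to \<open>v\<close> otherwise. The resulting cocone
  separates \<open>u\<close> from \<open>v\<close>.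
\<close>

lemma set_colimit_identified:
  assumes inf: "Cinfinite lam" and dir: "directed_poset lam r"
    and H: "is_functor (poset_cat r) set_cat H"
    and col: "is_colimit (poset_cat r) set_cat H X k"
    and i: "i \<in> Field r" and u: "u \<in> fo H i" and v: "v \<in> fo H i"
    and eq: "amap (k i) u = amap (k i) v"
  shows "\<exists>j. (i, j) \<in> r \<and> amap (fa H (i, j)) u = amap (fa H (i, j)) v"
proof (rule ccontr)
  assume apart: "\<nexists>j. (i, j) \<in> r \<and> amap (fa H (i, j)) u = amap (fa H (i, j)) v"
  define meets where "meets j w \<longleftrightarrow>
    (\<exists>m. (i, m) \<in> r \<and> (j, m) \<in> r \<and> amap (fa H (j, m)) w = amap (fa H (i, m)) u)" for j w
  define l where "l j = (fo H j, (\<lambda>w \<in> fo H j. if meets j w then u else v), {u, v})" for j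
  have Hm: "\<exists>h \<in> fo H j \<rightarrow>\<^sub>E fo H m. fa H (j, m) = (fo H j, h, fo H m)" if "(j, m) \<in> r" for j m
    using poset_functor_hom[OF H that] by (simp add: hom_set_cat)
  have Hc: "amap (fa H (j, m)) (amap (fa H (j', j)) w) = amap (fa H (j', m)) w"
    if "(j', j) \<in> r" "(j, m) \<in> r" "w \<in> fo H j'" for j' j m w
    using poset_functor_cmp[OF H that(1,2), symmetric] Hm[OF that(1)] Hm[OF that(2)] that(3)
    by (auto simp: cmp_set_cat compose_eq)
  \<comment> \<open>Membership in the class of \<open>u\<close> does not change along transition maps, so \<open>l\<close> is a cocone.\<close>
  have meets: "meets j (amap (fa H (j', j)) w) \<longleftrightarrow> meets j' w"
    if e: "(j', j) \<in> r" and w: "w \<in> fo H j'" for j' j w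
  proof
    assume "meets j (amap (fa H (j', j)) w)"
    then show "meets j' w" unfolding meets_def using Hc[OF e] w directed_trans[OF dir e] by metis
  next
    assume "meets j' w"
    then obtain m where m: "(i, m) \<in> r" "(j', m) \<in> r" "amap (fa H (j', m)) w = amap (fa H (i, m)) u"
      unfolding meets_def by blast
    obtain b where b: "(j, b) \<in> r" "(m, b) \<in> r"
      using directed_bound2[OF inf dir] e m by (metis FieldI2)
    have "amap (fa H (j', b)) w = amap (fa H (i, b)) u"
      using Hc[OF m(2) b(2) w] Hc[OF m(1) b(2) u] m(3) by simp
    then show "meets j (amap (fa H (j', j)) w)"
      unfolding meets_def using Hc[OF e b(1) w] directed_trans[OF dir m(1) b(2)] b(1) by metis
  qed
  have "is_cocone (poset_cat r) set_cat H {u, v} l"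
  proof (rule poset_coconeI)
    fix j' j assume e: "(j', j) \<in> r"
    obtain h where h: "h \<in> fo H j' \<rightarrow>\<^sub>E fo H j" "fa H (j', j) = (fo H j', h, fo H j)" using Hm[OF e] by blast
    have "h w \<in> fo H j \<and> meets j (h w) = meets j' w" if "w \<in> fo H j'" for w
      using meets[OF e that] h that by auto
    then show "cmp set_cat (l j) (fa H (j', j)) = l j'"
      by (auto simp: l_def h(2) cmp_set_cat compose_def)
  qed (auto simp: l_def hom_set_cat ob_set_cat)
  from colimit_mediate[OF col this] obtain \<beta> where
    \<beta>: "\<beta> \<in> hom set_cat X {u, v}" "\<And>j. j \<in> Field r \<Longrightarrow> cmp set_cat \<beta> (k j) = l j" by auto
  have "k i \<in> hom set_cat (fo H i) X" using cocone_leg[OF colimit_cocone[OF col]] i by simp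
  then have "amap (l i) w = amap \<beta> (amap (k i) w)" if "w \<in> fo H i" for w
    using \<beta>(1) \<beta>(2)[OF i, symmetric] that by (auto simp: hom_set_cat cmp_set_cat compose_eq)
  then have "amap (l i) u = amap (l i) v" using u v eq by simp
  moreover have "meets i u" unfolding meets_def using directed_refl[OF dir i] by blast
  moreover have "\<not> meets i v" unfolding meets_def using apart by metis
  ultimately show False using u v apart i directed_refl[OF dir i] by (auto simp: l_def)
qed

lemma hom_functor_is_functor:
  assumes C: "category C"
  shows "is_functor C set_cat (hom_functor C G)"
proof -
  have arr: "fa (hom_functor C G) f \<in> hom set_cat (hom C G X) (hom C G Y)" if f: "f \<in> hom C X Y" for X Y f
  proof -
    have "dm C f = X" "cd C f = Y" using f by (auto simp: hom_def)
    then show ?thesis using cat_cmp_hom[OF C _ f] by (auto simp: hom_functor_def hom_set_cat)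
  qed
  moreover have "fa (hom_functor C G) (cmp C g f) = cmp set_cat (fa (hom_functor C G) g) (fa (hom_functor C G) f)"
    if f: "f \<in> hom C X Y" and g: "g \<in> hom C Y Z" for X Y Z f g
  proof -
    have "cmp C g f \<in> hom C X Z" using C f g by (rule cat_cmp_hom)
    then show ?thesis using f g cat_assoc[OF C _ f g] cat_cmp_hom[OF C _ f]
      by (auto simp: hom_functor_def cmp_set_cat compose_def hom_def fun_eq_iff)
  qed
  moreover have "fa (hom_functor C G) (idt C X) = idt set_cat (hom C G X)" if "X \<in> ob C" for X
    using C that unfolding category_def
    by (auto simp: hom_functor_def set_cat_def hom_def fun_eq_iff)
  moreover have "fo (hom_functor C G) X = hom C G X" for X by (simp add: hom_functor_def)
  ultimately show ?thesis
    unfolding is_functor_def by (simp add: ob_set_cat)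
qed

lemma generated_colimit:
  assumes "generated_obj TYPE('u) lam C G" "directed_mono_diagram lam (r :: 'u rel) C D"
    "is_colimit (poset_cat r) C D X k"
  shows "is_colimit (poset_cat r) set_cat (func_comp (hom_functor C G) D) (hom C G X)
    (\<lambda>i. fa (hom_functor C G) (k i))"
  using assms unfolding generated_obj_def takes_directed_mono_colimits_to_colimits_def
  by (force simp: hom_functor_def)

lemma hom_functor_apply:
  assumes "u \<in> hom C X Y" "g \<in> hom C G X"
  shows "amap (fa (hom_functor C G) u) g = cmp C u g"
  using assms by (simp add: hom_functor_def hom_def)

lemma generated_factor:
  assumes G: "generated_obj TYPE('u) lam C G" and D: "directed_mono_diagram lam (r :: 'u rel) C D"
    and col: "is_colimit (poset_cat r) C D X k" and g: "g \<in> hom C G X"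
  obtains i g' where "i \<in> Field r" "g' \<in> hom C G (fo D i)" "cmp C (k i) g' = g"
proof -
  from set_colimit_surj[OF generated_colimit[OF G D col] g] obtain i g' where
    i: "i \<in> Field r" "g' \<in> hom C G (fo D i)" "g = amap (fa (hom_functor C G) (k i)) g'"
    by (auto simp: func_comp_def hom_functor_def)
  moreover have "k i \<in> hom C (fo D i) X" using cocone_leg[OF colimit_cocone[OF col]] i by simp
  ultimately show ?thesis using that hom_functor_apply by metis
qed

text \<open>
  Arrows that agree in the colimit agree at some stage, and the transition maps are monomorphisms.
\<close>

lemma generated_equalised:
  assumes C: "category C" and inf: "Cinfinite lam"
    and G: "generated_obj TYPE('u) lam C G" and D: "directed_mono_diagram lam (r :: 'u rel) C D"
    and col: "is_colimit (poset_cat r) C D X k" and i: "i \<in> Field r"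
    and u: "u \<in> hom C G (fo D i)" and v: "v \<in> hom C G (fo D i)"
    and eq: "cmp C (k i) u = cmp C (k i) v"
  shows "u = v"
proof -
  let ?H = "func_comp (hom_functor C G) D"
  have D': "directed_poset lam r" "is_functor (poset_cat r) C D" "\<And>e. e \<in> r \<Longrightarrow> mono_in C (fa D e)"
    using D unfolding directed_mono_diagram_def by auto
  have H: "is_functor (poset_cat r) set_cat ?H"
    using functor_func_comp[OF D'(2) hom_functor_is_functor[OF C]] .
  have k: "k i \<in> hom C (fo D i) X" using cocone_leg[OF colimit_cocone[OF col]] i by simp
  obtain j where j: "(i, j) \<in> r" "amap (fa ?H (i, j)) u = amap (fa ?H (i, j)) v"
    using set_colimit_identified[OF inf D'(1) H generated_colimit[OF G D col] i, of u v] u v eq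
      hom_functor_apply[OF k u] hom_functor_apply[OF k v]
    by (auto simp: func_comp_def hom_functor_def)
  have e: "fa D (i, j) \<in> hom C (fo D i) (fo D j)" using poset_functor_hom[OF D'(2) j(1)] .
  have "cmp C (fa D (i, j)) u = cmp C (fa D (i, j)) v"
    using j(2) hom_functor_apply[OF e u] hom_functor_apply[OF e v] by (simp add: func_comp_def)
  then show ?thesis using mono_cancel[OF D'(3)[OF j(1)] e u v] by simp
qed

text \<open>
  \<open>Z\<close> is a colimit of generated objects, and the legs of a colimit are jointly epimorphic.
\<close>

lemma generated_objects_separate:
  assumes A: "mono_generated_category TYPE('u) lam A"
    and u: "u \<in> hom A Z W" and v: "v \<in> hom A Z W"
    and eq: "\<And>G h. generated_obj TYPE('u) lam A G \<Longrightarrow> h \<in> hom A G Z \<Longrightarrow> cmp A u h = cmp A v h"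
  shows "u = v"
proof -
  have C: "category A" using A unfolding mono_generated_category_def by blast
  then have "Z \<in> ob A" "W \<in> ob A" using u unfolding hom_def category_def by auto
  then obtain r :: "'u rel" and D k where D: "directed_mono_diagram lam r A D"
    "\<And>i. i \<in> Field r \<Longrightarrow> generated_obj TYPE('u) lam A (fo D i)"
    and col: "is_colimit (poset_cat r) A D Z k"
    using A unfolding mono_generated_category_def by blast
  have F: "is_functor (poset_cat r) A D" using D unfolding directed_mono_diagram_def by auto
  note cc = colimit_cocone[OF col]
  have k: "k i \<in> hom A (fo D i) Z" if "i \<in> Field r" for i using cocone_leg[OF cc] that by simp
  have "is_cocone (poset_cat r) A D W (\<lambda>i. cmp A u (k i))"
  proof (rule poset_coconeI)
    fix i j assume e: "(i, j) \<in> r"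
    then have "j \<in> Field r" by (auto simp: Field_def)
    then show "cmp A (cmp A u (k j)) (fa D (i, j)) = cmp A u (k i)"
      using cat_assoc[OF C poset_functor_hom[OF F e] k u] cocone_edge[OF cc e] by simp
  qed (use \<open>W \<in> ob A\<close> cat_cmp_hom[OF C k u] in auto)
  from colimit_unique[OF col this u _ v] show ?thesis using eq D(2) k by (metis poset_cat_simps(1))
qed

text \<open>
  Separation by generated objects reduces the claim to arrows from a generated object, which are
  handled by \<open>generated_equalised\<close>.
\<close>

lemma directed_mono_colimit_leg_mono:
  assumes A: "mono_generated_category TYPE('u) lam A" and inf: "Cinfinite lam"
    and D: "directed_mono_diagram lam (r :: 'u rel) A D"
    and col: "is_colimit (poset_cat r) A D X k" and i: "i \<in> Field r"
  shows "mono_in A (k i)"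
proof -
  have C: "category A" using A unfolding mono_generated_category_def by blast
  have k: "k i \<in> hom A (fo D i) X" using cocone_leg[OF colimit_cocone[OF col]] i by simp
  have "u = v" if u: "u \<in> hom A Z (fo D i)" and v: "v \<in> hom A Z (fo D i)"
    and eq: "cmp A (k i) u = cmp A (k i) v" for Z u v
  proof (rule generated_objects_separate[OF A u v])
    fix G h assume G: "generated_obj TYPE('u) lam A G" and h: "h \<in> hom A G Z"
    show "cmp A u h = cmp A v h"
      using generated_equalised[OF C inf G D col i cat_cmp_hom[OF C h u] cat_cmp_hom[OF C h v]]
        cat_assoc[OF C h u k] cat_assoc[OF C h v k] eq by simp
  qed
  then show ?thesis using k unfolding mono_in_def hom_def by auto
qed

lemma generated_cover:
  assumes A: "mono_generated_category TYPE('u) lam A" and inf: "Cinfinite lam" and X: "X \<in> ob A"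
  obtains r :: "'u rel" and D k where "directed_mono_diagram lam r A D"
    "is_colimit (poset_cat r) A D X k" "directed_poset lam r" "is_functor (poset_cat r) A D"
    "\<And>i. i \<in> Field r \<Longrightarrow> generated_obj TYPE('u) lam A (fo D i)"
    "\<And>i. i \<in> Field r \<Longrightarrow> k i \<in> hom A (fo D i) X"
    "\<And>i. i \<in> Field r \<Longrightarrow> mono_in A (k i)"
proof -
  obtain r :: "'u rel" and D k where *: "directed_mono_diagram lam r A D"
    "\<And>i. i \<in> Field r \<Longrightarrow> generated_obj TYPE('u) lam A (fo D i)"
    "is_colimit (poset_cat r) A D X k"
    using A X unfolding mono_generated_category_def by blast
  show ?thesis
    by (rule that[OF *(1,3) _ _ *(2)])
      (use * directed_mono_colimit_leg_mono[OF A inf *(1,3)] cocone_leg[OF colimit_cocone[OF *(3)]]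
        in \<open>auto simp: directed_mono_diagram_def\<close>)
qed


section \<open>Dense sets of spans\<close>

definition extends_span :: "('o, 'm) cat \<Rightarrow> 'm \<Rightarrow> 'm \<Rightarrow> 'm \<Rightarrow> 'm \<Rightarrow> bool" where
  "extends_span C x' y' x y \<longleftrightarrow>
    (\<exists>w \<in> hom C (dm C x) (dm C x'). cmp C x' w = x \<and> cmp C y' w = y)"

definition factors_through :: "('o, 'm) cat \<Rightarrow> 'm \<Rightarrow> 'm \<Rightarrow> bool" where
  "factors_through C x g \<longleftrightarrow> (\<exists>s \<in> hom C (dm C g) (dm C x). cmp C x s = g)"

text \<open>
  The back condition. The forth condition for a set of spans is the back condition for the converse
  set, which is how every argument below avoids being carried out twice.
\<close>

definition back_closed ::
  "'u itself \<Rightarrow> 'k rel \<Rightarrow> ('o, 'm) cat \<Rightarrow> 'o \<Rightarrow> ('m \<times> 'm) set \<Rightarrow> bool" where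
  "back_closed U lam C X S \<longleftrightarrow>
    (\<forall>x y G g. (x, y) \<in> S \<longrightarrow> generated_obj U lam C G \<longrightarrow> g \<in> hom C G X \<longrightarrow> mono_in C g \<longrightarrow>
      (\<exists>x' y'. (x', y') \<in> S \<and> factors_through C x' g \<and> extends_span C x' y' x y))"

lemma spans_homs:
  assumes "S \<subseteq> spans C X Y" "(x, y) \<in> S"
  shows "x \<in> hom C (dm C x) X" "y \<in> hom C (dm C x) Y" "mono_in C x" "mono_in C y" "dm C y = dm C x"
  using assms unfolding spans_def hom_def mono_in_def by auto

lemma spans_converse: "S \<subseteq> spans C X Y \<Longrightarrow> S\<inverse> \<subseteq> spans C Y X"
  by (auto simp: spans_def)

lemma dense_spans_iff:
  "dense_spans U lam C X Y S \<longleftrightarrow> S \<noteq> {} \<and> S \<subseteq> spans C X Y \<and>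
    back_closed U lam C X S \<and> back_closed U lam C Y (S\<inverse>)"
proof (cases "S \<subseteq> spans C X Y")
  case True
  have [simp]: "dm C g = G" if "g \<in> hom C G Z" for g G Z using that by (simp add: hom_def)
  have swap: "(y, x) \<in> S \<Longrightarrow> dm C x = dm C y" for x y
    using spans_homs(5)[OF True] by simp
  have forth: "back_closed U lam C Y (S\<inverse>) \<longleftrightarrow>
      (\<forall>x y G g. (x, y) \<in> S \<longrightarrow> generated_obj U lam C G \<longrightarrow> g \<in> hom C G Y \<longrightarrow> mono_in C g \<longrightarrow>
        (\<exists>x' y'. (x', y') \<in> S \<and> factors_through C y' g \<and> extends_span C x' y' x y))"
  proof -
    have "extends_span C y' x' y x \<longleftrightarrow> extends_span C x' y' x y"
      if "(x, y) \<in> S" "(x', y') \<in> S" for x y x' y'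
      using swap[OF that(1)] swap[OF that(2)] unfolding extends_span_def by auto
    then show ?thesis unfolding back_closed_def converse_iff by meson
  qed
  show ?thesis using True swap unfolding dense_spans_def forth
    unfolding back_closed_def extends_span_def factors_through_def
    by (simp add: Ball_def Bex_def split_paired_all cong: conj_cong)
qed (simp add: dense_spans_def)

section \<open>Functors that preserve monomorphisms\<close>

lemma embeddingI:
  assumes "f \<in> hom C X Y" "dense_spans U lam C X Y S"
    "\<And>G g. generated_obj U lam C G \<Longrightarrow> g \<in> hom C G X \<Longrightarrow>
      \<exists>(u, v) \<in> S. \<exists>t \<in> hom C G (dm C u). cmp C u t = g \<and> cmp C v t = cmp C f g"
  shows "is_embedding U lam C f"
  using assms unfolding is_embedding_def hom_def by blast

lemma embeddingE:
  assumes A: "mono_generated_category TYPE('u) lam A" and f: "is_embedding TYPE('u) lam A f"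
  obtains X Y S where "f \<in> hom A X Y" "X \<in> ob A" "Y \<in> ob A" "S \<noteq> {}" "S \<subseteq> spans A X Y"
    "back_closed TYPE('u) lam A X S" "back_closed TYPE('u) lam A Y (S\<inverse>)"
    "\<And>G g. generated_obj TYPE('u) lam A G \<Longrightarrow> g \<in> hom A G X \<Longrightarrow> mono_in A g \<Longrightarrow>
      \<exists>u v. (u, v) \<in> S \<and> (\<exists>t \<in> hom A G (dm A u). cmp A u t = g \<and> cmp A v t = cmp A f g)"
proof -
  have fh: "f \<in> hom A (dm A f) (cd A f)" using f by (simp add: is_embedding_def hom_def)
  then have "dm A f \<in> ob A" "cd A f \<in> ob A"
    using A unfolding mono_generated_category_def category_def hom_def by auto
  moreover obtain S where "dense_spans TYPE('u) lam A (dm A f) (cd A f) S"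
    "\<And>G g. generated_obj TYPE('u) lam A G \<Longrightarrow> g \<in> hom A G (dm A f) \<Longrightarrow> mono_in A g \<Longrightarrow>
      \<exists>u v. (u, v) \<in> S \<and> (\<exists>t \<in> hom A G (dm A u). cmp A u t = g \<and> cmp A v t = cmp A f g)"
    using f unfolding is_embedding_def by blast
  ultimately show ?thesis using that[OF fh] unfolding dense_spans_iff by blast
qed

lemma functor_extends_span:
  assumes F: "is_functor A B F" and "extends_span A x' y' x y"
    and "x' \<in> hom A U' X" "y' \<in> hom A U' Y" "x \<in> hom A U X"
  shows "extends_span B (fa F x') (fa F y') (fa F x) (fa F y)"
proof -
  obtain w where w: "w \<in> hom A U U'" "cmp A x' w = x" "cmp A y' w = y"
    using assms unfolding extends_span_def by (auto simp: hom_def)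
  have "dm B (fa F x) = fo F U" "dm B (fa F x') = fo F U'"
    using functor_hom[OF F] assms(3,5) by (auto simp: hom_def)
  then show ?thesis unfolding extends_span_def
    using functor_hom[OF F w(1)] functor_cmp[OF F w(1)] assms(3,4) w(2,3) by metis
qed

lemma functor_factors_through:
  assumes B: "category B" and F: "is_functor A B F" and "factors_through A x k"
    and "x \<in> hom A U X" "k \<in> hom A D X" and g: "g \<in> hom B G (fo F D)"
  shows "factors_through B (fa F x) (cmp B (fa F k) g)"
proof -
  obtain s where s: "s \<in> hom A D U" "cmp A x s = k"
    using assms unfolding factors_through_def by (auto simp: hom_def)
  have F': "fa F s \<in> hom B (fo F D) (fo F U)" "fa F x \<in> hom B (fo F U) (fo F X)"
      "fa F k \<in> hom B (fo F D) (fo F X)"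
    using functor_hom[OF F] assms s by auto
  have "dm B (fa F x) = fo F U" "dm B (cmp B (fa F k) g) = G"
    using F' cat_cmp_hom[OF B g F'(3)] by (auto simp: hom_def)
  then show ?thesis unfolding factors_through_def
    using cat_cmp_hom[OF B g F'(1)] cat_assoc[OF B g F'(1,2)] functor_cmp[OF F s(1) assms(4)] s(2) by metis
qed

text \<open>
  \<open>F\<close> turns the generated cover of \<open>X\<close> into a directed colimit of monomorphisms with colimit \<open>FX\<close>,
  and \<open>hom(G, -)\<close> preserves that colimit.
\<close>

lemma generated_factor_functor:
  assumes A: "mono_generated_category TYPE('u) lam A" and inf: "Cinfinite lam"
    and B: "category B" and F: "is_functor A B F" "preserves_monos A B F"
    and pres: "takes_directed_mono_colimits_to_colimits TYPE('u) lam A B F"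
    and X: "X \<in> ob A" and G: "generated_obj TYPE('u) lam B G" and g: "g \<in> hom B G (fo F X)"
  obtains D k g' where "generated_obj TYPE('u) lam A D" "k \<in> hom A D X" "mono_in A k"
    "g' \<in> hom B G (fo F D)" "g = cmp B (fa F k) g'"
proof -
  obtain r :: "'u rel" and D k where D: "directed_mono_diagram lam r A D"
    "is_colimit (poset_cat r) A D X k" "directed_poset lam r" "is_functor (poset_cat r) A D"
    "\<And>i. i \<in> Field r \<Longrightarrow> generated_obj TYPE('u) lam A (fo D i)"
    "\<And>i. i \<in> Field r \<Longrightarrow> k i \<in> hom A (fo D i) X"
    "\<And>i. i \<in> Field r \<Longrightarrow> mono_in A (k i)"
    using generated_cover[OF A inf X] by blast
  have FD: "directed_mono_diagram lam r B (func_comp F D)"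
    using D(1) functor_func_comp[OF D(4) F(1)] F(2)
    unfolding directed_mono_diagram_def preserves_monos_def by (auto simp: func_comp_def)
  have "is_colimit (poset_cat r) B (func_comp F D) (fo F X) (\<lambda>i. fa F (k i))"
    using pres D(1,2) unfolding takes_directed_mono_colimits_to_colimits_def by blast
  from generated_factor[OF G FD this g] obtain i g' where
    "i \<in> Field r" "g' \<in> hom B G (fo F (fo D i))" "cmp B (fa F (k i)) g' = g"
    by (auto simp: func_comp_def)
  then show ?thesis using that D(5-7) by metis
qed

text \<open>
  A span that answers \<open>k : D \<rightarrow> X\<close> in \<open>A\<close> is carried by \<open>F\<close> to one that answers every arrow which
  factors through \<open>F(k)\<close>.
\<close>

lemma functor_back_closed:
  assumes A: "mono_generated_category TYPE('u) lam A" and inf: "Cinfinite lam"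
    and B: "category B" and F: "is_functor A B F" and mono: "preserves_monos A B F"
    and pres: "takes_directed_mono_colimits_to_colimits TYPE('u) lam A B F"
    and X: "X \<in> ob A" and S: "S \<subseteq> spans A X Y" and bk: "back_closed TYPE('u) lam A X S"
  shows "back_closed TYPE('u) lam B (fo F X) (map_prod (fa F) (fa F) ` S)"
  unfolding back_closed_def
proof (intro allI impI)
  fix a b G g assume ab: "(a, b) \<in> map_prod (fa F) (fa F) ` S"
    and G: "generated_obj TYPE('u) lam B G" and g: "g \<in> hom B G (fo F X)" "mono_in B g"
  note sp = spans_homs[OF S]
  obtain x y where xy: "(x, y) \<in> S" "a = fa F x" "b = fa F y" using ab by auto
  obtain D k g' where k: "generated_obj TYPE('u) lam A D" "k \<in> hom A D X" "mono_in A k"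
    "g' \<in> hom B G (fo F D)" "g = cmp B (fa F k) g'"
    using generated_factor_functor[OF A inf B F mono pres X G g(1)] .
  then obtain x' y' where xy': "(x', y') \<in> S" "factors_through A x' k" "extends_span A x' y' x y"
    using bk xy(1) unfolding back_closed_def by blast
  have "factors_through B (fa F x') g"
    using functor_factors_through[OF B F xy'(2) sp(1)[OF xy'(1)] k(2,4)] k(5) by simp
  moreover have "extends_span B (fa F x') (fa F y') a b"
    using functor_extends_span[OF F xy'(3) sp(1,2)[OF xy'(1)] sp(1)[OF xy(1)]] xy by simp
  ultimately show "\<exists>x' y'. (x', y') \<in> map_prod (fa F) (fa F) ` S \<and>
      factors_through B x' g \<and> extends_span B x' y' a b"
    using xy'(1) by force
qed

theorem mono_functor_preserves_embeddings:
  assumes A: "mono_generated_category TYPE('u) lam A" and inf: "Cinfinite lam"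
    and B: "category B" and F: "is_functor A B F" and mono: "preserves_monos A B F"
    and pres: "takes_directed_mono_colimits_to_colimits TYPE('u) lam A B F"
    and f: "is_embedding TYPE('u) lam A f"
  shows "is_embedding TYPE('u) lam B (fa F f)"
proof -
  obtain X Y S where fa: "f \<in> hom A X Y" and XY: "X \<in> ob A" "Y \<in> ob A"
    and S: "S \<noteq> {}" "S \<subseteq> spans A X Y"
      "back_closed TYPE('u) lam A X S" "back_closed TYPE('u) lam A Y (S\<inverse>)"
    and fS: "\<And>G g. generated_obj TYPE('u) lam A G \<Longrightarrow> g \<in> hom A G X \<Longrightarrow> mono_in A g \<Longrightarrow>
      \<exists>u v. (u, v) \<in> S \<and> (\<exists>t \<in> hom A G (dm A u). cmp A u t = g \<and> cmp A v t = cmp A f g)"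
    using embeddingE[OF A f] by metis
  note sp = spans_homs[OF S(2)]
  let ?S = "map_prod (fa F) (fa F) ` S"
  have "?S\<inverse> = map_prod (fa F) (fa F) ` (S\<inverse>)" by force
  moreover have "?S \<subseteq> spans B (fo F X) (fo F Y)"
  proof
    fix z assume "z \<in> ?S"
    then obtain x y where xy: "(x, y) \<in> S" "z = (fa F x, fa F y)" by auto
    show "z \<in> spans B (fo F X) (fo F Y)"
      using sp[OF xy(1)] functor_hom[OF F sp(1)[OF xy(1)]] functor_hom[OF F sp(2)[OF xy(1)]] mono xy(2)
      unfolding preserves_monos_def by (auto simp: spans_def hom_def)
  qed
  ultimately have "dense_spans TYPE('u) lam B (fo F X) (fo F Y) ?S"
    using functor_back_closed[OF A inf B F mono pres XY(1) S(2,3)]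
      functor_back_closed[OF A inf B F mono pres XY(2) spans_converse[OF S(2)] S(4)] S(1)
    unfolding dense_spans_iff by simp
  moreover have "\<exists>(u, v) \<in> ?S. \<exists>t \<in> hom B G (dm B u). cmp B u t = g \<and> cmp B v t = cmp B (fa F f) g"
    if G: "generated_obj TYPE('u) lam B G" and g: "g \<in> hom B G (fo F X)" for G g
  proof -
    obtain D k g' where k: "generated_obj TYPE('u) lam A D" "k \<in> hom A D X" "mono_in A k"
      "g' \<in> hom B G (fo F D)" "g = cmp B (fa F k) g'"
      using generated_factor_functor[OF A inf B F mono pres XY(1) G g] .
    obtain u v t where uv: "(u, v) \<in> S" "t \<in> hom A D (dm A u)" "cmp A u t = k" "cmp A v t = cmp A f k"
      using fS[OF k(1-3)] by blast
    note u = sp(1)[OF uv(1)] and v = sp(2)[OF uv(1)]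
    have Fk: "fa F k = cmp B (fa F u) (fa F t)" using functor_cmp[OF F uv(2) u] uv(3) by simp
    have Ffk: "cmp B (fa F v) (fa F t) = cmp B (fa F f) (fa F k)"
      using functor_cmp[OF F uv(2) v] functor_cmp[OF F k(2) fa] uv(4) by simp
    note h = functor_hom[OF F uv(2)] functor_hom[OF F u] functor_hom[OF F v] functor_hom[OF F k(2)]
      functor_hom[OF F fa]
    have "cmp B (fa F t) g' \<in> hom B G (fo F (dm A u))" using cat_cmp_hom[OF B k(4) h(1)] .
    moreover have "cmp B (fa F u) (cmp B (fa F t) g') = g"
      using cat_assoc[OF B k(4) h(1,2)] Fk k(5) by simp
    moreover have "cmp B (fa F v) (cmp B (fa F t) g') = cmp B (fa F f) g"
      using cat_assoc[OF B k(4) h(1,3)] cat_assoc[OF B k(4) h(4,5)] Ffk k(5) by simp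
    moreover have "dm B (fa F u) = fo F (dm A u)" using h(2) by (simp add: hom_def)
    ultimately show ?thesis using uv(1) by force
  qed
  ultimately show ?thesis using embeddingI[OF functor_hom[OF F fa]] by blast
qed

section \<open>Homomorphisms and positive formulas\<close>

abbreviation tuple_map :: "'p set \<Rightarrow> ('p \<Rightarrow> 's) \<Rightarrow> ('s \<Rightarrow> 'u \<Rightarrow> 'u) \<Rightarrow> ('p \<Rightarrow> 'u) \<Rightarrow> 'p \<Rightarrow> 'u" where
  "tuple_map P \<sigma> h a \<equiv> \<lambda>p \<in> P. h (\<sigma> p) (a p)"

lemma struct_hom_in: "is_struct_hom L M N h \<Longrightarrow> x \<in> carr M s \<Longrightarrow> h s x \<in> carr N s"
  unfolding is_struct_hom_def by (blast intro: PiE_mem)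

lemma struct_hom_fint:
  "is_struct_hom L M N h \<Longrightarrow> f \<in> funs L \<Longrightarrow> a \<in> fargs L M f \<Longrightarrow>
    h (fres L f) (fint M f a) = fint N f (tuple_map (far L f) (fsort L f) h a)"
  unfolding is_struct_hom_def by blast

lemma struct_hom_rint:
  "is_struct_hom L M N h \<Longrightarrow> R \<in> rels L \<Longrightarrow> a \<in> rint M R \<Longrightarrow>
    tuple_map (rar L R) (rsort L R) h a \<in> rint N R"
  unfolding is_struct_hom_def by blast

lemma struct_fint:
  assumes "is_struct L M" "f \<in> funs L" "a \<in> fargs L M f"
  shows "fint M f a \<in> carr M (fres L f)"
proof -
  have "fint M f \<in> fargs L M f \<rightarrow>\<^sub>E carr M (fres L f)" using assms unfolding is_struct_def by blast
  then show ?thesis using assms(3) by (rule PiE_mem)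
qed

lemma struct_rint: "is_struct L M \<Longrightarrow> R \<in> rels L \<Longrightarrow> rint M R \<subseteq> rargs L M R"
  unfolding is_struct_def by blast

lemma tuple_map_fargs:
  "(\<And>s x. x \<in> carr M s \<Longrightarrow> h s x \<in> carr N s) \<Longrightarrow> a \<in> fargs L M f \<Longrightarrow> tuple_map (far L f) (fsort L f) h a \<in> fargs L N f"
  unfolding fargs_def by (auto simp: PiE_iff)

lemma tuple_map_rargs:
  "(\<And>s x. x \<in> carr M s \<Longrightarrow> h s x \<in> carr N s) \<Longrightarrow> a \<in> rargs L M R \<Longrightarrow> tuple_map (rar L R) (rsort L R) h a \<in> rargs L N R"
  unfolding rargs_def by (auto simp: PiE_iff)

lemma eval_in:
  assumes "is_struct L M" "\<And>x. x \<in> V \<Longrightarrow> a x \<in> carr M (snd x)"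
  shows "wf_tm L V t s \<Longrightarrow> eval_tm L M a t \<in> carr M s"
proof (induction t arbitrary: s)
  case (Var x)
  then show ?case using assms(2)[of x] by simp
next
  case (App f t)
  then have f: "f \<in> funs L" "fres L f = s" and t: "\<And>p. p \<in> far L f \<Longrightarrow> wf_tm L V (t p) (fsort L f p)" by auto
  have "(\<lambda>p \<in> far L f. eval_tm L M a (t p)) \<in> fargs L M f"
    using App.IH[OF rangeI t] by (simp add: fargs_def PiE_iff)
  then show ?case using struct_fint[OF assms(1) f(1)] f(2) by simp
qed

lemma eval_args:
  assumes "is_struct L M" "\<And>x. x \<in> V \<Longrightarrow> a x \<in> carr M (snd x)"
    and "\<And>p. p \<in> P \<Longrightarrow> wf_tm L V (t p) (\<sigma> p)"
  shows "(\<lambda>p \<in> P. eval_tm L M a (t p)) \<in> (\<Pi>\<^sub>E p \<in> P. carr M (\<sigma> p))"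
proof -
  have "eval_tm L M a (t p) \<in> carr M (\<sigma> p)" if "p \<in> P" for p
    by (rule eval_in[where V = V]) (use assms that in \<open>simp_all\<close>)
  then show ?thesis by (simp add: PiE_iff)
qed

lemma hom_eval:
  assumes M: "is_struct L M" and h: "is_struct_hom L M N h"
    and a: "\<And>x. x \<in> V \<Longrightarrow> a x \<in> carr M (snd x)"
    and b: "\<And>x. x \<in> V \<Longrightarrow> b x = h (snd x) (a x)"
  shows "wf_tm L V t s \<Longrightarrow> eval_tm L N b t = h s (eval_tm L M a t)"
proof (induction t arbitrary: s)
  case (Var x)
  then show ?case using b[of x] by auto
next
  case (App f t)
  then have f: "f \<in> funs L" "fres L f = s" and t: "\<And>p. p \<in> far L f \<Longrightarrow> wf_tm L V (t p) (fsort L f p)" by auto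
  have "(\<lambda>p \<in> far L f. eval_tm L M a (t p)) \<in> fargs L M f"
    unfolding fargs_def using eval_args[OF M a t] .
  moreover have "(\<lambda>p \<in> far L f. eval_tm L N b (t p)) =
      tuple_map (far L f) (fsort L f) h (\<lambda>p \<in> far L f. eval_tm L M a (t p))"
    by (rule ext) (simp add: App.IH[OF rangeI t])
  ultimately show ?case using struct_hom_fint[OF h f(1)] f(2) by simp
qed

text \<open>
  Formulas contain neither negation nor implication, so truth is preserved by homomorphisms. Only
  the values of the valuations on \<open>V\<close> matter, and \<open>b\<close> is constrained only there.
\<close>

lemma hom_sat:
  assumes M: "is_struct L M" and h: "is_struct_hom L M N h"
    and a: "\<And>x. x \<in> V \<Longrightarrow> a x \<in> carr M (snd x)"
    and b: "\<And>x. x \<in> V \<Longrightarrow> b x = h (snd x) (a x)"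
  shows "wf_fm lam L V \<phi> \<Longrightarrow> sat_fm L M a \<phi> \<Longrightarrow> sat_fm L N b \<phi>"
proof (induction \<phi>)
  case (Eq t u)
  then obtain s where "wf_tm L V t s" "wf_tm L V u s" by auto
  then show ?case using hom_eval[OF M h a b] Eq.prems(2) by simp
next
  case (Rel R t)
  then have R: "R \<in> rels L" and t: "\<And>p. p \<in> rar L R \<Longrightarrow> wf_tm L V (t p) (rsort L R p)"
    and sat: "(\<lambda>p \<in> rar L R. eval_tm L M a (t p)) \<in> rint M R" by auto
  have "(\<lambda>p \<in> rar L R. eval_tm L N b (t p)) =
      tuple_map (rar L R) (rsort L R) h (\<lambda>p \<in> rar L R. eval_tm L M a (t p))"
    by (rule ext) (simp add: hom_eval[OF M h a b t])
  then show ?case using struct_hom_rint[OF h R sat] by simp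
qed auto

text \<open>
  Embeddings of structures in the sense of model theory. A monomorphism of models is
  weaker, since it need not reflect the relations.
\<close>

definition strong_embedding ::
  "('s, 'f, 'r, 'p) lang \<Rightarrow> ('s, 'f, 'r, 'p, 'u) struct \<Rightarrow> ('s, 'f, 'r, 'p, 'u) struct \<Rightarrow>
     ('s \<Rightarrow> 'u \<Rightarrow> 'u) \<Rightarrow> bool" where
  "strong_embedding L M N e \<longleftrightarrow> is_struct_hom L M N e \<and> (\<forall>s. inj_on (e s) (carr M s)) \<and>
    (\<forall>R \<in> rels L. \<forall>a \<in> rargs L M R. tuple_map (rar L R) (rsort L R) e a \<in> rint N R \<longrightarrow> a \<in> rint M R)"

lemma strong_embedding_sat:
  assumes M: "is_struct L M" and e: "strong_embedding L M N e"
    and a: "\<And>x. x \<in> V \<Longrightarrow> a x \<in> carr M (snd x)"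
    and b: "\<And>x. x \<in> V \<Longrightarrow> b x = e (snd x) (a x)"
  shows "wf_fm lam L V \<phi> \<Longrightarrow> sat_fm L N b \<phi> \<longleftrightarrow> sat_fm L M a \<phi>"
proof (induction \<phi>)
  case (Eq t u)
  have h: "is_struct_hom L M N e" and inj: "\<And>s. inj_on (e s) (carr M s)"
    using e unfolding strong_embedding_def by auto
  obtain s where s: "wf_tm L V t s" "wf_tm L V u s" using Eq by auto
  have ev: "eval_tm L N b w = e s (eval_tm L M a w)" "eval_tm L M a w \<in> carr M s"
    if "wf_tm L V w s" for w
    using hom_eval[OF M h a b that] eval_in[OF M a that] by auto
  show ?case using ev[OF s(1)] ev[OF s(2)] inj_on_eq_iff[OF inj[of s]] by simp
next
  case (Rel R t)
  have h: "is_struct_hom L M N e" using e unfolding strong_embedding_def by auto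
  have R: "R \<in> rels L" and t: "\<And>p. p \<in> rar L R \<Longrightarrow> wf_tm L V (t p) (rsort L R p)"
    using Rel by auto
  have *: "(\<lambda>p \<in> rar L R. eval_tm L N b (t p)) =
      tuple_map (rar L R) (rsort L R) e (\<lambda>p \<in> rar L R. eval_tm L M a (t p))"
    by (rule ext) (simp add: hom_eval[OF M h a b t])
  have "(\<lambda>p \<in> rar L R. eval_tm L M a (t p)) \<in> rargs L M R"
    unfolding rargs_def using eval_args[OF M a t] .
  then have "(\<lambda>p \<in> rar L R. eval_tm L N b (t p)) \<in> rint N R \<longleftrightarrow>
      (\<lambda>p \<in> rar L R. eval_tm L M a (t p)) \<in> rint M R"
    unfolding * using e struct_hom_rint[OF h R] R unfolding strong_embedding_def by blast
  then show ?case by simp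
qed auto

text \<open>
  A sentence \<open>\<forall>V. \<phi> \<Rightarrow> \<psi>\<close> is universal and quantifier-free inside, and quantifier-free formulas have
  the same truth value in both structures.
\<close>

lemma strong_embedding_model:
  assumes T: "bu_theory lam kap L T" and M: "is_struct L M" and N: "is_model L T N"
    and e: "strong_embedding L M N e"
  shows "is_model L T M"
proof -
  have "sat_fm L M a \<psi>"
    if \<theta>: "(V, \<phi>, \<psi>) \<in> T" and a: "a \<in> (\<Pi>\<^sub>E x \<in> V. carr M (snd x))" and sat: "sat_fm L M a \<phi>" for V \<phi> \<psi> a
  proof -
    define b where "b = (\<lambda>x \<in> V. e (snd x) (a x))"
    have h: "is_struct_hom L M N e" using e unfolding strong_embedding_def by auto
    have wf: "wf_fm lam L V \<phi>" "wf_fm lam L V \<psi>" using T \<theta> unfolding bu_theory_def by auto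
    have a': "\<And>x. x \<in> V \<Longrightarrow> a x \<in> carr M (snd x)" using a by auto
    have b': "\<And>x. x \<in> V \<Longrightarrow> b x = e (snd x) (a x)" by (simp add: b_def)
    have "b \<in> (\<Pi>\<^sub>E x \<in> V. carr N (snd x))" using struct_hom_in[OF h] a' by (auto simp: b_def)
    then have "sat_fm L N b \<phi> \<longrightarrow> sat_fm L N b \<psi>" using N \<theta> unfolding is_model_def by auto
    then show ?thesis using strong_embedding_sat[OF M e a' b'] wf sat by blast
  qed
  then show ?thesis using M unfolding is_model_def by auto
qed

text \<open>
  A strong embedding identifies \<open>M\<close> with the full substructure on its image, and a homomorphism
  with values in a full substructure is a homomorphism into it.
\<close>

lemma strong_embedding_lift:
  assumes G: "is_struct L G" and e: "strong_embedding L M N e" and M: "is_struct L M"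
    and g: "is_struct_hom L G N g"
    and im: "\<And>s x. x \<in> carr G s \<Longrightarrow> g s x \<in> e s ` carr M s"
  obtains g' where "is_struct_hom L G M g'" "\<And>s x. x \<in> carr G s \<Longrightarrow> e s (g' s x) = g s x"
proof
  let ?g = "\<lambda>s. \<lambda>x \<in> carr G s. inv_into (carr M s) (e s) (g s x)"
  have h: "is_struct_hom L M N e" and inj: "inj_on (e s) (carr M s)"
    and refl: "R \<in> rels L \<Longrightarrow> a \<in> rargs L M R \<Longrightarrow>
      tuple_map (rar L R) (rsort L R) e a \<in> rint N R \<Longrightarrow> a \<in> rint M R" for s R a
    using e unfolding strong_embedding_def by auto
  show eg: "e s (?g s x) = g s x" if "x \<in> carr G s" for s x
    using im[OF that] that by (simp add: f_inv_into_f)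
  have gM: "?g s x \<in> carr M s" if "x \<in> carr G s" for s x
    using im[OF that] that by (simp add: inv_into_into)
  have tup: "tuple_map P \<sigma> e (tuple_map P \<sigma> ?g a) = tuple_map P \<sigma> g a"
    if "\<And>p. p \<in> P \<Longrightarrow> a p \<in> carr G (\<sigma> p)" for P \<sigma> a
    using eg that by (auto simp: fun_eq_iff)
  show "is_struct_hom L G M ?g"
    unfolding is_struct_hom_def
  proof (intro conjI allI ballI)
    show "?g s \<in> carr G s \<rightarrow>\<^sub>E carr M s" for s using gM[of _ s] by (auto simp: PiE_iff)
  next
    fix f a assume f: "f \<in> funs L" and a: "a \<in> fargs L G f"
    have ga: "tuple_map (far L f) (fsort L f) ?g a \<in> fargs L M f"
      using tuple_map_fargs[of G ?g M a] gM a by blast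
    have "e (fres L f) (?g (fres L f) (fint G f a)) = g (fres L f) (fint G f a)"
      using eg struct_fint[OF G f a] by blast
    also have "\<dots> = fint N f (tuple_map (far L f) (fsort L f) e (tuple_map (far L f) (fsort L f) ?g a))"
      using struct_hom_fint[OF g f a] tup[of "far L f" a "fsort L f"] a by (simp add: fargs_def PiE_iff)
    also have "\<dots> = e (fres L f) (fint M f (tuple_map (far L f) (fsort L f) ?g a))"
      using struct_hom_fint[OF h f ga] by simp
    finally show "?g (fres L f) (fint G f a) = fint M f (tuple_map (far L f) (fsort L f) ?g a)"
      using inj_onD[OF inj] gM[OF struct_fint[OF G f a]] struct_fint[OF M f ga] by blast
  next
    fix R a assume R: "R \<in> rels L" and a: "a \<in> rint G R"
    have aG: "a \<in> rargs L G R" using struct_rint[OF G R] a by auto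
    have "tuple_map (rar L R) (rsort L R) ?g a \<in> rargs L M R"
      using tuple_map_rargs[of G ?g M a] gM aG by blast
    moreover have "tuple_map (rar L R) (rsort L R) e (tuple_map (rar L R) (rsort L R) ?g a) \<in> rint N R"
      using struct_hom_rint[OF g R a] tup[of "rar L R" a "rsort L R"] aG by (simp add: rargs_def PiE_iff)
    ultimately show "tuple_map (rar L R) (rsort L R) ?g a \<in> rint M R" using refl[OF R] by blast
  qed
qed

section \<open>Substructures\<close>

definition closed_under ::
  "('s, 'f, 'r, 'p) lang \<Rightarrow> ('s, 'f, 'r, 'p, 'u) struct \<Rightarrow> ('s \<Rightarrow> 'u set) \<Rightarrow> bool" where
  "closed_under L M C \<longleftrightarrow> (\<forall>s. C s \<subseteq> carr M s) \<and>
    (\<forall>f \<in> funs L. \<forall>a \<in> (\<Pi>\<^sub>E p \<in> far L f. C (fsort L f p)). fint M f a \<in> C (fres L f))"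

text \<open>
  The induced structure, with all relations inherited; it is a structure when \<open>C\<close> is closed under
  the functions. The values outside the language and outside the arguments from \<open>C\<close> are forced by
  the normalisation of structures.
\<close>

definition substruct ::
  "('s, 'f, 'r, 'p) lang \<Rightarrow> ('s, 'f, 'r, 'p, 'u) struct \<Rightarrow> ('s \<Rightarrow> 'u set) \<Rightarrow> ('s, 'f, 'r, 'p, 'u) struct" where
  "substruct L M C = \<lparr>carr = C,
     fint = (\<lambda>f. if f \<in> funs L then restrict (fint M f) (\<Pi>\<^sub>E p \<in> far L f. C (fsort L f p)) else undefined),
     rint = (\<lambda>R. if R \<in> rels L then rint M R \<inter> (\<Pi>\<^sub>E p \<in> rar L R. C (rsort L R p)) else {})\<rparr>"

abbreviation incl :: "('s \<Rightarrow> 'u set) \<Rightarrow> 's \<Rightarrow> 'u \<Rightarrow> 'u" where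
  "incl C \<equiv> \<lambda>s. \<lambda>x \<in> C s. x"

lemma carr_substruct [simp]: "carr (substruct L M C) = C"
  by (simp add: substruct_def)

lemma tuple_map_incl: "a \<in> (\<Pi>\<^sub>E p \<in> P. C (\<sigma> p)) \<Longrightarrow> tuple_map P \<sigma> (incl C) a = a"
  by (auto simp: fun_eq_iff PiE_iff extensional_def)

lemma substruct:
  assumes M: "is_struct L M" and C: "closed_under L M C"
  shows "is_struct L (substruct L M C)"
  using assms unfolding is_struct_def closed_under_def
  by (auto simp: substruct_def fargs_def rargs_def PiE_iff)

lemma incl_strong_embedding:
  assumes C: "closed_under L M C"
  shows "strong_embedding L (substruct L M C) M (incl C)"
  unfolding strong_embedding_def is_struct_hom_def
proof (intro conjI allI ballI impI)
  show "incl C s \<in> carr (substruct L M C) s \<rightarrow>\<^sub>E carr M s" for s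
    using C unfolding closed_under_def by auto
  show "inj_on (incl C s) (carr (substruct L M C) s)" for s by (auto simp: inj_on_def)
next
  fix f a assume f: "f \<in> funs L" "a \<in> fargs L (substruct L M C) f"
  then have a: "a \<in> (\<Pi>\<^sub>E p \<in> far L f. C (fsort L f p))" by (simp add: fargs_def)
  then have "fint M f a \<in> C (fres L f)" using C f unfolding closed_under_def by blast
  then show "incl C (fres L f) (fint (substruct L M C) f a) = fint M f (tuple_map (far L f) (fsort L f) (incl C) a)"
    unfolding tuple_map_incl[where C = C and \<sigma> = "fsort L f", OF a] using f(1) a by (simp add: substruct_def)
next
  fix R a assume R: "R \<in> rels L" "a \<in> rint (substruct L M C) R"
  then have a: "a \<in> (\<Pi>\<^sub>E p \<in> rar L R. C (rsort L R p))" "a \<in> rint M R" by (auto simp: substruct_def)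
  then show "tuple_map (rar L R) (rsort L R) (incl C) a \<in> rint M R"
    unfolding tuple_map_incl[where C = C and \<sigma> = "rsort L R", OF a(1)] by simp
next
  fix R a assume R: "R \<in> rels L" "a \<in> rargs L (substruct L M C) R"
    "tuple_map (rar L R) (rsort L R) (incl C) a \<in> rint M R"
  then have a: "a \<in> (\<Pi>\<^sub>E p \<in> rar L R. C (rsort L R p))" by (simp add: rargs_def)
  then show "a \<in> rint (substruct L M C) R"
    using R(3) unfolding tuple_map_incl[where C = C and \<sigma> = "rsort L R", OF a] using R(1) by (simp add: substruct_def)
qed

lemma substruct_model:
  assumes "bu_theory lam kap L T" "is_model L T M" "closed_under L M C"
  shows "is_model L T (substruct L M C)"
  using strong_embedding_model[OF assms(1) substruct assms(2) incl_strong_embedding] assms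
  unfolding is_model_def by blast

lemma tuple_preimage:
  assumes b: "b \<in> (\<Pi>\<^sub>E p \<in> P. h (\<sigma> p) ` carr M (\<sigma> p))"
  shows "\<exists>a \<in> (\<Pi>\<^sub>E p \<in> P. carr M (\<sigma> p)). tuple_map P \<sigma> h a = b"
proof -
  have "\<forall>p \<in> P. \<exists>x. x \<in> carr M (\<sigma> p) \<and> b p = h (\<sigma> p) x" using PiE_mem[OF b] by blast
  then obtain c where c: "\<And>p. p \<in> P \<Longrightarrow> c p \<in> carr M (\<sigma> p) \<and> b p = h (\<sigma> p) (c p)" by metis
  have "tuple_map P \<sigma> h (restrict c P) = b"
  proof (rule ext)
    fix p show "tuple_map P \<sigma> h (restrict c P) p = b p"
      using c[of p] PiE_arb[OF b, of p] by (cases "p \<in> P") simp_all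
  qed
  moreover have "restrict c P \<in> (\<Pi>\<^sub>E p \<in> P. carr M (\<sigma> p))" using c by (simp add: PiE_iff)
  ultimately show ?thesis by blast
qed

lemma image_closed_under:
  assumes M: "is_struct L M" and h: "is_struct_hom L M N h"
  shows "closed_under L N (\<lambda>s. h s ` carr M s)"
  unfolding closed_under_def
proof (intro conjI allI ballI)
  show "h s ` carr M s \<subseteq> carr N s" for s using struct_hom_in[OF h] by auto
  fix f b assume f: "f \<in> funs L" and b: "b \<in> (\<Pi>\<^sub>E p \<in> far L f. h (fsort L f p) ` carr M (fsort L f p))"
  obtain a where a: "a \<in> fargs L M f" and ab: "tuple_map (far L f) (fsort L f) h a = b"
    using tuple_preimage[OF b] unfolding fargs_def by blast
  have "fint N f b = h (fres L f) (fint M f a)" using struct_hom_fint[OF h f a] ab by simp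
  then show "fint N f b \<in> h (fres L f) ` carr M (fres L f)"
    using struct_fint[OF M f a] by simp
qed


lemma struct_id_hom:
  assumes M: "is_struct L M"
  shows "is_struct_hom L M M (\<lambda>s. \<lambda>x \<in> carr M s. x)"
  unfolding is_struct_hom_def
proof (intro conjI allI ballI)
  fix f a assume f: "f \<in> funs L" and a: "a \<in> fargs L M f"
  show "(\<lambda>x \<in> carr M (fres L f). x) (fint M f a) = fint M f (tuple_map (far L f) (fsort L f) (incl (carr M)) a)"
    using struct_fint[OF M f a] tuple_map_incl[where C = "carr M" and \<sigma> = "fsort L f", OF a[unfolded fargs_def]]
    by simp
next
  fix R a assume R: "R \<in> rels L" and a: "a \<in> rint M R"
  have "a \<in> rargs L M R" using struct_rint[OF M R] a by blast
  then show "tuple_map (rar L R) (rsort L R) (incl (carr M)) a \<in> rint M R"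
    using a tuple_map_incl[where C = "carr M" and \<sigma> = "rsort L R" and a = a] by (simp add: rargs_def)
qed simp

section \<open>Concrete directed colimits of structures\<close>

text \<open>
  A directed system of structures whose indices and elements are taken from one and the same type.
  The aim is to realise its colimit on that type again, so that the colimit is an object of the
  category of models and can be used as a test object.
\<close>

locale directed_system =
  fixes lam :: "'k rel" and r :: "'u rel" and L :: "('s, 'f, 'r, 'p) lang"
    and M :: "'u \<Rightarrow> ('s, 'f, 'r, 'p, 'u) struct" and d :: "'u \<Rightarrow> 'u \<Rightarrow> 's \<Rightarrow> 'u \<Rightarrow> 'u"
  assumes inf: "Cinfinite lam" and dir: "directed_poset lam r"
    and far_small: "f \<in> funs L \<Longrightarrow> |far L f| <o lam"
    and rar_small: "R \<in> rels L \<Longrightarrow> |rar L R| <o lam"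
    and struct: "i \<in> Field r \<Longrightarrow> is_struct L (M i)"
    and hom: "(i, j) \<in> r \<Longrightarrow> is_struct_hom L (M i) (M j) (d i j)"
    and trans: "(i, j) \<in> r \<Longrightarrow> (j, l) \<in> r \<Longrightarrow> x \<in> carr (M i) s \<Longrightarrow> d j l s (d i j s x) = d i l s x"
begin

lemma d_in: "(i, j) \<in> r \<Longrightarrow> x \<in> carr (M i) s \<Longrightarrow> d i j s x \<in> carr (M j) s"
  using struct_hom_in[OF hom] .

text \<open>
  A pair \<open>(i, x)\<close> stands for the element \<open>x\<close> at stage \<open>i\<close>. Two such pairs represent the same
  element of the colimit if they become equal at some common later stage.
\<close>

definition meets :: "'s \<Rightarrow> 'u \<times> 'u \<Rightarrow> 'u \<times> 'u \<Rightarrow> bool" where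
  "meets s z w \<longleftrightarrow> (\<exists>k. (fst z, k) \<in> r \<and> (fst w, k) \<in> r \<and> d (fst z) k s (snd z) = d (fst w) k s (snd w))"

definition stage_elems :: "'s \<Rightarrow> ('u \<times> 'u) set" where
  "stage_elems s = (SIGMA i : Field r. carr (M i) s)"

lemma meets_trans:
  assumes "z \<in> stage_elems s" "w \<in> stage_elems s" "v \<in> stage_elems s" "meets s z w" "meets s w v"
  shows "meets s z v"
proof -
  obtain k where k: "(fst z, k) \<in> r" "(fst w, k) \<in> r" "d (fst z) k s (snd z) = d (fst w) k s (snd w)"
    using assms(4) unfolding meets_def by blast
  obtain l where l: "(fst w, l) \<in> r" "(fst v, l) \<in> r" "d (fst w) l s (snd w) = d (fst v) l s (snd v)"
    using assms(5) unfolding meets_def by blast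
  obtain b where b: "(k, b) \<in> r" "(l, b) \<in> r"
    using directed_bound2[OF inf dir] k l by (metis FieldI2)
  have c: "snd z \<in> carr (M (fst z)) s" "snd w \<in> carr (M (fst w)) s" "snd v \<in> carr (M (fst v)) s"
    using assms(1-3) by (auto simp: stage_elems_def)
  have "d (fst z) b s (snd z) = d (fst v) b s (snd v)"
    using trans[OF k(1) b(1) c(1)] trans[OF k(2) b(1) c(2)] trans[OF l(1) b(2) c(2)]
      trans[OF l(2) b(2) c(3)] k(3) l(3) by simp
  then show ?thesis unfolding meets_def
    using directed_trans[OF dir k(1) b(1)] directed_trans[OF dir l(2) b(2)] by blast
qed

lemma meets_refl: "z \<in> stage_elems s \<Longrightarrow> meets s z z"
  using directed_refl[OF dir] unfolding meets_def stage_elems_def by fastforce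

lemma meets_sym: "meets s z w \<Longrightarrow> meets s w z"
  unfolding meets_def by metis

text \<open>
  The classes of pairs can be named by elements of \<open>'u\<close>. If \<open>'u\<close> is infinite, there are no more
  pairs than elements. If \<open>'u\<close> is finite, the index poset is finite and has, being directed, a
  greatest element \<open>m\<close>; a class is then named by its value at stage \<open>m\<close>.
\<close>

lemma encoding_exists:
  "\<exists>c :: 'u \<times> 'u \<Rightarrow> 'u. \<forall>z \<in> stage_elems s. \<forall>w \<in> stage_elems s. c z = c w \<longleftrightarrow> meets s z w"
proof (cases "finite (UNIV :: 'u set)")
  case True
  then have "|Field r| <o lam"
    by (rule finite_ordLess_Cinfinite[OF inf finite_subset[OF subset_UNIV]])
  then obtain m where m: "\<And>i. i \<in> Field r \<Longrightarrow> (i, m) \<in> r"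
    using dir unfolding directed_poset_def by blast
  have "d (fst z) m s (snd z) = d (fst w) m s (snd w) \<longleftrightarrow> meets s z w"
    if z: "z \<in> stage_elems s" and w: "w \<in> stage_elems s" for z w
  proof -
    have c: "fst z \<in> Field r" "snd z \<in> carr (M (fst z)) s" "fst w \<in> Field r" "snd w \<in> carr (M (fst w)) s"
      using z w by (auto simp: stage_elems_def)
    have "d (fst z) m s (snd z) = d (fst w) m s (snd w)"
      if k: "(fst z, k) \<in> r" "(fst w, k) \<in> r" "d (fst z) k s (snd z) = d (fst w) k s (snd w)" for k
      using trans[OF k(1) m c(2)] trans[OF k(2) m c(4)] k by (metis FieldI2)
    then show ?thesis using m c unfolding meets_def by blast
  qed
  then show ?thesis by (intro exI[of _ "\<lambda>z. d (fst z) m s (snd z)"]) simp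
next
  case False
  then have "|UNIV \<times> UNIV :: ('u \<times> 'u) set| \<le>o |UNIV :: 'u set|"
    using card_of_Times_same_infinite ordIso_iff_ordLeq by blast
  then obtain g :: "'u \<times> 'u \<Rightarrow> 'u" where g: "inj g"
    using card_of_ordLeq[of "UNIV :: ('u \<times> 'u) set" "UNIV :: 'u set"] by auto
  define rep where "rep z = (SOME w. w \<in> stage_elems s \<and> meets s z w)" for z
  have rep: "rep z \<in> stage_elems s \<and> meets s z (rep z)" if "z \<in> stage_elems s" for z
    unfolding rep_def by (rule someI[of _ z]) (simp add: that meets_refl)
  have "rep z = rep w" if "z \<in> stage_elems s" "w \<in> stage_elems s" "meets s z w" for z w
  proof -
    have "meets s z v \<longleftrightarrow> meets s w v" if "v \<in> stage_elems s" for v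
      using meets_trans[OF \<open>z \<in> _\<close> \<open>w \<in> _\<close> that] meets_trans[OF \<open>w \<in> _\<close> \<open>z \<in> _\<close> that]
        \<open>meets s z w\<close> meets_sym by blast
    then have "(\<lambda>v. v \<in> stage_elems s \<and> meets s z v) = (\<lambda>v. v \<in> stage_elems s \<and> meets s w v)" by blast
    then show ?thesis by (simp add: rep_def)
  qed
  moreover have "meets s z w" if "z \<in> stage_elems s" "w \<in> stage_elems s" "rep z = rep w" for z w
  proof -
    have "meets s z (rep z)" "meets s (rep z) w" "rep z \<in> stage_elems s"
      using rep[OF that(1)] rep[OF that(2)] that(3) by (auto intro: meets_sym)
    then show ?thesis using meets_trans[OF that(1) _ that(2)] by blast
  qed
  ultimately have "g (rep z) = g (rep w) \<longleftrightarrow> meets s z w"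
    if "z \<in> stage_elems s" "w \<in> stage_elems s" for z w
    using that unfolding inj_eq[OF g] by blast
  then show ?thesis by (intro exI[of _ "\<lambda>z. g (rep z)"]) blast
qed

definition encode :: "'s \<Rightarrow> 'u \<times> 'u \<Rightarrow> 'u" where
  "encode s = (SOME c. \<forall>z \<in> stage_elems s. \<forall>w \<in> stage_elems s. c z = c w \<longleftrightarrow> meets s z w)"

definition leg :: "'u \<Rightarrow> 's \<Rightarrow> 'u \<Rightarrow> 'u" where
  "leg i s = (\<lambda>x \<in> carr (M i) s. encode s (i, x))"

lemma leg_eq_iff:
  assumes "i \<in> Field r" "j \<in> Field r" "x \<in> carr (M i) s" "y \<in> carr (M j) s"
  shows "leg i s x = leg j s y \<longleftrightarrow> (\<exists>k. (i, k) \<in> r \<and> (j, k) \<in> r \<and> d i k s x = d j k s y)"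
proof -
  have "(\<forall>z \<in> stage_elems s. \<forall>w \<in> stage_elems s. encode s z = encode s w \<longleftrightarrow> meets s z w)"
    using someI_ex[OF encoding_exists[of s]] unfolding encode_def .
  moreover have "(i, x) \<in> stage_elems s" "(j, y) \<in> stage_elems s" using assms by (auto simp: stage_elems_def)
  ultimately have "encode s (i, x) = encode s (j, y) \<longleftrightarrow> meets s (i, x) (j, y)" by blast
  then show ?thesis using assms(3,4) unfolding leg_def meets_def by simp
qed

lemma leg_d:
  assumes e: "(i, j) \<in> r" and x: "x \<in> carr (M i) s"
  shows "leg j s (d i j s x) = leg i s x"
proof -
  have ij: "i \<in> Field r" "j \<in> Field r" using e by (auto simp: Field_def)
  show ?thesis unfolding leg_eq_iff[OF ij(2,1) d_in[OF e x] x]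
    using e directed_refl[OF dir ij(2)] trans[OF e directed_refl[OF dir ij(2)] x] by blast
qed

text \<open>
  The legs \<open>l\<close> of the cocone are arbitrary, because the lemma serves both the concrete colimit and
  a colimit given only by its universal property.
\<close>

lemma tuple_from_stage:
  assumes l: "\<And>i j s x. (i, j) \<in> r \<Longrightarrow> x \<in> carr (M i) s \<Longrightarrow> l j s (d i j s x) = l i s x"
    and P: "|P| <o lam" and z: "z \<in> (\<Pi>\<^sub>E p \<in> P. \<Union>i \<in> Field r. l i (\<sigma> p) ` carr (M i) (\<sigma> p))"
  obtains i a where "i \<in> Field r" "a \<in> (\<Pi>\<^sub>E p \<in> P. carr (M i) (\<sigma> p))" "tuple_map P \<sigma> (l i) a = z"
proof -
  have "\<exists>i \<in> Field r. \<forall>p \<in> P. z p \<in> l i (\<sigma> p) ` carr (M i) (\<sigma> p)"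
  proof (rule directed_common_stage[OF dir P])
    show "\<exists>i \<in> Field r. z p \<in> l i (\<sigma> p) ` carr (M i) (\<sigma> p)" if "p \<in> P" for p
      using PiE_mem[OF z that] by blast
    show "z p \<in> l j (\<sigma> p) ` carr (M j) (\<sigma> p)"
      if im: "z p \<in> l i (\<sigma> p) ` carr (M i) (\<sigma> p)" and e: "(i, j) \<in> r" for p i j
    proof -
      obtain x where x: "x \<in> carr (M i) (\<sigma> p)" "z p = l i (\<sigma> p) x" using im by blast
      show ?thesis using l[OF e x(1)] d_in[OF e x(1)] x(2) by (metis imageI)
    qed
  qed
  then obtain i where i: "i \<in> Field r" "\<forall>p \<in> P. z p \<in> l i (\<sigma> p) ` carr (M i) (\<sigma> p)" by blast
  have "z \<in> (\<Pi>\<^sub>E p \<in> P. l i (\<sigma> p) ` carr (M i) (\<sigma> p))"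
    using i(2) z by (simp add: PiE_iff)
  from tuple_preimage[OF this] show ?thesis using that i(1) by blast
qed

lemma tuple_equal_stage:
  assumes P: "|P| <o lam" and ij: "i \<in> Field r" "j \<in> Field r"
    and a: "\<And>p. p \<in> P \<Longrightarrow> a p \<in> carr (M i) (\<sigma> p)" and b: "\<And>p. p \<in> P \<Longrightarrow> b p \<in> carr (M j) (\<sigma> p)"
    and eq: "\<And>p. p \<in> P \<Longrightarrow> leg i (\<sigma> p) (a p) = leg j (\<sigma> p) (b p)"
  obtains k where "(i, k) \<in> r" "(j, k) \<in> r" "\<And>p. p \<in> P \<Longrightarrow> d i k (\<sigma> p) (a p) = d j k (\<sigma> p) (b p)"
proof -
  let ?Q = "\<lambda>p k. (i, k) \<in> r \<and> (j, k) \<in> r \<and> d i k (\<sigma> p) (a p) = d j k (\<sigma> p) (b p)"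
  have up: "?Q p l" if p: "p \<in> P" and k: "?Q p k" and kl: "(k, l) \<in> r" for p k l
    using trans[OF _ kl a[OF p]] trans[OF _ kl b[OF p]] k directed_trans[OF dir _ kl] by metis
  have "\<exists>k \<in> Field r. \<forall>p \<in> P. ?Q p k"
  proof (rule directed_common_stage[OF dir P])
    show "\<exists>k \<in> Field r. ?Q p k" if p: "p \<in> P" for p
      using leg_eq_iff[OF ij a[OF p] b[OF p]] eq[OF p] by (metis FieldI2)
  qed (rule up)
  then obtain k where k: "k \<in> Field r" "\<forall>p \<in> P. ?Q p k" by blast
  obtain i' where i': "i' \<in> Field r" "(i, i') \<in> r" "(j, i') \<in> r" using directed_bound2[OF inf dir ij] .
  obtain m where m: "(k, m) \<in> r" "(i', m) \<in> r" using directed_bound2[OF inf dir k(1) i'(1)] .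
  show ?thesis
  proof (rule that)
    show "(i, m) \<in> r" "(j, m) \<in> r" using directed_trans[OF dir _ m(2)] i' by auto
    show "d i m (\<sigma> p) (a p) = d j m (\<sigma> p) (b p)" if p: "p \<in> P" for p
      using up[OF p _ m(1)] k(2) p by blast
  qed
qed

definition colim_carr :: "'s \<Rightarrow> 'u set" where
  "colim_carr s = (\<Union>i \<in> Field r. leg i s ` carr (M i) s)"

text \<open>
  The value of a function at a tuple is computed at any stage that contains the whole tuple; that
  the choice does not matter is \<open>colim_fint\<close>.
\<close>

definition colim :: "('s, 'f, 'r, 'p, 'u) struct" where
  "colim = \<lparr>carr = colim_carr,
     fint = (\<lambda>f. if f \<in> funs L then (\<lambda>z \<in> (\<Pi>\<^sub>E p \<in> far L f. colim_carr (fsort L f p)).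
        SOME y. \<exists>i \<in> Field r. \<exists>a \<in> fargs L (M i) f.
          z = tuple_map (far L f) (fsort L f) (leg i) a \<and> y = leg i (fres L f) (fint (M i) f a))
        else undefined),
     rint = (\<lambda>R. if R \<in> rels L then
        (\<Union>i \<in> Field r. tuple_map (rar L R) (rsort L R) (leg i) ` rint (M i) R) else {})\<rparr>"

lemma carr_colim [simp]: "carr colim = colim_carr"
  by (simp add: colim_def)

lemma leg_in: "i \<in> Field r \<Longrightarrow> x \<in> carr (M i) s \<Longrightarrow> leg i s x \<in> colim_carr s"
  by (auto simp: colim_carr_def)

lemma colim_tuple:
  assumes "|P| <o lam" "z \<in> (\<Pi>\<^sub>E p \<in> P. colim_carr (\<sigma> p))"
  obtains i a where "i \<in> Field r" "a \<in> (\<Pi>\<^sub>E p \<in> P. carr (M i) (\<sigma> p))" "tuple_map P \<sigma> (leg i) a = z"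
  using tuple_from_stage[of leg P z \<sigma>, OF leg_d] assms unfolding colim_carr_def by blast

lemma colim_fint:
  assumes f: "f \<in> funs L" and i: "i \<in> Field r" and a: "a \<in> fargs L (M i) f"
  shows "fint colim f (tuple_map (far L f) (fsort L f) (leg i) a) = leg i (fres L f) (fint (M i) f a)"
proof -
  let ?tm = "\<lambda>i. tuple_map (far L f) (fsort L f) (leg i)"
  have ai: "a p \<in> carr (M i) (fsort L f p)" if "p \<in> far L f" for p
    using a that by (auto simp: fargs_def)
  have z: "?tm i a \<in> (\<Pi>\<^sub>E p \<in> far L f. colim_carr (fsort L f p))"
    using ai leg_in[OF i] by (simp add: PiE_iff)
  \<comment> \<open>Two representations of one tuple coincide at a later stage, in all positions at once.\<close>
  have uniq: "leg j (fres L f) (fint (M j) f b) = leg i (fres L f) (fint (M i) f a)"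
    if j: "j \<in> Field r" and b: "b \<in> fargs L (M j) f" and eq: "?tm i a = ?tm j b" for j b
  proof -
    have bj: "b p \<in> carr (M j) (fsort L f p)" if "p \<in> far L f" for p
      using b that by (auto simp: fargs_def)
    have "leg i (fsort L f p) (a p) = leg j (fsort L f p) (b p)" if "p \<in> far L f" for p
      using fun_cong[OF eq, of p] that by simp
    then obtain k where k: "(i, k) \<in> r" "(j, k) \<in> r"
      "\<And>p. p \<in> far L f \<Longrightarrow> d i k (fsort L f p) (a p) = d j k (fsort L f p) (b p)"
      using tuple_equal_stage[where \<sigma> = "fsort L f", OF far_small[OF f] i j ai bj] by blast
    have "tuple_map (far L f) (fsort L f) (d i k) a = tuple_map (far L f) (fsort L f) (d j k) b"
      by (rule ext) (simp add: k(3))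
    then have "d i k (fres L f) (fint (M i) f a) = d j k (fres L f) (fint (M j) f b)"
      using struct_hom_fint[OF hom[OF k(1)] f a] struct_hom_fint[OF hom[OF k(2)] f b] by simp
    then show ?thesis
      using leg_d[OF k(1) struct_fint[OF struct[OF i] f a]] leg_d[OF k(2) struct_fint[OF struct[OF j] f b]]
      by simp
  qed
  let ?P = "\<lambda>y. \<exists>j \<in> Field r. \<exists>b \<in> fargs L (M j) f. ?tm i a = ?tm j b \<and> y = leg j (fres L f) (fint (M j) f b)"
  have "fint colim f (?tm i a) = (SOME y. ?P y)"
    using f z by (simp add: colim_def)
  moreover have "?P (leg i (fres L f) (fint (M i) f a))" using i a by blast
  then have "?P (SOME y. ?P y)" by (rule someI[of ?P])
  then obtain j b where "j \<in> Field r" "b \<in> fargs L (M j) f" "?tm i a = ?tm j b"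
    "(SOME y. ?P y) = leg j (fres L f) (fint (M j) f b)" by blast
  ultimately show ?thesis using uniq by simp
qed

lemma colim_rint:
  "R \<in> rels L \<Longrightarrow> rint colim R = (\<Union>i \<in> Field r. tuple_map (rar L R) (rsort L R) (leg i) ` rint (M i) R)"
  by (simp add: colim_def)

lemma leg_hom:
  assumes i: "i \<in> Field r"
  shows "is_struct_hom L (M i) colim (leg i)"
  unfolding is_struct_hom_def
proof (intro conjI allI ballI)
  show "leg i s \<in> carr (M i) s \<rightarrow>\<^sub>E carr colim s" for s
    using leg_in[OF i] by (simp add: PiE_iff) (simp add: leg_def)
qed (use colim_fint[OF _ i] colim_rint i in auto)

lemma colim_struct: "is_struct L colim"
  unfolding is_struct_def
proof (intro conjI allI ballI impI)
  show "carr colim s = {}" if "s \<notin> sorts L" for s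
    using struct that unfolding is_struct_def by (auto simp: colim_carr_def)
  show "fint colim f = undefined" if "f \<notin> funs L" for f using that by (simp add: colim_def)
  show "rint colim R = {}" if "R \<notin> rels L" for R using that by (simp add: colim_def)
next
  fix f assume f: "f \<in> funs L"
  have "fint colim f z \<in> colim_carr (fres L f)" if z: "z \<in> fargs L colim f" for z
  proof -
    obtain i a where i: "i \<in> Field r" and a: "a \<in> fargs L (M i) f"
      and za: "tuple_map (far L f) (fsort L f) (leg i) a = z"
      using colim_tuple[OF far_small[OF f], of z "fsort L f"] z by (auto simp: fargs_def)
    show ?thesis using colim_fint[OF f i a] leg_in[OF i struct_fint[OF struct[OF i] f a]] za by simp
  qed
  then show "fint colim f \<in> fargs L colim f \<rightarrow>\<^sub>E carr colim (fres L f)"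
    using f by (simp add: PiE_iff) (simp add: colim_def fargs_def)
next
  fix R assume R: "R \<in> rels L"
  show "rint colim R \<subseteq> rargs L colim R"
    unfolding colim_rint[OF R]
  proof clarify
    fix i a assume i: "i \<in> Field r" and a: "a \<in> rint (M i) R"
    have "a \<in> rargs L (M i) R" using struct_rint[OF struct[OF i] R] a by blast
    then show "tuple_map (rar L R) (rsort L R) (leg i) a \<in> rargs L colim R"
      using tuple_map_rargs[of "M i" "leg i" colim a] leg_in[OF i] by simp
  qed
qed

text \<open>
  Atomic formulas hold in the colimit exactly because of a witness at some stage. A conjunction has
  fewer than \<open>\<lambda>\<close> members, whose stages have a common upper bound, and truth persists to later
  stages; for a disjunction the stage of one true member suffices.
\<close>

lemma sat_at_stage:
  assumes i: "i \<in> Field r" and a: "\<And>x. x \<in> V \<Longrightarrow> a x \<in> carr (M i) (snd x)"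
    and b: "\<And>x. x \<in> V \<Longrightarrow> b x = leg i (snd x) (a x)"
  shows "wf_fm lam L V \<phi> \<Longrightarrow> sat_fm L colim b \<phi> \<Longrightarrow>
    \<exists>j. (i, j) \<in> r \<and> sat_fm L (M j) (\<lambda>x. d i j (snd x) (a x)) \<phi>"
proof (induction \<phi>)
  case (Eq t u)
  then obtain s where s: "wf_tm L V t s" "wf_tm L V u s" by auto
  have "leg i s (eval_tm L (M i) a t) = leg i s (eval_tm L (M i) a u)"
    using hom_eval[OF struct[OF i] leg_hom[OF i] a b s(1)]
      hom_eval[OF struct[OF i] leg_hom[OF i] a b s(2)] Eq.prems(2) by simp
  then obtain k where k: "(i, k) \<in> r" "d i k s (eval_tm L (M i) a t) = d i k s (eval_tm L (M i) a u)"
    using leg_eq_iff[OF i i eval_in[OF struct[OF i] a s(1)] eval_in[OF struct[OF i] a s(2)]] by auto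
  then have "sat_fm L (M k) (\<lambda>x. d i k (snd x) (a x)) (Eq t u)"
    using hom_eval[OF struct[OF i] hom[OF k(1)] a refl s(1)]
      hom_eval[OF struct[OF i] hom[OF k(1)] a refl s(2)] by simp
  then show ?case using k(1) by blast
next
  case (Rel R t)
  then have R: "R \<in> rels L" and t: "\<And>p. p \<in> rar L R \<Longrightarrow> wf_tm L V (t p) (rsort L R p)" by auto
  let ?v = "\<lambda>p. eval_tm L (M i) a (t p)"
  have "(\<lambda>p \<in> rar L R. eval_tm L colim b (t p)) \<in> rint colim R" using Rel.prems(2) by simp
  then obtain j c where j: "j \<in> Field r" and c: "c \<in> rint (M j) R"
    and eq: "(\<lambda>p \<in> rar L R. eval_tm L colim b (t p)) = tuple_map (rar L R) (rsort L R) (leg j) c"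
    unfolding colim_rint[OF R] by blast
  have "c \<in> rargs L (M j) R" using struct_rint[OF struct[OF j] R] c by blast
  then have cj: "\<And>p. p \<in> rar L R \<Longrightarrow> c p \<in> carr (M j) (rsort L R p)" by (auto simp: rargs_def)
  have vi: "\<And>p. p \<in> rar L R \<Longrightarrow> ?v p \<in> carr (M i) (rsort L R p)"
    using eval_in[OF struct[OF i] a t] by blast
  have "leg i (rsort L R p) (?v p) = leg j (rsort L R p) (c p)" if "p \<in> rar L R" for p
    using fun_cong[OF eq, of p] that hom_eval[OF struct[OF i] leg_hom[OF i] a b t[OF that]] by simp
  then obtain k where k: "(i, k) \<in> r" "(j, k) \<in> r"
    "\<And>p. p \<in> rar L R \<Longrightarrow> d i k (rsort L R p) (?v p) = d j k (rsort L R p) (c p)"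
    using tuple_equal_stage[where \<sigma> = "rsort L R", OF rar_small[OF R] i j vi cj] by blast
  have "(\<lambda>p \<in> rar L R. eval_tm L (M k) (\<lambda>x. d i k (snd x) (a x)) (t p)) =
      tuple_map (rar L R) (rsort L R) (d j k) c"
    by (rule ext) (simp add: k(3)[symmetric] hom_eval[OF struct[OF i] hom[OF k(1)] a refl t])
  then have "sat_fm L (M k) (\<lambda>x. d i k (snd x) (a x)) (Rel R t)"
    using struct_hom_rint[OF hom[OF k(2)] R c] by simp
  then show ?case using k(1) by blast
next
  case (Conj I ph)
  let ?Q = "\<lambda>\<iota> j. (i, j) \<in> r \<and> sat_fm L (M j) (\<lambda>x. d i j (snd x) (a x)) (ph \<iota>)"
  have I: "|I| <o lam" and wf: "\<And>\<iota>. \<iota> \<in> I \<Longrightarrow> wf_fm lam L V (ph \<iota>)" using Conj.prems by auto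
  have up: "?Q \<iota> l" if \<iota>: "\<iota> \<in> I" and j: "?Q \<iota> j" and jl: "(j, l) \<in> r" for \<iota> j l
  proof
    have ij: "(i, j) \<in> r" and j': "j \<in> Field r" using j by (auto simp: Field_def)
    show "(i, l) \<in> r" using directed_trans[OF dir ij jl] .
    show "sat_fm L (M l) (\<lambda>x. d i l (snd x) (a x)) (ph \<iota>)"
      by (rule hom_sat[OF struct[OF j'] hom[OF jl] _ _ wf[OF \<iota>] conjunct2[OF j]])
        (use d_in[OF ij a] trans[OF ij jl a] in auto)
  qed
  have "\<exists>j \<in> Field r. \<forall>\<iota> \<in> I. ?Q \<iota> j"
  proof (rule directed_common_stage[OF dir I])
    show "\<exists>j \<in> Field r. ?Q \<iota> j" if \<iota>: "\<iota> \<in> I" for \<iota>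
    proof -
      have "sat_fm L colim b (ph \<iota>)" using Conj.prems(2) \<iota> by simp
      then show ?thesis using Conj.IH[OF rangeI wf[OF \<iota>]] by (metis FieldI2)
    qed
  qed (rule up)
  then obtain j where j: "j \<in> Field r" "\<forall>\<iota> \<in> I. ?Q \<iota> j" by blast
  obtain m where m: "(i, m) \<in> r" "(j, m) \<in> r" using directed_bound2[OF inf dir i j(1)] .
  have "sat_fm L (M m) (\<lambda>x. d i m (snd x) (a x)) (Conj I ph)"
    using up[OF _ _ m(2)] j(2) by auto
  then show ?case using m(1) by blast
next
  case (Disj I ph)
  then obtain \<iota> where \<iota>: "\<iota> \<in> I" "wf_fm lam L V (ph \<iota>)" "sat_fm L colim b (ph \<iota>)" by auto
  then show ?case using Disj.IH[OF rangeI \<iota>(2,3)] by auto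
qed

text \<open>
  The parameters of a sentence, fewer than \<open>\<kappa> \<le> \<lambda>\<close> many, and the truth of \<open>\<phi>\<close> are both found at one
  stage. There \<open>\<psi>\<close> holds, and the leg carries it to the colimit.
\<close>

lemma colim_model:
  assumes T: "bu_theory lam kap L T" and kap: "kap \<le>o lam"
    and model: "\<And>i. i \<in> Field r \<Longrightarrow> is_model L T (M i)"
  shows "is_model L T colim"
proof -
  have "sat_fm L colim b \<psi>"
    if \<theta>: "(V, \<phi>, \<psi>) \<in> T" and b: "b \<in> (\<Pi>\<^sub>E x \<in> V. carr colim (snd x))" and sat: "sat_fm L colim b \<phi>" for V \<phi> \<psi> b
  proof -
    have wf: "wf_fm lam L V \<phi>" "wf_fm lam L V \<psi>" and V: "|V| <o lam"
      using T \<theta> kap unfolding bu_theory_def by (auto intro: ordLess_ordLeq_trans)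
    obtain i a where i: "i \<in> Field r" and a: "a \<in> (\<Pi>\<^sub>E x \<in> V. carr (M i) (snd x))"
      and ab: "tuple_map V snd (leg i) a = b"
      using colim_tuple[OF V, of b snd] b by auto
    have a': "\<And>x. x \<in> V \<Longrightarrow> a x \<in> carr (M i) (snd x)" using a by auto
    have b': "\<And>x. x \<in> V \<Longrightarrow> b x = leg i (snd x) (a x)" using ab by auto
    obtain j where j: "(i, j) \<in> r" "sat_fm L (M j) (\<lambda>x. d i j (snd x) (a x)) \<phi>"
      using sat_at_stage[OF i a' b' wf(1) sat] by blast
    have jF: "j \<in> Field r" using j by (auto simp: Field_def)
    let ?c = "\<lambda>x \<in> V. d i j (snd x) (a x)"
    have c: "x \<in> V \<Longrightarrow> d i j (snd x) (a x) \<in> carr (M j) (snd x)" for x using d_in[OF j(1) a'] .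
    have id: "is_struct_hom L (M j) (M j) (\<lambda>s. \<lambda>x \<in> carr (M j) s. x)"
      using struct_id_hom[OF struct[OF jF]] .
    have "sat_fm L (M j) ?c \<phi>"
      by (rule hom_sat[OF struct[OF jF] id c _ wf(1) j(2)]) (simp_all add: c)
    moreover have "?c \<in> (\<Pi>\<^sub>E x \<in> V. carr (M j) (snd x))" using c by (simp add: PiE_iff)
    ultimately have s: "sat_fm L (M j) ?c \<psi>"
      using model[OF jF] \<theta> unfolding is_model_def by blast
    show ?thesis
      by (rule hom_sat[OF struct[OF jF] leg_hom[OF jF] _ _ wf(2) s])
        (use c b' leg_d[OF j(1) a'] in auto)
  qed
  then show ?thesis using colim_struct unfolding is_model_def by auto
qed

end

section \<open>Colimits in categories of models\<close>

lemma struct_hom_ext: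
  assumes "is_struct_hom L M N h" "is_struct_hom L M N' h'"
    and "\<And>s x. x \<in> carr M s \<Longrightarrow> h s x = h' s x"
  shows "h = h'"
proof
  fix s
  have "h s \<in> extensional (carr M s)" "h' s \<in> extensional (carr M s)"
    using assms(1,2) unfolding is_struct_hom_def by (auto simp: PiE_iff)
  then show "h s = h' s" using assms(3) by (rule extensionalityI)
qed

lemma struct_hom_comp:
  assumes M: "is_struct L M" and h: "is_struct_hom L M N h" and h': "is_struct_hom L N Q h'"
  shows "is_struct_hom L M Q (\<lambda>s. compose (carr M s) (h' s) (h s))"
  unfolding is_struct_hom_def
proof (intro conjI allI ballI)
  let ?c = "\<lambda>s. compose (carr M s) (h' s) (h s)"
  show "?c s \<in> carr M s \<rightarrow>\<^sub>E carr Q s" for s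
    using struct_hom_in[OF h] struct_hom_in[OF h'] by (simp add: PiE_iff compose_def)
  have tup: "tuple_map P \<sigma> ?c a = tuple_map P \<sigma> h' (tuple_map P \<sigma> h a)"
    if "a \<in> (\<Pi>\<^sub>E p \<in> P. carr M (\<sigma> p))" for P and \<sigma> :: "_ \<Rightarrow> _" and a
    by (rule ext) (simp add: compose_def PiE_mem[OF that])
  show "?c (fres L f) (fint M f a) = fint Q f (tuple_map (far L f) (fsort L f) ?c a)"
    if f: "f \<in> funs L" and a: "a \<in> fargs L M f" for f a
    using struct_hom_fint[OF h f a] struct_hom_fint[OF h' f tuple_map_fargs[OF struct_hom_in[OF h] a]]
      struct_fint[OF M f a] tup[OF a[unfolded fargs_def]]
    by (simp add: compose_def)
  show "tuple_map (rar L R) (rsort L R) ?c a \<in> rint Q R" if R: "R \<in> rels L" and a: "a \<in> rint M R" for R a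
  proof -
    have "a \<in> (\<Pi>\<^sub>E p \<in> rar L R. carr M (rsort L R p))"
      using struct_rint[OF M R] a unfolding rargs_def by blast
    from tup[OF this] show ?thesis using struct_hom_rint[OF h' R struct_hom_rint[OF h R a]] by simp
  qed
qed

lemma substruct_lift:
  assumes G: "is_struct L G" and N: "is_struct L N" and C: "closed_under L N C"
    and g: "is_struct_hom L G N g" and im: "\<And>s x. x \<in> carr G s \<Longrightarrow> g s x \<in> C s"
  shows "is_struct_hom L G (substruct L N C) g"
proof -
  have "g s x \<in> incl C s ` carr (substruct L N C) s" if "x \<in> carr G s" for s x
    using im[OF that] by (force simp: image_iff)
  then obtain g' where g': "is_struct_hom L G (substruct L N C) g'"
    "\<And>s x. x \<in> carr G s \<Longrightarrow> incl C s (g' s x) = g s x"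
    using strong_embedding_lift[OF G incl_strong_embedding[OF C] substruct[OF N C] g] by blast
  have "g' s x = g s x" if "x \<in> carr G s" for s x
    using g'(2)[OF that] struct_hom_in[OF g'(1) that] by simp
  then show ?thesis using struct_hom_ext[OF g'(1) g] g'(1) by metis
qed

lemma hom_mod_cat:
  "\<alpha> \<in> hom (mod_cat L T) M N \<longleftrightarrow>
    (\<exists>h. \<alpha> = (M, h, N) \<and> is_model L T M \<and> is_model L T N \<and> is_struct_hom L M N h)"
  by (auto simp: hom_def mod_cat_def)

lemma ob_mod_cat [simp]: "M \<in> ob (mod_cat L T) \<longleftrightarrow> is_model L T M"
  by (simp add: mod_cat_def)

lemma dm_mod_cat [simp]: "dm (mod_cat L T) \<alpha> = fst \<alpha>"
  by (simp add: mod_cat_def split: prod.split)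

lemma cmp_mod_cat:
  "cmp (mod_cat L T) (N, h', Q) (M, h, N') = (M, \<lambda>s. compose (carr M s) (h' s) (h s), Q)"
  by (simp add: mod_cat_def)

lemma model_struct: "is_model L T M \<Longrightarrow> is_struct L M"
  by (simp add: is_model_def)

lemma mod_hom:
  assumes "\<alpha> \<in> hom (mod_cat L T) M N"
  shows "is_struct_hom L M N (amap \<alpha>)" "is_model L T M" "is_model L T N" "fst \<alpha> = M" "snd (snd \<alpha>) = N"
  using assms unfolding hom_mod_cat by auto

lemma mod_hom_in: "\<alpha> \<in> hom (mod_cat L T) M N \<Longrightarrow> x \<in> carr M s \<Longrightarrow> amap \<alpha> s x \<in> carr N s"
  using struct_hom_in mod_hom(1) by metis

lemma mod_cmp_hom:
  "\<alpha> \<in> hom (mod_cat L T) M N \<Longrightarrow> \<beta> \<in> hom (mod_cat L T) N Q \<Longrightarrow> cmp (mod_cat L T) \<beta> \<alpha> \<in> hom (mod_cat L T) M Q"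
  unfolding hom_mod_cat using struct_hom_comp[OF model_struct] cmp_mod_cat by fastforce

lemma mod_cmp_apply:
  "\<alpha> \<in> hom (mod_cat L T) M N \<Longrightarrow> \<beta> \<in> hom (mod_cat L T) N Q \<Longrightarrow> x \<in> carr M s \<Longrightarrow>
    amap (cmp (mod_cat L T) \<beta> \<alpha>) s x = amap \<beta> s (amap \<alpha> s x)"
  unfolding hom_mod_cat by (auto simp: cmp_mod_cat compose_def)

lemma mod_arrow_eqI:
  assumes "\<alpha> \<in> hom (mod_cat L T) M N" "\<beta> \<in> hom (mod_cat L T) M N"
    "\<And>s x. x \<in> carr M s \<Longrightarrow> amap \<alpha> s x = amap \<beta> s x"
  shows "\<alpha> = \<beta>"
proof -
  have "amap \<alpha> = amap \<beta>" using struct_hom_ext[OF mod_hom(1)[OF assms(1)] mod_hom(1)[OF assms(2)] assms(3)] .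
  then show ?thesis using mod_hom(4,5)[OF assms(1)] mod_hom(4,5)[OF assms(2)] by (simp add: prod_eq_iff)
qed

lemma mod_injective_mono:
  assumes \<alpha>: "\<alpha> \<in> hom (mod_cat L T) M N" and inj: "\<And>s. inj_on (amap \<alpha> s) (carr M s)"
  shows "mono_in (mod_cat L T) \<alpha>"
proof -
  have "u = v" if u: "u \<in> hom (mod_cat L T) Z M" and v: "v \<in> hom (mod_cat L T) Z M"
    and eq: "cmp (mod_cat L T) \<alpha> u = cmp (mod_cat L T) \<alpha> v" for Z u v
  proof (rule mod_arrow_eqI[OF u v])
    fix s x assume x: "x \<in> carr Z s"
    have "amap \<alpha> s (amap u s x) = amap \<alpha> s (amap v s x)"
      using mod_cmp_apply[OF u \<alpha> x] mod_cmp_apply[OF v \<alpha> x] eq by simp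
    then show "amap u s x = amap v s x"
      using inj_onD[OF inj] mod_hom_in[OF u x] mod_hom_in[OF v x] by blast
  qed
  then show ?thesis using \<alpha> mod_hom(4)[OF \<alpha>] unfolding mono_in_def by (simp add: hom_def[of _ M])
qed

lemma strong_embedding_factors:
  assumes e: "e \<in> hom (mod_cat L T) M N" "strong_embedding L M N (amap e)"
    and g: "g \<in> hom (mod_cat L T) G N"
    and im: "\<And>s x. x \<in> carr G s \<Longrightarrow> amap g s x \<in> amap e s ` carr M s"
  obtains t where "t \<in> hom (mod_cat L T) G M" "cmp (mod_cat L T) e t = g"
proof -
  obtain g' where g': "is_struct_hom L G M g'" "\<And>s x. x \<in> carr G s \<Longrightarrow> amap e s (g' s x) = amap g s x"
    using strong_embedding_lift[OF model_struct[OF mod_hom(2)[OF g]] e(2)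
        model_struct[OF mod_hom(2)[OF e(1)]] mod_hom(1)[OF g] im] by blast
  have t: "(G, g', M) \<in> hom (mod_cat L T) G M"
    using g'(1) mod_hom(2)[OF g] mod_hom(2)[OF e(1)] by (simp add: hom_mod_cat)
  show ?thesis
    by (rule that[OF t], rule mod_arrow_eqI[OF mod_cmp_hom[OF t e(1)] g])
      (use mod_cmp_apply[OF t e(1)] g'(2) in auto)
qed

text \<open>
  As \<open>\<kappa> \<le> \<lambda>\<close>, tuples of arguments and of parameters are small enough for \<open>\<lambda>\<close>-directed posets.
\<close>

locale model_category =
  fixes lam :: "'k rel" and kap :: "'c rel" and L :: "('s, 'f, 'r, 'q) lang"
    and T :: "('s, 'f, 'r, 'q, 'v, 'j) bu_sentence set"
  assumes inf: "Cinfinite lam" and kap: "kap \<le>o lam" and lang: "is_lang kap L" and thy: "bu_theory lam kap L T"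
begin

abbreviation Mod :: "(('s, 'f, 'r, 'q, 'u) struct,
    ('s, 'f, 'r, 'q, 'u) struct \<times> ('s \<Rightarrow> 'u \<Rightarrow> 'u) \<times> ('s, 'f, 'r, 'q, 'u) struct) cat" where
  "Mod \<equiv> mod_cat L T"

lemma far_small: "f \<in> funs L \<Longrightarrow> |far L f| <o lam"
  using lang kap unfolding is_lang_def by (blast intro: ordLess_ordLeq_trans)

lemma rar_small: "R \<in> rels L \<Longrightarrow> |rar L R| <o lam"
  using lang kap unfolding is_lang_def by (blast intro: ordLess_ordLeq_trans)

lemma functor_directed_system:
  fixes D :: "('u, 'u \<times> 'u, ('s, 'f, 'r, 'q, 'u) struct, _) func"
  assumes dir: "directed_poset lam r" and D: "is_functor (poset_cat r) Mod D"
  shows "directed_system lam r L (fo D) (\<lambda>i j. amap (fa D (i, j)))"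
proof
  show "is_struct L (fo D i)" if "i \<in> Field r" for i
    using functor_ob[OF D, of i] that model_struct by auto
  show "is_struct_hom L (fo D i) (fo D j) (amap (fa D (i, j)))" if "(i, j) \<in> r" for i j
    using mod_hom(1)[OF poset_functor_hom[OF D that]] .
  show "amap (fa D (j, l)) s (amap (fa D (i, j)) s x) = amap (fa D (i, l)) s x"
    if "(i, j) \<in> r" "(j, l) \<in> r" "x \<in> carr (fo D i) s" for i j l x s
    using mod_cmp_apply[OF poset_functor_hom[OF D that(1)] poset_functor_hom[OF D that(2)] that(3)]
      poset_functor_cmp[OF D that(1,2)] by simp
qed (use inf dir far_small rar_small in auto)

context
  fixes r :: "'u rel" and D :: "('u, 'u \<times> 'u, ('s, 'f, 'r, 'q, 'u) struct, _) func" and N k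
  assumes dir: "directed_poset lam r" and D: "is_functor (poset_cat r) Mod D"
    and col: "is_colimit (poset_cat r) Mod D N k"
begin

interpretation sys: directed_system lam r L "fo D" "\<lambda>i j. amap (fa D (i, j))"
  using functor_directed_system[OF dir D] .

lemma colimit_leg: "i \<in> Field r \<Longrightarrow> k i \<in> hom Mod (fo D i) N"
  using cocone_leg[OF colimit_cocone[OF col]] by simp

lemma colimit_leg_edge:
  assumes "(i, j) \<in> r" "x \<in> carr (fo D i) s"
  shows "amap (k j) s (amap (fa D (i, j)) s x) = amap (k i) s x"
proof -
  have "j \<in> Field r" using assms by (auto simp: Field_def)
  then show ?thesis
    using mod_cmp_apply[OF poset_functor_hom[OF D assms(1)] colimit_leg assms(2)]
      cocone_edge[OF colimit_cocone[OF col] assms(1)] by simp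
qed

text \<open>
  The union of the images of the legs is closed under the functions, since every tuple of arguments
  lies in a single image. As a full substructure it is a model, and the uniqueness of mediating
  arrows forces it to be the whole colimit.
\<close>

lemma colimit_jointly_surjective:
  assumes x: "x \<in> carr N s"
  shows "\<exists>i \<in> Field r. x \<in> amap (k i) s ` carr (fo D i) s"
proof -
  have N: "is_model L T N" using colimit_cocone[OF col] unfolding is_cocone_def by simp
  define C where "C s = (\<Union>i \<in> Field r. amap (k i) s ` carr (fo D i) s)" for s
  have C: "closed_under L N C"
    unfolding closed_under_def
  proof (intro conjI allI ballI)
    show "C s \<subseteq> carr N s" for s using mod_hom_in[OF colimit_leg] by (auto simp: C_def)
    fix f a assume f: "f \<in> funs L" and a: "a \<in> (\<Pi>\<^sub>E p \<in> far L f. C (fsort L f p))"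
    obtain i b where i: "i \<in> Field r" and b: "b \<in> fargs L (fo D i) f"
      and ab: "tuple_map (far L f) (fsort L f) (amap (k i)) b = a"
      using sys.tuple_from_stage[of "\<lambda>i. amap (k i)", OF colimit_leg_edge far_small[OF f] a[unfolded C_def]]
      unfolding fargs_def by blast
    have "fint N f a = amap (k i) (fres L f) (fint (fo D i) f b)"
      using struct_hom_fint[OF mod_hom(1)[OF colimit_leg[OF i]] f b] ab by simp
    then show "fint N f a \<in> C (fres L f)"
      using i struct_fint[OF sys.struct[OF i] f b] unfolding C_def by blast
  qed
  let ?N = "substruct L N C"
  have N': "is_model L T ?N" using substruct_model[OF thy N C] .
  have sub: "(?N, incl C, N) \<in> hom Mod ?N N"
    using N N' incl_strong_embedding[OF C] unfolding hom_mod_cat strong_embedding_def by blast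
  define l where "l i = (fo D i, amap (k i), ?N)" for i
  have l: "l i \<in> hom Mod (fo D i) ?N" if i: "i \<in> Field r" for i
    using substruct_lift[OF sys.struct[OF i] model_struct[OF N] C mod_hom(1)[OF colimit_leg[OF i]]]
      N' mod_hom(2)[OF colimit_leg[OF i]] i unfolding hom_mod_cat l_def C_def by blast
  have "is_cocone (poset_cat r) Mod D ?N l"
  proof (rule poset_coconeI)
    fix i j assume e: "(i, j) \<in> r"
    then have i: "i \<in> Field r" and j: "j \<in> Field r" by (auto simp: Field_def)
    note E = poset_functor_hom[OF D e]
    show "cmp Mod (l j) (fa D (i, j)) = l i"
      by (rule mod_arrow_eqI[OF mod_cmp_hom[OF E l[OF j]] l[OF i]])
        (simp add: mod_cmp_apply[OF E l[OF j], unfolded l_def] l_def colimit_leg_edge[OF e])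
  qed (use N' l in auto)
  from colimit_mediate[OF col this] obtain h where
    h: "h \<in> hom Mod N ?N" "\<And>i. i \<in> Field r \<Longrightarrow> cmp Mod h (k i) = l i" by auto
  have id: "(N, incl (carr N), N) \<in> hom Mod N N"
    using N struct_id_hom[OF model_struct[OF N]] by (simp add: hom_mod_cat)
  have "cmp Mod (?N, incl C, N) h = (N, incl (carr N), N)"
  proof (rule colimit_unique[OF col colimit_cocone[OF col] mod_cmp_hom[OF h(1) sub] _ id])
    fix i assume "i \<in> ob (poset_cat r)"
    then have i: "i \<in> Field r" by simp
    note K = colimit_leg[OF i]
    show "cmp Mod (cmp Mod (?N, incl C, N) h) (k i) = k i"
    proof (rule mod_arrow_eqI[OF mod_cmp_hom[OF K mod_cmp_hom[OF h(1) sub]] K])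
      fix s x assume x: "x \<in> carr (fo D i) s"
      have "amap h s (amap (k i) s x) = amap (k i) s x"
        using mod_cmp_apply[OF K h(1) x] h(2)[OF i] by (simp add: l_def)
      moreover have "amap (k i) s x \<in> C s" using i x by (auto simp: C_def)
      ultimately show "amap (cmp Mod (cmp Mod (?N, incl C, N) h) (k i)) s x = amap (k i) s x"
        using mod_cmp_apply[OF K mod_cmp_hom[OF h(1) sub] x] mod_cmp_apply[OF h(1) sub mod_hom_in[OF K x]]
        by simp
    qed
    show "cmp Mod (N, incl (carr N), N) (k i) = k i"
      by (rule mod_arrow_eqI[OF mod_cmp_hom[OF K id] K])
        (simp add: mod_cmp_apply[OF K id] mod_hom_in[OF K])
  qed
  then have "amap (cmp Mod (?N, incl C, N) h) s x = x" using x by simp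
  moreover have "amap h s x \<in> C s" using mod_hom_in[OF h(1) x] by simp
  ultimately have "x \<in> C s" using mod_cmp_apply[OF h(1) sub x] by simp
  then show ?thesis by (simp add: C_def)
qed

lemma colimit_tuple:
  assumes P: "|P| <o lam" and z: "\<And>p. p \<in> P \<Longrightarrow> z p \<in> carr N (\<sigma> p)"
  obtains i a where "i \<in> Field r" "\<And>p. p \<in> P \<Longrightarrow> a p \<in> carr (fo D i) (\<sigma> p)"
    "\<And>p. p \<in> P \<Longrightarrow> amap (k i) (\<sigma> p) (a p) = z p"
proof -
  have "restrict z P \<in> (\<Pi>\<^sub>E p \<in> P. \<Union>i \<in> Field r. amap (k i) (\<sigma> p) ` carr (fo D i) (\<sigma> p))"
    using colimit_jointly_surjective[OF z] by auto
  then obtain i a where i: "i \<in> Field r" and a: "a \<in> (\<Pi>\<^sub>E p \<in> P. carr (fo D i) (\<sigma> p))"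
    and eq: "tuple_map P \<sigma> (amap (k i)) a = restrict z P"
    using sys.tuple_from_stage[of "\<lambda>i. amap (k i)", OF colimit_leg_edge P] by blast
  have "amap (k i) (\<sigma> p) (a p) = z p" if "p \<in> P" for p using fun_cong[OF eq, of p] that by simp
  then show ?thesis using that[OF i] a by blast
qed

text \<open>
  The concrete colimit is the apex of a cocone of models, so there is a homomorphism from \<open>N\<close> to it,
  and truth in \<open>N\<close> is carried along to the place where it can be traced back to a stage. The
  variables and index types of \<open>\<phi>\<close> are independent of those of \<open>T\<close>.
\<close>

lemma colimit_sat_at_stage:
  assumes i: "i \<in> Field r" and a: "\<And>x. x \<in> V \<Longrightarrow> a x \<in> carr (fo D i) (snd x)"
    and b: "\<And>x. x \<in> V \<Longrightarrow> b x = amap (k i) (snd x) (a x)"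
    and wf: "wf_fm lam L V \<phi>" and sat: "sat_fm L N b \<phi>"
  obtains j where "(i, j) \<in> r" "sat_fm L (fo D j) (\<lambda>x. amap (fa D (i, j)) (snd x) (a x)) \<phi>"
proof -
  have Z: "is_model L T sys.colim"
    using sys.colim_model[OF thy kap] functor_ob[OF D] by simp
  have l: "(fo D i, sys.leg i, sys.colim) \<in> hom Mod (fo D i) sys.colim" if "i \<in> Field r" for i
    using sys.leg_hom[OF that] functor_ob[OF D, of i] that Z by (simp add: hom_mod_cat)
  have "is_cocone (poset_cat r) Mod D sys.colim (\<lambda>i. (fo D i, sys.leg i, sys.colim))"
  proof (rule poset_coconeI)
    fix i j assume e: "(i, j) \<in> r"
    then have i: "i \<in> Field r" and j: "j \<in> Field r" by (auto simp: Field_def)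
    note E = poset_functor_hom[OF D e]
    show "cmp Mod (fo D j, sys.leg j, sys.colim) (fa D (i, j)) = (fo D i, sys.leg i, sys.colim)"
      by (rule mod_arrow_eqI[OF mod_cmp_hom[OF E l[OF j]] l[OF i]])
        (simp add: mod_cmp_apply[OF E l[OF j]] sys.leg_d[OF e])
  qed (use Z l in auto)
  from colimit_mediate[OF col this] obtain h where
    h: "h \<in> hom Mod N sys.colim" "\<And>i. i \<in> Field r \<Longrightarrow> cmp Mod h (k i) = (fo D i, sys.leg i, sys.colim)" by auto
  have bN: "b x \<in> carr N (snd x)" if "x \<in> V" for x
    using b[OF that] mod_hom_in[OF colimit_leg[OF i] a[OF that]] by simp
  have hb: "amap h (snd x) (b x) = sys.leg i (snd x) (a x)" if "x \<in> V" for x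
    using mod_cmp_apply[OF colimit_leg[OF i] h(1) a[OF that]] h(2)[OF i] b[OF that] by simp
  have "sat_fm L sys.colim (\<lambda>x. amap h (snd x) (b x)) \<phi>"
    using hom_sat[OF model_struct[OF mod_hom(2)[OF h(1)]] mod_hom(1)[OF h(1)] bN refl wf sat] .
  from sys.sat_at_stage[OF i a hb wf this] show ?thesis using that by blast
qed

end

end

section \<open>Directed unions of substructures\<close>

definition union_diagram where
  "union_diagram L N C = \<lparr>fo = (\<lambda>i. substruct L N (C i)),
     fa = (\<lambda>(i, j). (substruct L N (C i), incl (C i), substruct L N (C j)))\<rparr>"

context model_category begin

lemma substruct_incl_arrow:
  assumes N: "is_model L T N" and C: "closed_under L N C" "closed_under L N C'" and le: "\<And>s. C s \<subseteq> C' s"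
  shows "(substruct L N C, incl C, substruct L N C') \<in> hom Mod (substruct L N C) (substruct L N C')"
proof -
  have "is_struct_hom L (substruct L N C) N (incl C)"
    using incl_strong_embedding[OF C(1)] unfolding strong_embedding_def by blast
  then have "is_struct_hom L (substruct L N C) (substruct L N C') (incl C)"
    by (rule substruct_lift[OF substruct[OF model_struct[OF N] C(1)] model_struct[OF N] C(2)])
      (use le in auto)
  then show ?thesis using substruct_model[OF thy N] C by (simp add: hom_mod_cat)
qed

lemma substruct_incl_model_arrow:
  assumes N: "is_model L T N" and C: "closed_under L N C"
  shows "(substruct L N C, incl C, N) \<in> hom Mod (substruct L N C) N"
  using incl_strong_embedding[OF C] substruct_model[OF thy N C] N
  unfolding hom_mod_cat strong_embedding_def by blast

context
  fixes r :: "'i rel" and N :: "('s, 'f, 'r, 'q, 'u) struct" and C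
  assumes dir: "directed_poset lam r" and N: "is_model L T N"
    and C: "\<And>i. i \<in> Field r \<Longrightarrow> closed_under L N (C i)"
    and mono: "\<And>i j s. (i, j) \<in> r \<Longrightarrow> C i s \<subseteq> C j s"
    and union: "\<And>s x. x \<in> carr N s \<Longrightarrow> \<exists>i \<in> Field r. x \<in> C i s"
begin

lemma union_diagram_arrow:
  assumes "(i, j) \<in> r"
  shows "fa (union_diagram L N C) (i, j) \<in> hom Mod (substruct L N (C i)) (substruct L N (C j))"
    and "x \<in> C i s \<Longrightarrow> amap (fa (union_diagram L N C) (i, j)) s x = x"
proof -
  have "i \<in> Field r" "j \<in> Field r" using assms by (auto simp: Field_def)
  then show "fa (union_diagram L N C) (i, j) \<in> hom Mod (substruct L N (C i)) (substruct L N (C j))"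
    using substruct_incl_arrow[OF N C C mono[OF assms]] by (simp add: union_diagram_def)
qed (simp add: union_diagram_def)

lemma directed_union_diagram: "directed_mono_diagram lam r Mod (union_diagram L N C)"
proof -
  let ?D = "union_diagram L N C"
  have "is_functor (poset_cat r) Mod ?D"
    unfolding is_functor_def
  proof (intro conjI ballI allI impI)
    show "fo ?D i \<in> ob Mod" if "i \<in> ob (poset_cat r)" for i
      using that substruct_model[OF thy N C] by (simp add: union_diagram_def)
    show "fa ?D e \<in> hom Mod (fo ?D i) (fo ?D j)" if "e \<in> hom (poset_cat r) i j" for i j e
      using that union_diagram_arrow(1) unfolding hom_poset_cat by (auto simp: union_diagram_def)
    show "fa ?D (idt (poset_cat r) i) = idt Mod (fo ?D i)" if "i \<in> ob (poset_cat r)" for i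
      by (simp add: union_diagram_def mod_cat_def)
    show "fa ?D (cmp (poset_cat r) e' e) = cmp Mod (fa ?D e') (fa ?D e)"
      if "e \<in> hom (poset_cat r) i j" "e' \<in> hom (poset_cat r) j l" for i j l e e'
    proof -
      have e: "e = (i, j)" "(i, j) \<in> r" "e' = (j, l)" "(j, l) \<in> r"
        using that by (auto simp: hom_poset_cat)
      note il = directed_trans[OF dir e(2,4)]
      note u = union_diagram_arrow(1)
      have "fa ?D (i, l) = cmp Mod (fa ?D (j, l)) (fa ?D (i, j))"
        by (rule mod_arrow_eqI[OF u[OF il] mod_cmp_hom[OF u[OF e(2)] u[OF e(4)]]])
          (use subsetD[OF mono[OF e(2)]] in \<open>simp add: mod_cmp_apply[OF u[OF e(2)] u[OF e(4)]]
            union_diagram_arrow(2)[OF il] union_diagram_arrow(2)[OF e(2)] union_diagram_arrow(2)[OF e(4)]\<close>)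
      then show ?thesis using e by simp
    qed
  qed
  moreover have "mono_in Mod (fa ?D e)" if e: "e \<in> r" for e
  proof -
    obtain i j where ij: "e = (i, j)" by fastforce
    show ?thesis unfolding ij
      by (rule mod_injective_mono[OF union_diagram_arrow(1)])
        (use e ij union_diagram_arrow(2) in \<open>auto simp: inj_on_def\<close>)
  qed
  ultimately show ?thesis using dir unfolding directed_mono_diagram_def by blast
qed

text \<open>
  Homomorphisms from the members of the union that agree on overlaps glue to a map on \<open>N\<close>. It
  preserves functions and relations because each tuple of arguments lies in one member, and because
  the relations of a member are those induced from \<open>N\<close>.
\<close>

lemma directed_union_colimit:
  "is_colimit (poset_cat r) Mod (union_diagram L N C) N (\<lambda>i. (substruct L N (C i), incl (C i), N))"
  unfolding is_colimit_def
proof (intro conjI allI impI)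
  let ?D = "union_diagram L N C" and ?k = "\<lambda>i. (substruct L N (C i), incl (C i), N)"
  have fo: "fo ?D i = substruct L N (C i)" for i by (simp add: union_diagram_def)
  have k: "?k i \<in> hom Mod (substruct L N (C i)) N" if "i \<in> Field r" for i
    using substruct_incl_model_arrow[OF N C[OF that]] .
  show "is_cocone (poset_cat r) Mod ?D N ?k"
  proof (rule poset_coconeI)
    fix i j assume e: "(i, j) \<in> r"
    then have ij: "i \<in> Field r" "j \<in> Field r" by (auto simp: Field_def)
    note u = union_diagram_arrow(1)[OF e]
    show "cmp Mod (?k j) (fa ?D (i, j)) = ?k i"
      by (rule mod_arrow_eqI[OF mod_cmp_hom[OF u k[OF ij(2)]] k[OF ij(1)]])
        (use mono[OF e] in \<open>auto simp: mod_cmp_apply[OF u k[OF ij(2)]] union_diagram_arrow(2)[OF e]\<close>)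
  qed (use N k fo in auto)
  fix Z l assume cc: "is_cocone (poset_cat r) Mod ?D Z l"
  have l: "l i \<in> hom Mod (substruct L N (C i)) Z" if "i \<in> Field r" for i
    using cocone_leg[OF cc, of i] that by (simp add: fo)
  have Z: "is_model L T Z" using cc unfolding is_cocone_def by simp
  have edge: "amap (l j) s x = amap (l i) s x" if e: "(i, j) \<in> r" and x: "x \<in> C i s" for i j s x
  proof -
    have "j \<in> Field r" using e by (auto simp: Field_def)
    from l[OF this] show ?thesis
      using mod_cmp_apply[OF union_diagram_arrow(1)[OF e], of "l j" Z x s] cocone_edge[OF cc e]
        union_diagram_arrow(2)[OF e x] x by simp
  qed
  have agree: "amap (l i) s x = amap (l j) s x"
    if ij: "i \<in> Field r" "j \<in> Field r" and x: "x \<in> C i s" "x \<in> C j s" for i j s x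
  proof -
    obtain b where "(i, b) \<in> r" "(j, b) \<in> r" using directed_bound2[OF inf dir ij] .
    then show ?thesis using edge x by metis
  qed
  define h where "h s = (\<lambda>x \<in> carr N s. amap (l (SOME i. i \<in> Field r \<and> x \<in> C i s)) s x)" for s
  have h: "h s x = amap (l i) s x" if i: "i \<in> Field r" and x: "x \<in> C i s" for i s x
  proof -
    have "x \<in> carr N s" using C[OF i] x unfolding closed_under_def by blast
    moreover have "(SOME i. i \<in> Field r \<and> x \<in> C i s) \<in> Field r \<and> x \<in> C (SOME i. i \<in> Field r \<and> x \<in> C i s) s"
      by (rule someI[of "\<lambda>i. i \<in> Field r \<and> x \<in> C i s" i]) (simp add: that)
    ultimately show ?thesis using agree[OF _ i _ x] by (simp add: h_def)
  qed
  have stage: "\<exists>i \<in> Field r. \<forall>p \<in> P. a p \<in> C i (\<sigma> p)"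
    if P: "|P| <o lam" and a: "\<And>p. p \<in> P \<Longrightarrow> a p \<in> carr N (\<sigma> p)" for P and \<sigma> :: "'q \<Rightarrow> 's" and a
    by (rule directed_common_stage[OF dir P]) (use union[OF a] mono in blast)+
  have "is_struct_hom L N Z h"
    unfolding is_struct_hom_def
  proof (intro conjI allI ballI)
    have "h s x \<in> carr Z s" if x: "x \<in> carr N s" for s x
    proof -
      obtain i where i: "i \<in> Field r" "x \<in> C i s" using union[OF x] by blast
      show ?thesis using mod_hom_in[OF l[OF i(1)], of x s] h[OF i] i(2) by simp
    qed
    then show "h s \<in> carr N s \<rightarrow>\<^sub>E carr Z s" for s by (simp add: PiE_iff) (simp add: h_def)
  next
    fix f a assume f: "f \<in> funs L" and a: "a \<in> fargs L N f"
    obtain i where i: "i \<in> Field r" and ai: "\<And>p. p \<in> far L f \<Longrightarrow> a p \<in> C i (fsort L f p)"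
      using stage[OF far_small[OF f], of a "fsort L f"] a unfolding fargs_def by blast
    have a': "a \<in> (\<Pi>\<^sub>E p \<in> far L f. C i (fsort L f p))"
      using a ai unfolding fargs_def by (simp add: PiE_iff)
    then have a'': "a \<in> fargs L (substruct L N (C i)) f" by (simp add: fargs_def)
    have fint: "fint (substruct L N (C i)) f a = fint N f a" using f a' by (simp add: substruct_def)
    have "fint N f a \<in> C i (fres L f)" using C[OF i] f a' unfolding closed_under_def by blast
    then have "h (fres L f) (fint N f a) = amap (l i) (fres L f) (fint (substruct L N (C i)) f a)"
      using h[OF i] fint by simp
    also have "\<dots> = fint Z f (tuple_map (far L f) (fsort L f) (amap (l i)) a)"
      using struct_hom_fint[OF mod_hom(1)[OF l[OF i]] f a''] .
    also have "tuple_map (far L f) (fsort L f) (amap (l i)) a = tuple_map (far L f) (fsort L f) h a"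
      by (rule ext) (simp add: h[OF i ai])
    finally show "h (fres L f) (fint N f a) = fint Z f (tuple_map (far L f) (fsort L f) h a)" .
  next
    fix R a assume R: "R \<in> rels L" and a: "a \<in> rint N R"
    have aN: "a \<in> rargs L N R" using struct_rint[OF model_struct[OF N] R] a by blast
    obtain i where i: "i \<in> Field r" and ai: "\<And>p. p \<in> rar L R \<Longrightarrow> a p \<in> C i (rsort L R p)"
      using stage[OF rar_small[OF R], of a "rsort L R"] aN unfolding rargs_def by blast
    have "a \<in> (\<Pi>\<^sub>E p \<in> rar L R. C i (rsort L R p))"
      using aN ai unfolding rargs_def by (simp add: PiE_iff)
    then have "a \<in> rint (substruct L N (C i)) R" using R a by (simp add: substruct_def)
    then have "tuple_map (rar L R) (rsort L R) (amap (l i)) a \<in> rint Z R"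
      using struct_hom_rint[OF mod_hom(1)[OF l[OF i]] R] by blast
    moreover have "tuple_map (rar L R) (rsort L R) (amap (l i)) a = tuple_map (rar L R) (rsort L R) h a"
      by (rule ext) (simp add: h[OF i ai])
    ultimately show "tuple_map (rar L R) (rsort L R) h a \<in> rint Z R" by simp
  qed
  then have H: "(N, h, Z) \<in> hom Mod N Z" using N Z by (simp add: hom_mod_cat)
  show "\<exists>!h. h \<in> hom Mod N Z \<and> (\<forall>i \<in> ob (poset_cat r). cmp Mod h (?k i) = l i)"
  proof (rule ex1I[of _ "(N, h, Z)"], intro conjI ballI)
    fix i assume "i \<in> ob (poset_cat r)"
    then have i: "i \<in> Field r" by simp
    show "cmp Mod (N, h, Z) (?k i) = l i"
      by (rule mod_arrow_eqI[OF mod_cmp_hom[OF k[OF i] H] l[OF i]])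
        (simp add: mod_cmp_apply[OF k[OF i] H] h[OF i])
  next
    fix g assume g: "g \<in> hom Mod N Z \<and> (\<forall>i \<in> ob (poset_cat r). cmp Mod g (?k i) = l i)"
    show "g = (N, h, Z)"
    proof (rule mod_arrow_eqI[OF _ H])
      show "g \<in> hom Mod N Z" using g by blast
      fix s x assume "x \<in> carr N s"
      then obtain i where i: "i \<in> Field r" "x \<in> C i s" using union by blast
      show "amap g s x = amap (N, h, Z) s x"
        using mod_cmp_apply[OF k[OF i(1)] conjunct1[OF g], of x s] g i h[OF i] by simp
    qed
  qed (rule H)
qed

end

text \<open>
  The inclusions between members are monomorphisms, so \<open>hom(G, -)\<close> preserves the union.
\<close>

lemma generated_into_union:
  assumes dir: "directed_poset lam (r :: 'u rel)" and N: "is_model L T N"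
    and C: "\<And>i. i \<in> Field r \<Longrightarrow> closed_under L N (C i)"
    and mono: "\<And>i j s. (i, j) \<in> r \<Longrightarrow> C i s \<subseteq> C j s"
    and union: "\<And>s x. x \<in> carr N s \<Longrightarrow> \<exists>i \<in> Field r. x \<in> C i s"
    and G: "generated_obj TYPE('u) lam Mod G" and g: "g \<in> hom Mod G N"
  obtains i where "i \<in> Field r" "\<And>s x. x \<in> carr G s \<Longrightarrow> amap g s x \<in> C i s"
proof -
  note D = directed_union_diagram[OF dir N C mono union]
    and col = directed_union_colimit[OF dir N C mono union]
  obtain i g' where i: "i \<in> Field r" and "g' \<in> hom Mod G (fo (union_diagram L N C) i)"
    and eq: "cmp Mod (substruct L N (C i), incl (C i), N) g' = g"
    using generated_factor[OF G D col g] .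
  then have g': "g' \<in> hom Mod G (substruct L N (C i))" by (simp add: union_diagram_def)
  show ?thesis
  proof (rule that[OF i])
    fix s x assume x: "x \<in> carr G s"
    have "amap g' s x \<in> C i s" using mod_hom_in[OF g' x] by simp
    then show "amap g s x \<in> C i s"
      using mod_cmp_apply[OF g' substruct_incl_model_arrow[OF N C[OF i]] x] eq by simp
  qed
qed

end

section \<open>Transfer of positive formulas along dense spans\<close>

locale model_functor = model_category lam kap L T
  for lam :: "'k rel" and kap :: "'c rel" and L :: "('s, 'f, 'r, 'q) lang"
    and T :: "('s, 'f, 'r, 'q, 'v, 'j) bu_sentence set" +
  fixes A :: "('o, 'm) cat" and F :: "('o, 'm, ('s, 'f, 'r, 'q, 'u) struct,
    ('s, 'f, 'r, 'q, 'u) struct \<times> ('s \<Rightarrow> 'u \<Rightarrow> 'u) \<times> ('s, 'f, 'r, 'q, 'u) struct) func"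
  assumes A: "mono_generated_category TYPE('u) lam A"
    and F: "is_functor A (mod_cat L T) F"
    and pres: "takes_directed_mono_colimits_to_colimits TYPE('u) lam A (mod_cat L T) F"
begin

lemma catA: "category A"
  using A unfolding mono_generated_category_def by blast

abbreviation Fmap :: "'m \<Rightarrow> 's \<Rightarrow> 'u \<Rightarrow> 'u" where
  "Fmap x \<equiv> amap (fa F x)"

lemmas F_hom = functor_hom[OF F]

lemma Fmap_in: "x \<in> hom A U X \<Longrightarrow> a \<in> carr (fo F U) s \<Longrightarrow> Fmap x s a \<in> carr (fo F X) s"
  using mod_hom_in[OF F_hom] .

lemma Fmap_cmp:
  assumes "w \<in> hom A U U'" "x \<in> hom A U' X" "a \<in> carr (fo F U) s"
  shows "Fmap (cmp A x w) s a = Fmap x s (Fmap w s a)"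
  using mod_cmp_apply[OF F_hom F_hom, OF assms] functor_cmp[OF F assms(1,2)] by simp

lemma F_model: "X \<in> ob A \<Longrightarrow> is_model L T (fo F X)"
  using functor_ob[OF F] by simp

lemma F_struct: "X \<in> ob A \<Longrightarrow> is_struct L (fo F X)"
  using F_model model_struct by blast

lemma hom_ob: "x \<in> hom A U X \<Longrightarrow> U \<in> ob A" "x \<in> hom A U X \<Longrightarrow> X \<in> ob A"
  using catA unfolding category_def hom_def by auto

lemma F_colimit:
  assumes "directed_mono_diagram lam (r :: 'u rel) A D" "is_colimit (poset_cat r) A D X k"
  shows "is_colimit (poset_cat r) Mod (func_comp F D) (fo F X) (\<lambda>i. fa F (k i))"
  using pres assms unfolding takes_directed_mono_colimits_to_colimits_def by blast

text \<open>
  The maps \<open>F(k\<^sub>i)\<close> need not be injective, so the diagram of the \<open>FD\<^sub>i\<close> says nothing about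
  generated models; the diagram of their images does, since it consists of inclusions.
\<close>

lemma image_into_generated:
  assumes X: "X \<in> ob A" and G: "generated_obj TYPE('u) lam Mod G" and g: "g \<in> hom Mod G (fo F X)"
  obtains D k where "generated_obj TYPE('u) lam A D" "k \<in> hom A D X" "mono_in A k"
    "\<And>s z. z \<in> carr G s \<Longrightarrow> amap g s z \<in> Fmap k s ` carr (fo F D) s"
proof -
  obtain r :: "'u rel" and D k where D: "directed_mono_diagram lam r A D"
    "is_colimit (poset_cat r) A D X k" "directed_poset lam r" "is_functor (poset_cat r) A D"
    "\<And>i. i \<in> Field r \<Longrightarrow> generated_obj TYPE('u) lam A (fo D i)"
    "\<And>i. i \<in> Field r \<Longrightarrow> k i \<in> hom A (fo D i) X"
    "\<And>i. i \<in> Field r \<Longrightarrow> mono_in A (k i)"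
    using generated_cover[OF A inf X] by blast
  note FD = functor_func_comp[OF D(4) F] and col = F_colimit[OF D(1,2)]
  let ?C = "\<lambda>i s. Fmap (k i) s ` carr (fo F (fo D i)) s"
  have C: "closed_under L (fo F X) (?C i)" if "i \<in> Field r" for i
    using image_closed_under[OF F_struct mod_hom(1)[OF F_hom]] D(6)[OF that] hom_ob(1) by blast
  have mono: "?C i s \<subseteq> ?C j s" if e: "(i, j) \<in> r" for i j s
  proof -
    have j: "j \<in> Field r" using e by (auto simp: Field_def)
    note E = poset_functor_hom[OF D(4) e]
    have ki: "k i = cmp A (k j) (fa D (i, j))" using cocone_edge[OF colimit_cocone[OF D(2)] e] by simp
    show ?thesis
    proof clarify
      fix a assume a: "a \<in> carr (fo F (fo D i)) s"
      show "Fmap (k i) s a \<in> ?C j s"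
        using Fmap_cmp[OF E D(6)[OF j] a] Fmap_in[OF E a] unfolding ki by simp
    qed
  qed
  have union: "\<exists>i \<in> Field r. x \<in> ?C i s" if "x \<in> carr (fo F X) s" for s x
    using colimit_jointly_surjective[OF D(3) FD col that] by (simp add: func_comp_def)
  obtain i where "i \<in> Field r" "\<And>s z. z \<in> carr G s \<Longrightarrow> amap g s z \<in> ?C i s"
    using generated_into_union[where C = ?C, OF D(3) F_model[OF X] C mono union G g] by blast
  then show ?thesis using that D(5-7) by blast
qed

text \<open>
  The parameters come from a generated \<open>E\<^sub>j\<close> with leg \<open>\<epsilon> : E\<^sub>j \<rightarrow> U\<close>. The composite \<open>x \<epsilon>\<close> factors
  through a generated \<open>D\<^sub>i\<close> over \<open>X\<close>, and by moving to a later stage \<open>i'\<close> one achieves that the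
  formula holds already in \<open>FD'\<close>, where \<open>D'\<close> is the object at stage \<open>i'\<close>. The back condition provides a span \<open>(x', y')\<close> that extends
  \<open>(x, y)\<close> and through which \<open>D' \<rightarrow> X\<close> factors. Thus the formula is carried from \<open>FD'\<close> through
  \<open>FU'\<close> and along \<open>Fy'\<close> to \<open>FY\<close>. That it then speaks about the images of the original parameters
  under \<open>Fy\<close> uses that \<open>x'\<close> is a monomorphism: the two ways from \<open>E\<^sub>j\<close> to \<open>U'\<close> agree over \<open>X\<close>.
\<close>

lemma span_positive_transfer:
  assumes S: "S \<subseteq> spans A X Y" and bk: "back_closed TYPE('u) lam A X S"
    and xy: "(x, y) \<in> S" and V: "|V| <o lam" and wf: "wf_fm lam L V \<phi>"
    and a: "\<And>v. v \<in> V \<Longrightarrow> a v \<in> carr (fo F (dm A x)) (snd v)"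
    and sat: "sat_fm L (fo F X) (\<lambda>v. Fmap x (snd v) (a v)) \<phi>"
  shows "sat_fm L (fo F Y) (\<lambda>v. Fmap y (snd v) (a v)) \<phi>"
proof -
  let ?U = "dm A x"
  note x = spans_homs(1)[OF S xy] and y = spans_homs(2)[OF S xy]
  obtain r' :: "'u rel" and E \<epsilon> where E: "directed_mono_diagram lam r' A E"
    "is_colimit (poset_cat r') A E ?U \<epsilon>" "directed_poset lam r'" "is_functor (poset_cat r') A E"
    "\<And>j. j \<in> Field r' \<Longrightarrow> generated_obj TYPE('u) lam A (fo E j)"
    "\<And>j. j \<in> Field r' \<Longrightarrow> \<epsilon> j \<in> hom A (fo E j) ?U"
    "\<And>j. j \<in> Field r' \<Longrightarrow> mono_in A (\<epsilon> j)"
    using generated_cover[OF A inf hom_ob(1)[OF x]] by blast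
  obtain r :: "'u rel" and D k where D: "directed_mono_diagram lam r A D"
    "is_colimit (poset_cat r) A D X k" "directed_poset lam r" "is_functor (poset_cat r) A D"
    "\<And>i. i \<in> Field r \<Longrightarrow> generated_obj TYPE('u) lam A (fo D i)"
    "\<And>i. i \<in> Field r \<Longrightarrow> k i \<in> hom A (fo D i) X"
    "\<And>i. i \<in> Field r \<Longrightarrow> mono_in A (k i)"
    using generated_cover[OF A inf hom_ob(2)[OF x]] by blast
  obtain j b where j: "j \<in> Field r'" and b: "\<And>v. v \<in> V \<Longrightarrow> b v \<in> carr (fo F (fo E j)) (snd v)"
    and ab: "\<And>v. v \<in> V \<Longrightarrow> Fmap (\<epsilon> j) (snd v) (b v) = a v"
    using colimit_tuple[where \<sigma> = snd, OF E(3) functor_func_comp[OF E(4) F] F_colimit[OF E(1,2)] V a]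
    unfolding func_comp_simps by blast
  note \<epsilon> = E(6)[OF j]
  note x\<epsilon> = cat_cmp_hom[OF catA \<epsilon> x]
  obtain i g where i: "i \<in> Field r" and g: "g \<in> hom A (fo E j) (fo D i)" "cmp A (k i) g = cmp A x (\<epsilon> j)"
    using generated_factor[OF E(5)[OF j] D(1,2) x\<epsilon>] .
  have gb: "Fmap g (snd v) (b v) \<in> carr (fo F (fo D i)) (snd v)" if "v \<in> V" for v
    using Fmap_in[OF g(1) b[OF that]] .
  have "Fmap x (snd v) (a v) = Fmap (k i) (snd v) (Fmap g (snd v) (b v))" if "v \<in> V" for v
    using Fmap_cmp[OF \<epsilon> x b[OF that]] Fmap_cmp[OF g(1) D(6)[OF i] b[OF that]] g(2) ab[OF that] by simp
  then obtain i' where e: "(i, i') \<in> r"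
    and sat': "sat_fm L (fo F (fo D i')) (\<lambda>v. Fmap (fa D (i, i')) (snd v) (Fmap g (snd v) (b v))) \<phi>"
    using colimit_sat_at_stage[OF D(3) functor_func_comp[OF D(4) F] F_colimit[OF D(1,2)] i, of V
        "\<lambda>v. Fmap g (snd v) (b v)" "\<lambda>v. Fmap x (snd v) (a v)" \<phi>] gb wf sat
    unfolding func_comp_simps by blast
  have i': "i' \<in> Field r" using e by (auto simp: Field_def)
  define g' where "g' = cmp A (fa D (i, i')) g"
  note De = poset_functor_hom[OF D(4) e]
  have g': "g' \<in> hom A (fo E j) (fo D i')" unfolding g'_def using cat_cmp_hom[OF catA g(1) De] .
  have kg': "cmp A (k i') g' = cmp A x (\<epsilon> j)"
    using cat_assoc[OF catA g(1) De D(6)[OF i']] cocone_edge[OF colimit_cocone[OF D(2)] e] g(2)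
    unfolding g'_def by simp
  obtain x' y' where xy': "(x', y') \<in> S" and fac: "factors_through A x' (k i')" and ext: "extends_span A x' y' x y"
    using bk xy D(5)[OF i'] D(6)[OF i'] D(7)[OF i'] unfolding back_closed_def by blast
  let ?U' = "dm A x'"
  note x' = spans_homs(1)[OF S xy'] and y' = spans_homs(2)[OF S xy']
  obtain t where t: "t \<in> hom A (fo D i') ?U'" "cmp A x' t = k i'"
    using fac D(6)[OF i'] unfolding factors_through_def by (auto simp: hom_def)
  obtain w where w: "w \<in> hom A ?U ?U'" "cmp A x' w = x" "cmp A y' w = y"
    using ext unfolding extends_span_def by blast
  \<comment> \<open>Both arrows into \<open>U'\<close> are equal after composition with the monomorphism \<open>x'\<close>.\<close>
  have tg: "cmp A t g' = cmp A w (\<epsilon> j)"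
  proof (rule mono_cancel[OF spans_homs(3)[OF S xy'] x' cat_cmp_hom[OF catA g' t(1)] cat_cmp_hom[OF catA \<epsilon> w(1)]])
    show "cmp A x' (cmp A t g') = cmp A x' (cmp A w (\<epsilon> j))"
      using cat_assoc[OF catA g' t(1) x'] cat_assoc[OF catA \<epsilon> w(1) x'] t(2) w(2) kg' by simp
  qed
  have g'b: "Fmap g' (snd v) (b v) \<in> carr (fo F (fo D i')) (snd v)" if "v \<in> V" for v
    using Fmap_in[OF g' b[OF that]] .
  have Dg': "Fmap g' (snd v) (b v) = Fmap (fa D (i, i')) (snd v) (Fmap g (snd v) (b v))" if "v \<in> V" for v
    using Fmap_cmp[OF g(1) De b[OF that]] unfolding g'_def .
  note y't = cat_cmp_hom[OF catA t(1) y']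
  have "Fmap y (snd v) (a v) = Fmap (cmp A y' t) (snd v) (Fmap g' (snd v) (b v))" if "v \<in> V" for v
  proof -
    note bv = b[OF that]
    have "Fmap y (snd v) (a v) = Fmap y' (snd v) (Fmap w (snd v) (Fmap (\<epsilon> j) (snd v) (b v)))"
      using Fmap_cmp[OF w(1) y' Fmap_in[OF \<epsilon> bv]] w(3) ab[OF that] by simp
    also have "\<dots> = Fmap y' (snd v) (Fmap t (snd v) (Fmap g' (snd v) (b v)))"
      using Fmap_cmp[OF \<epsilon> w(1) bv] Fmap_cmp[OF g' t(1) bv] tg by simp
    also have "\<dots> = Fmap (cmp A y' t) (snd v) (Fmap g' (snd v) (b v))"
      using Fmap_cmp[OF t(1) y' g'b[OF that]] by simp
    finally show ?thesis .
  qed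
  then have "Fmap y (snd v) (a v) =
      Fmap (cmp A y' t) (snd v) (Fmap (fa D (i, i')) (snd v) (Fmap g (snd v) (b v)))" if "v \<in> V" for v
    using Dg' that by simp
  then show ?thesis
    by (rule hom_sat[where V = V, OF F_struct[OF hom_ob(1)[OF y't]] mod_hom(1)[OF F_hom[OF y't]] _ _ wf sat', rotated])
      (use g'b Dg' in auto)
qed

text \<open>
  The sort of the two variables is the same, so they are told apart by boolean names.
\<close>

lemma span_transfer_eq:
  assumes S: "S \<subseteq> spans A X Y" "back_closed TYPE('u) lam A X S" "(x, y) \<in> S"
    and a: "a \<in> carr (fo F (dm A x)) s" "b \<in> carr (fo F (dm A x)) s"
    and eq: "Fmap x s a = Fmap x s b"
  shows "Fmap y s a = Fmap y s b"
proof -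
  let ?V = "{(False, s), (True, s)}"
  let ?\<phi> = "Eq (Var (False, s)) (Var (True, s)) :: ('s, 'f, 'r, 'q, bool, unit) fm"
  let ?c = "\<lambda>v :: bool \<times> 's. if fst v then b else a"
  have "sat_fm L (fo F Y) (\<lambda>v. Fmap y (snd v) (?c v)) ?\<phi>"
    by (rule span_positive_transfer[OF S finite_ordLess_Cinfinite[OF inf], of ?V])
      (use a eq in auto)
  then show ?thesis by simp
qed

text \<open>
  The argument positions of the relation serve as names of the variables.
\<close>

lemma span_transfer_rel:
  assumes S: "S \<subseteq> spans A X Y" "back_closed TYPE('u) lam A X S" "(x, y) \<in> S"
    and R: "R \<in> rels L" and a: "a \<in> rargs L (fo F (dm A x)) R"
    and rel: "tuple_map (rar L R) (rsort L R) (Fmap x) a \<in> rint (fo F X) R"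
  shows "tuple_map (rar L R) (rsort L R) (Fmap y) a \<in> rint (fo F Y) R"
proof -
  let ?V = "(\<lambda>p. (p, rsort L R p)) ` rar L R"
  let ?\<phi> = "Rel R (\<lambda>p. Var (p, rsort L R p)) :: ('s, 'f, 'r, 'q, 'q, unit) fm"
  let ?c = "\<lambda>v :: 'q \<times> 's. a (fst v)"
  have V: "|?V| <o lam" using card_of_image rar_small[OF R] by (rule ordLeq_ordLess_trans)
  have "sat_fm L (fo F Y) (\<lambda>v. Fmap y (snd v) (?c v)) ?\<phi>"
    by (rule span_positive_transfer[OF S V])
      (use R a rel in \<open>auto simp: rargs_def\<close>)
  then show ?thesis by simp
qed

end

section \<open>Image spans\<close>

context model_functor begin

definition image_carr :: "'m \<Rightarrow> 's \<Rightarrow> 'u set" where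
  "image_carr x s = Fmap x s ` carr (fo F (dm A x)) s"

definition image_struct :: "'m \<Rightarrow> ('s, 'f, 'r, 'q, 'u) struct" where
  "image_struct x = substruct L (fo F (cd A x)) (image_carr x)"

definition image_incl where
  "image_incl x = (image_struct x, incl (image_carr x), fo F (cd A x))"

text \<open>
  The second leg of the span on the image of \<open>Fx\<close> sends \<open>Fx(a)\<close> to \<open>Fy(a)\<close>; the preimage \<open>a\<close> is
  chosen, and \<open>image_map_apply\<close> shows that the choice does not matter for spans in a dense set.
\<close>

definition image_map where
  "image_map x y = (image_struct x,
     \<lambda>s. \<lambda>v \<in> image_carr x s. Fmap y s (inv_into (carr (fo F (dm A x)) s) (Fmap x s) v),
     fo F (cd A y))"

lemma carr_image_struct [simp]: "carr (image_struct x) = image_carr x"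
  by (simp add: image_struct_def)

lemma image_incl_arrow:
  assumes x: "x \<in> hom A U X"
  shows "closed_under L (fo F X) (image_carr x)"
    and "image_incl x \<in> hom Mod (image_struct x) (fo F X)"
    and "strong_embedding L (image_struct x) (fo F X) (amap (image_incl x))"
    and "v \<in> image_carr x s \<Longrightarrow> amap (image_incl x) s v = v"
proof -
  have dc: "dm A x = U" "cd A x = X" using x by (auto simp: hom_def)
  show C: "closed_under L (fo F X) (image_carr x)"
    unfolding image_carr_def dc
    using image_closed_under[OF F_struct[OF hom_ob(1)[OF x]] mod_hom(1)[OF F_hom[OF x]]] .
  show "image_incl x \<in> hom Mod (image_struct x) (fo F X)"
    using substruct_incl_model_arrow[OF F_model[OF hom_ob(2)[OF x]] C]
    by (simp add: image_incl_def image_struct_def dc)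
  show "strong_embedding L (image_struct x) (fo F X) (amap (image_incl x))"
    using incl_strong_embedding[OF C] by (simp add: image_incl_def image_struct_def dc)
qed (simp add: image_incl_def)

context
  fixes X Y S
  assumes S: "S \<subseteq> spans A X Y"
    and bk: "back_closed TYPE('u) lam A X S" "back_closed TYPE('u) lam A Y (S\<inverse>)"
begin

lemmas sp = spans_homs[OF S]

lemma transfer_eq_iff:
  assumes xy: "(x, y) \<in> S" and a: "a \<in> carr (fo F (dm A x)) s" "b \<in> carr (fo F (dm A x)) s"
  shows "Fmap x s a = Fmap x s b \<longleftrightarrow> Fmap y s a = Fmap y s b"
proof
  show "Fmap x s a = Fmap x s b \<Longrightarrow> Fmap y s a = Fmap y s b"
    using span_transfer_eq[OF S bk(1) xy a] .
  have yx: "(y, x) \<in> S\<inverse>" using xy by simp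
  show "Fmap y s a = Fmap y s b \<Longrightarrow> Fmap x s a = Fmap x s b"
    by (rule span_transfer_eq[OF spans_converse[OF S] bk(2) yx]) (use a sp(5)[OF xy] in simp_all)
qed

lemma transfer_rel_iff:
  assumes xy: "(x, y) \<in> S" and R: "R \<in> rels L" and a: "a \<in> rargs L (fo F (dm A x)) R"
  shows "tuple_map (rar L R) (rsort L R) (Fmap x) a \<in> rint (fo F X) R \<longleftrightarrow>
    tuple_map (rar L R) (rsort L R) (Fmap y) a \<in> rint (fo F Y) R"
proof
  show "tuple_map (rar L R) (rsort L R) (Fmap x) a \<in> rint (fo F X) R \<Longrightarrow>
      tuple_map (rar L R) (rsort L R) (Fmap y) a \<in> rint (fo F Y) R"
    using span_transfer_rel[OF S bk(1) xy R a] .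
  have yx: "(y, x) \<in> S\<inverse>" using xy by simp
  show "tuple_map (rar L R) (rsort L R) (Fmap y) a \<in> rint (fo F Y) R \<Longrightarrow>
      tuple_map (rar L R) (rsort L R) (Fmap x) a \<in> rint (fo F X) R"
    by (rule span_transfer_rel[OF spans_converse[OF S] bk(2) yx R]) (use a sp(5)[OF xy] in simp_all)
qed

lemma image_map_apply:
  assumes xy: "(x, y) \<in> S" and a: "a \<in> carr (fo F (dm A x)) s"
  shows "amap (image_map x y) s (Fmap x s a) = Fmap y s a"
proof -
  let ?b = "inv_into (carr (fo F (dm A x)) s) (Fmap x s) (Fmap x s a)"
  have im: "Fmap x s a \<in> Fmap x s ` carr (fo F (dm A x)) s" using a by blast
  have "?b \<in> carr (fo F (dm A x)) s" "Fmap x s ?b = Fmap x s a"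
    using inv_into_into[OF im] f_inv_into_f[OF im] by auto
  then have "Fmap y s ?b = Fmap y s a" using transfer_eq_iff[OF xy _ a] by blast
  then show ?thesis using im by (simp add: image_map_def image_carr_def)
qed

text \<open>
  Transfer from \<open>X\<close> to \<open>Y\<close> makes \<open>Fx(a) \<mapsto> Fy(a)\<close> a homomorphism, and transfer from \<open>Y\<close> to \<open>X\<close>
  makes it injective and lets it reflect the relations.
\<close>

lemma image_map_arrow:
  assumes xy: "(x, y) \<in> S"
  shows "image_map x y \<in> hom Mod (image_struct x) (fo F Y)"
    and "strong_embedding L (image_struct x) (fo F Y) (amap (image_map x y))"
    and "amap (image_map x y) s ` carr (image_struct x) s = Fmap y s ` carr (fo F (dm A y)) s"
proof -
  let ?U = "dm A x" and ?h = "amap (image_map x y)"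
  note x = sp(1)[OF xy] and y = sp(2)[OF xy] and app = image_map_apply[OF xy]
  have cd: "cd A x = X" "cd A y = Y" using x y by (auto simp: hom_def)
  note strX = F_struct[OF hom_ob(2)[OF x]] and strU = F_struct[OF hom_ob(1)[OF x]]
  note Fx = mod_hom(1)[OF F_hom[OF x]] and Fy = mod_hom(1)[OF F_hom[OF y]]
  have preimage: "\<exists>a \<in> (\<Pi>\<^sub>E p \<in> P. carr (fo F ?U) (\<sigma> p)). tuple_map P \<sigma> (Fmap x) a = v \<and>
      tuple_map P \<sigma> ?h v = tuple_map P \<sigma> (Fmap y) a"
    if v: "v \<in> (\<Pi>\<^sub>E p \<in> P. image_carr x (\<sigma> p))" for P \<sigma> v
  proof -
    obtain a where a: "a \<in> (\<Pi>\<^sub>E p \<in> P. carr (fo F ?U) (\<sigma> p))" "tuple_map P \<sigma> (Fmap x) a = v"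
      using tuple_preimage[OF v[unfolded image_carr_def]] by blast
    have "tuple_map P \<sigma> ?h v = tuple_map P \<sigma> (Fmap y) a"
      unfolding a(2)[symmetric] by (rule ext) (simp add: app PiE_mem[OF a(1)])
    then show ?thesis using a by blast
  qed
  have hom: "is_struct_hom L (image_struct x) (fo F Y) ?h"
    unfolding is_struct_hom_def
  proof (intro conjI allI ballI)
    have "?h s v \<in> carr (fo F Y) s" if "v \<in> image_carr x s" for s v
      using that app Fmap_in[OF y] unfolding image_carr_def by auto
    then show "?h s \<in> carr (image_struct x) s \<rightarrow>\<^sub>E carr (fo F Y) s" for s
      by (simp add: PiE_iff) (simp add: image_map_def)
  next
    fix f v assume f: "f \<in> funs L" and v: "v \<in> fargs L (image_struct x) f"
    have v': "v \<in> (\<Pi>\<^sub>E p \<in> far L f. image_carr x (fsort L f p))" using v by (simp add: fargs_def)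
    obtain a where a: "a \<in> fargs L (fo F ?U) f" "tuple_map (far L f) (fsort L f) (Fmap x) a = v"
      "tuple_map (far L f) (fsort L f) ?h v = tuple_map (far L f) (fsort L f) (Fmap y) a"
      using preimage[OF v'] unfolding fargs_def by blast
    have "fint (image_struct x) f v = fint (fo F X) f v"
      using f v' by (simp add: image_struct_def substruct_def cd)
    also have "\<dots> = Fmap x (fres L f) (fint (fo F ?U) f a)"
      using struct_hom_fint[OF Fx f a(1)] a(2) by simp
    finally have "?h (fres L f) (fint (image_struct x) f v) = Fmap y (fres L f) (fint (fo F ?U) f a)"
      using app[OF struct_fint[OF strU f a(1)]] by simp
    then show "?h (fres L f) (fint (image_struct x) f v) = fint (fo F Y) f (tuple_map (far L f) (fsort L f) ?h v)"
      using struct_hom_fint[OF Fy f a(1)] a(3) by simp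
  next
    fix R v assume R: "R \<in> rels L" and v: "v \<in> rint (image_struct x) R"
    have v': "v \<in> (\<Pi>\<^sub>E p \<in> rar L R. image_carr x (rsort L R p))" and vX: "v \<in> rint (fo F X) R"
      using v R by (auto simp: image_struct_def substruct_def cd)
    obtain a where a: "a \<in> rargs L (fo F ?U) R" "tuple_map (rar L R) (rsort L R) (Fmap x) a = v"
      "tuple_map (rar L R) (rsort L R) ?h v = tuple_map (rar L R) (rsort L R) (Fmap y) a"
      using preimage[OF v'] unfolding rargs_def by blast
    show "tuple_map (rar L R) (rsort L R) ?h v \<in> rint (fo F Y) R"
      using transfer_rel_iff[OF xy R a(1)] a vX by simp
  qed
  show "image_map x y \<in> hom Mod (image_struct x) (fo F Y)"
    using hom mod_hom(2)[OF image_incl_arrow(2)[OF x]] F_model[OF hom_ob(2)[OF y]]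
    by (simp add: hom_mod_cat) (simp add: image_map_def cd)
  show "strong_embedding L (image_struct x) (fo F Y) ?h"
    unfolding strong_embedding_def
  proof (intro conjI allI ballI impI)
    show "is_struct_hom L (image_struct x) (fo F Y) ?h" by (rule hom)
    show "inj_on (?h s) (carr (image_struct x) s)" for s
    proof (rule inj_onI)
      fix v v' assume vv: "v \<in> carr (image_struct x) s" "v' \<in> carr (image_struct x) s" and eq: "?h s v = ?h s v'"
      obtain a b where ab: "a \<in> carr (fo F ?U) s" "v = Fmap x s a" "b \<in> carr (fo F ?U) s" "v' = Fmap x s b"
        using vv by (auto simp: image_carr_def)
      show "v = v'" using transfer_eq_iff[OF xy ab(1,3)] app[OF ab(1)] app[OF ab(3)] eq ab(2,4) by simp
    qed
    fix R v assume R: "R \<in> rels L" and v: "v \<in> rargs L (image_struct x) R"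
      and hv: "tuple_map (rar L R) (rsort L R) ?h v \<in> rint (fo F Y) R"
    have v': "v \<in> (\<Pi>\<^sub>E p \<in> rar L R. image_carr x (rsort L R p))" using v by (simp add: rargs_def)
    obtain a where a: "a \<in> rargs L (fo F ?U) R" "tuple_map (rar L R) (rsort L R) (Fmap x) a = v"
      "tuple_map (rar L R) (rsort L R) ?h v = tuple_map (rar L R) (rsort L R) (Fmap y) a"
      using preimage[OF v'] unfolding rargs_def by blast
    have "v \<in> rint (fo F X) R" using transfer_rel_iff[OF xy R a(1)] a hv by simp
    then show "v \<in> rint (image_struct x) R" using R v' by (simp add: image_struct_def substruct_def cd)
  qed
  show "?h s ` carr (image_struct x) s = Fmap y s ` carr (fo F (dm A y)) s"
    using app sp(5)[OF xy] by (auto simp: image_carr_def image_image)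
qed

lemma image_span:
  assumes xy: "(x, y) \<in> S"
  shows "(image_incl x, image_map x y) \<in> spans Mod (fo F X) (fo F Y)"
proof -
  note i = image_incl_arrow(2,3)[OF sp(1)[OF xy]] and m = image_map_arrow(1,2)[OF xy]
  have "mono_in Mod (image_incl x)" "mono_in Mod (image_map x y)"
    using mod_injective_mono[OF i(1)] i(2) mod_injective_mono[OF m(1)] m(2)
    unfolding strong_embedding_def by blast+
  then show ?thesis using i(1) m(1) by (simp add: spans_def hom_def)
qed

text \<open>
  If \<open>x = x' w\<close>, the image of \<open>Fx\<close> is contained in that of \<open>Fx'\<close>, and the inclusion is the
  connecting arrow.
\<close>

lemma image_extends_span:
  assumes xy: "(x, y) \<in> S" and xy': "(x', y') \<in> S" and ext: "extends_span A x' y' x y"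
  shows "extends_span Mod (image_incl x') (image_map x' y') (image_incl x) (image_map x y)"
proof -
  note x = sp(1)[OF xy] and x' = sp(1)[OF xy'] and y' = sp(2)[OF xy']
  obtain w where w: "w \<in> hom A (dm A x) (dm A x')" "cmp A x' w = x" "cmp A y' w = y"
    using ext unfolding extends_span_def by blast
  have x_eq: "Fmap x s a = Fmap x' s (Fmap w s a)" if "a \<in> carr (fo F (dm A x)) s" for s a
    using Fmap_cmp[OF w(1) x' that] w(2) by simp
  have y_eq: "Fmap y s a = Fmap y' s (Fmap w s a)" if "a \<in> carr (fo F (dm A x)) s" for s a
    using Fmap_cmp[OF w(1) y' that] w(3) by simp
  have sub: "image_carr x s \<subseteq> image_carr x' s" for s
    using x_eq Fmap_in[OF w(1)] unfolding image_carr_def by force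
  let ?i = "(image_struct x, incl (image_carr x), image_struct x')"
  have cd: "cd A x = X" "cd A x' = X" using x x' by (auto simp: hom_def)
  have i: "?i \<in> hom Mod (image_struct x) (image_struct x')"
    using substruct_incl_arrow[OF F_model[OF hom_ob(2)[OF x]] image_incl_arrow(1)[OF x] image_incl_arrow(1)[OF x'] sub]
    by (simp add: image_struct_def cd)
  have "cmp Mod (image_incl x') ?i = image_incl x"
    by (rule mod_arrow_eqI[OF mod_cmp_hom[OF i image_incl_arrow(2)[OF x']] image_incl_arrow(2)[OF x]])
      (use subsetD[OF sub] in \<open>simp add: mod_cmp_apply[OF i image_incl_arrow(2)[OF x']]
        image_incl_arrow(4)[OF x] image_incl_arrow(4)[OF x']\<close>)
  moreover have "cmp Mod (image_map x' y') ?i = image_map x y"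
  proof (rule mod_arrow_eqI[OF mod_cmp_hom[OF i image_map_arrow(1)[OF xy']] image_map_arrow(1)[OF xy]])
    fix s v assume v: "v \<in> carr (image_struct x) s"
    then obtain a where a: "a \<in> carr (fo F (dm A x)) s" "v = Fmap x s a" by (auto simp: image_carr_def)
    have "amap (image_map x' y') s v = Fmap y' s (Fmap w s a)"
      using image_map_apply[OF xy' Fmap_in[OF w(1) a(1)]] x_eq[OF a(1)] a(2) by simp
    also have "\<dots> = amap (image_map x y) s v"
      using image_map_apply[OF xy a(1)] y_eq[OF a(1)] a(2) by simp
    finally show "amap (cmp Mod (image_map x' y') ?i) s v = amap (image_map x y) s v"
      using mod_cmp_apply[OF i image_map_arrow(1)[OF xy'] v] v by simp
  qed
  ultimately show ?thesis unfolding extends_span_def using i by (auto simp: image_incl_def image_map_def)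
qed

end

text \<open>
  Once the values of \<open>g\<close> lie in the image of \<open>Fk\<close>, and \<open>k\<close> factors through \<open>x\<close>, they lie in the
  image of \<open>Fx\<close>, which is also the image of the strong embedding \<open>e\<close>.
\<close>

lemma factors_through_leg:
  assumes e: "e \<in> hom Mod M N" "strong_embedding L M N (amap e)"
    and im: "\<And>s. amap e s ` carr M s = Fmap x s ` carr (fo F (dm A x)) s"
    and x: "x \<in> hom A U X" and k: "k \<in> hom A D X" and fac: "factors_through A x k"
    and g: "g \<in> hom Mod G N" and gk: "\<And>s z. z \<in> carr G s \<Longrightarrow> amap g s z \<in> Fmap k s ` carr (fo F D) s"
  shows "factors_through Mod e g"
proof -
  have dm: "dm A x = U" "dm A k = D" using x k by (auto simp: hom_def)
  obtain t where t: "t \<in> hom A D U" "cmp A x t = k" using fac dm unfolding factors_through_def by auto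
  have "amap g s z \<in> amap e s ` carr M s" if z: "z \<in> carr G s" for s z
  proof -
    obtain c where c: "c \<in> carr (fo F D) s" "amap g s z = Fmap k s c" using gk[OF z] by blast
    have "Fmap k s c = Fmap x s (Fmap t s c)" using Fmap_cmp[OF t(1) x c(1)] t(2) by simp
    then show ?thesis unfolding im dm using Fmap_in[OF t(1) c(1)] c(2) by auto
  qed
  then obtain t' where "t' \<in> hom Mod G M" "cmp Mod e t' = g" using strong_embedding_factors[OF e g] by blast
  then show ?thesis unfolding factors_through_def using mod_hom(4)[OF g] mod_hom(4)[OF e(1)] by auto
qed

text \<open>
  Stated for an arbitrary family of strong embeddings with the images of the \<open>Fx\<close>, since it is
  needed for the inclusions over \<open>X\<close> and, for the converse set of spans, for the legs over \<open>Y\<close>. The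
  converse image spans are not the image spans of the converse: their apex is still a substructure
  of \<open>FX\<close>.
\<close>

lemma legs_back_closed:
  assumes S: "S \<subseteq> spans A X Y" and bk: "back_closed TYPE('u) lam A X S"
    and p: "\<And>x y. (x, y) \<in> S \<Longrightarrow> p x y \<in> hom Mod (M x y) (fo F X)"
      "\<And>x y. (x, y) \<in> S \<Longrightarrow> strong_embedding L (M x y) (fo F X) (amap (p x y))"
      "\<And>x y s. (x, y) \<in> S \<Longrightarrow> amap (p x y) s ` carr (M x y) s = Fmap x s ` carr (fo F (dm A x)) s"
    and ext: "\<And>x y x' y'. (x, y) \<in> S \<Longrightarrow> (x', y') \<in> S \<Longrightarrow> extends_span A x' y' x y \<Longrightarrow>
      extends_span Mod (p x' y') (q x' y') (p x y) (q x y)"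
  shows "back_closed TYPE('u) lam Mod (fo F X) ((\<lambda>(x, y). (p x y, q x y)) ` S)"
  unfolding back_closed_def
proof (intro allI impI)
  fix a b G g assume ab: "(a, b) \<in> (\<lambda>(x, y). (p x y, q x y)) ` S"
    and G: "generated_obj TYPE('u) lam Mod G" and g: "g \<in> hom Mod G (fo F X)"
  obtain x y where xy: "(x, y) \<in> S" "a = p x y" "b = q x y" using ab by auto
  obtain D k where k: "generated_obj TYPE('u) lam A D" "k \<in> hom A D X" "mono_in A k"
    "\<And>s z. z \<in> carr G s \<Longrightarrow> amap g s z \<in> Fmap k s ` carr (fo F D) s"
    using image_into_generated[OF hom_ob(2)[OF spans_homs(1)[OF S xy(1)]] G g] by blast
  obtain x' y' where xy': "(x', y') \<in> S" "factors_through A x' k" "extends_span A x' y' x y"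
    using bk xy(1) k(1-3) unfolding back_closed_def by blast
  have "factors_through Mod (p x' y') g"
    using factors_through_leg[OF p(1,2,3)[OF xy'(1)] spans_homs(1)[OF S xy'(1)] k(2) xy'(2) g k(4)] .
  moreover have "extends_span Mod (p x' y') (q x' y') a b" using ext[OF xy(1) xy'(1,3)] xy(2,3) by simp
  moreover have "(p x' y', q x' y') \<in> (\<lambda>(x, y). (p x y, q x y)) ` S"
    using xy'(1) by (simp add: rev_image_eqI)
  ultimately show "\<exists>x' y'. (x', y') \<in> (\<lambda>(x, y). (p x y, q x y)) ` S \<and>
      factors_through Mod x' g \<and> extends_span Mod x' y' a b"
    by blast
qed

lemma extends_span_swap:
  assumes "extends_span C x' y' x y" "dm C x = dm C y" "dm C x' = dm C y'"
  shows "extends_span C y' x' y x"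
  using assms unfolding extends_span_def by metis

theorem functor_to_models_preserves_embeddings:
  assumes f: "is_embedding TYPE('u) lam A f"
  shows "is_embedding TYPE('u) lam Mod (fa F f)"
proof -
  obtain X Y S where fXY: "f \<in> hom A X Y" and S: "S \<noteq> {}" "S \<subseteq> spans A X Y"
    and bk: "back_closed TYPE('u) lam A X S" "back_closed TYPE('u) lam A Y (S\<inverse>)"
    and fS: "\<And>G g. generated_obj TYPE('u) lam A G \<Longrightarrow> g \<in> hom A G X \<Longrightarrow> mono_in A g \<Longrightarrow>
      \<exists>u v. (u, v) \<in> S \<and> (\<exists>t \<in> hom A G (dm A u). cmp A u t = g \<and> cmp A v t = cmp A f g)"
    using embeddingE[OF A f] by metis
  note sp = spans_homs[OF S(2)] and im = image_map_arrow[OF S(2) bk]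
    and ext = image_extends_span[OF S(2) bk]
  let ?S = "(\<lambda>(x, y). (image_incl x, image_map x y)) ` S"
  have incl_image: "amap (image_incl x) s ` carr (image_struct x) s = Fmap x s ` carr (fo F (dm A x)) s"
    for x s by (auto simp: image_incl_def image_carr_def)
  have "?S \<subseteq> spans Mod (fo F X) (fo F Y)" using image_span[OF S(2) bk] by auto
  moreover have "back_closed TYPE('u) lam Mod (fo F X) ?S"
    by (rule legs_back_closed[OF S(2) bk(1), where M = "\<lambda>x y. image_struct x"])
      (use image_incl_arrow(2,3)[OF sp(1)] incl_image ext in blast)+
  moreover have "back_closed TYPE('u) lam Mod (fo F Y) (?S\<inverse>)"
  proof -
    have "back_closed TYPE('u) lam Mod (fo F Y) ((\<lambda>(y, x). (image_map x y, image_incl x)) ` (S\<inverse>))"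
    proof (rule legs_back_closed[OF spans_converse[OF S(2)] bk(2), where M = "\<lambda>y x. image_struct x"])
      fix y x y' x' assume xy: "(y, x) \<in> S\<inverse>" "(y', x') \<in> S\<inverse>" and e: "extends_span A y' x' y x"
      have "extends_span A x' y' x y"
        using extends_span_swap[OF e] sp(5)[of x y] sp(5)[of x' y'] xy by simp
      then show "extends_span Mod (image_map x' y') (image_incl x') (image_map x y) (image_incl x)"
        using extends_span_swap[OF ext] xy by (simp add: image_incl_def image_map_def)
    qed (use im in auto)
    moreover have "?S\<inverse> = (\<lambda>(y, x). (image_map x y, image_incl x)) ` (S\<inverse>)" by force
    ultimately show ?thesis by simp
  qed
  ultimately have dense: "dense_spans TYPE('u) lam Mod (fo F X) (fo F Y) ?S"
    using S(1) unfolding dense_spans_iff by simp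
  moreover have "\<exists>(u, v) \<in> ?S. \<exists>t \<in> hom Mod G (dm Mod u). cmp Mod u t = g \<and> cmp Mod v t = cmp Mod (fa F f) g"
    if G: "generated_obj TYPE('u) lam Mod G" and g: "g \<in> hom Mod G (fo F X)" for G g
  proof -
    obtain D k where k: "generated_obj TYPE('u) lam A D" "k \<in> hom A D X" "mono_in A k"
      "\<And>s z. z \<in> carr G s \<Longrightarrow> amap g s z \<in> Fmap k s ` carr (fo F D) s"
      using image_into_generated[OF hom_ob(1)[OF fXY] G g] by blast
    obtain u v t where uv: "(u, v) \<in> S" and t: "t \<in> hom A D (dm A u)" "cmp A u t = k" "cmp A v t = cmp A f k"
      using fS[OF k(1-3)] by blast
    note u = sp(1)[OF uv] and v = sp(2)[OF uv]
    note iu = image_incl_arrow(2,3)[OF u] and iv = im(1)[OF uv]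
    have "factors_through A u k" unfolding factors_through_def using t k(2) by (auto simp: hom_def)
    then have "factors_through Mod (image_incl u) g"
      using factors_through_leg[OF iu incl_image u k(2) _ g k(4)] by blast
    then obtain t' where t': "t' \<in> hom Mod G (image_struct u)" "cmp Mod (image_incl u) t' = g"
      unfolding factors_through_def using mod_hom(4)[OF g] mod_hom(4)[OF iu(1)] by auto
    have "cmp Mod (image_map u v) t' = cmp Mod (fa F f) g"
    proof (rule mod_arrow_eqI[OF mod_cmp_hom[OF t'(1) iv] mod_cmp_hom[OF g F_hom[OF fXY]]])
      fix s z assume z: "z \<in> carr G s"
      obtain c where c: "c \<in> carr (fo F D) s" "amap g s z = Fmap k s c" using k(4)[OF z] by blast
      have "amap t' s z = amap g s z"
        using mod_cmp_apply[OF t'(1) iu(1) z] t'(2) mod_hom_in[OF t'(1) z] image_incl_arrow(4)[OF u] by simp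
      also have "\<dots> = Fmap u s (Fmap t s c)" using Fmap_cmp[OF t(1) u c(1)] t(2) c(2) by simp
      finally have "amap (image_map u v) s (amap t' s z) = Fmap v s (Fmap t s c)"
        using image_map_apply[OF S(2) bk uv Fmap_in[OF t(1) c(1)]] by simp
      also have "\<dots> = Fmap f s (amap g s z)"
        using Fmap_cmp[OF t(1) v c(1)] Fmap_cmp[OF k(2) fXY c(1)] t(3) c(2) by simp
      finally show "amap (cmp Mod (image_map u v) t') s z = amap (cmp Mod (fa F f) g) s z"
        using mod_cmp_apply[OF t'(1) iv z] mod_cmp_apply[OF g F_hom[OF fXY] z] by simp
    qed
    then show ?thesis using uv t' mod_hom(4)[OF iu(1)] by force
  qed
  ultimately show ?thesis using embeddingI[OF F_hom[OF fXY]] by blast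
qed

end

section \<open>Preservation of embeddings\<close>

theorem theorem3p10:
  fixes lam :: "'k rel" and A :: "('o, 'm) cat" and f :: 'm
  assumes "regular_cardinal lam"
    and "mono_generated_category TYPE('u) lam A"
    and "is_embedding TYPE('u) lam A f"
  shows
    "(\<forall>(B :: ('p, 'n) cat) F.
        category B \<longrightarrow> is_functor A B F \<longrightarrow> preserves_monos A B F \<longrightarrow>
        takes_directed_mono_colimits_to_colimits TYPE('u) lam A B F \<longrightarrow>
        is_embedding TYPE('u) lam B (fa F f))
     \<and>
     (\<forall>(kap :: 'c rel) (L :: ('s, 'f, 'r, 'q) lang) (T :: ('s, 'f, 'r, 'q, 'v, 'j) bu_sentence set)
        (F :: ('o, 'm, ('s, 'f, 'r, 'q, 'u) struct, _) func).
        Cinfinite kap \<longrightarrow> kap \<le>o lam \<longrightarrow> is_lang kap L \<longrightarrow> bu_theory lam kap L T \<longrightarrow>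
        is_functor A (mod_cat L T) F \<longrightarrow>
        takes_directed_mono_colimits_to_colimits TYPE('u) lam A (mod_cat L T) F \<longrightarrow>
        is_embedding TYPE('u) lam (mod_cat L T) (fa F f))"
proof -
  have inf: "Cinfinite lam" using assms(1) unfolding regular_cardinal_def by blast
  show ?thesis
  proof (intro conjI allI impI)
    fix B :: "('p, 'n) cat" and F
    assume "category B" "is_functor A B F" "preserves_monos A B F"
      "takes_directed_mono_colimits_to_colimits TYPE('u) lam A B F"
    then show "is_embedding TYPE('u) lam B (fa F f)"
      using mono_functor_preserves_embeddings[OF assms(2) inf _ _ _ _ assms(3)] by blast
  next
    fix kap :: "'c rel" and L :: "('s, 'f, 'r, 'q) lang" and T :: "('s, 'f, 'r, 'q, 'v, 'j) bu_sentence set"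
      and F :: "('o, 'm, ('s, 'f, 'r, 'q, 'u) struct, _) func"
    assume "kap \<le>o lam" "is_lang kap L" "bu_theory lam kap L T" "is_functor A (mod_cat L T) F"
      "takes_directed_mono_colimits_to_colimits TYPE('u) lam A (mod_cat L T) F"
    then interpret model_functor lam kap L T A F
      using inf assms(2) by unfold_locales
    show "is_embedding TYPE('u) lam (mod_cat L T) (fa F f)"
      using functor_to_models_preserves_embeddings[OF assms(3)] .
  qed
qed

end
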